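(* Let $\mathscr M$ be any set of decorated representations of $\Lambda$ supported in $[n]$, and let $\mathcal N$ be any decorated representation of $\Lambda$ supported in $[n]$. If $CC_{\Lambda_{\mathrm{prin}}}(\mathcal N)$ belongs to the $R_{\mathrm{prin}}$-submodule of $R_{\mathrm{prin}}[x_1^{\pm1},\dots,x_n^{\pm1}]$ spanned by $CC_{\Lambda_{\mathrm{prin}}}(\mathscr M)$, then $CC_{\widetilde\Lambda}(\mathcal N)$ belongs to the $R$-submodule of $R[x_1^{\pm1},\dots,x_n^{\pm1}]$ spanned by $CC_{\widetilde\Lambda}(\mathscr M)$. Consequently, if $CC_{\Lambda_{\mathrm{prin}}}(\mathscr M)$ spans the Caldero–Chapoton algebra $\mathcal{CC}_{\Lambda_{\mathrm{prin}}}(\Lambda)$ over the ground ring $R_{\mathrm{prin}}$, then $CC_{\widetilde\Lambda}(\mathscr M)$ spans the Caldero–Chapoton algebra $\mathcal{CC}_{\widetilde\Lambda}(\Lambda)$ over the ground ring $R$.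
   Context: Let $n\ge 1$, $m\ge 0$ be integers and $[\ell]=\{1,\dots,\ell\}$. Let $\widetilde Q$ be a finite quiver with vertex set $[n+m]$ and arrows $a\colon s(a)\to t(a)$; $Q$ is the quiver with the same vertex set $[n+m]$ whose arrows are the arrows of $\widetilde Q$ with both endpoints in $[n]$. Paths are composed from right to left. $\mathbb C\langle\langle \widetilde Q\rangle\rangle$ and $\mathbb C\langle\langle Q\rangle\rangle$ are the complete path algebras, with arrow ideals $\widetilde{\mathfrak m}$, $\mathfrak m$ and the corresponding adic topologies. $\widehat\rho\colon \mathbb C\langle\langle \widetilde Q\rangle\rangle\to\mathbb C\langle\langle Q\rangle\rangle$ is the continuous $\mathbb C$-algebra homomorphism that is the identity on vertex idempotents and on arrows of $Q$ and sends all other arrows to $0$. $\widetilde{\mathcal J}\subseteq\widetilde{\mathfrak m}^2$ is a closed two-sided ideal, $\mathcal J:=\widehat\rho(\widetilde{\mathcal J})$, $\widetilde\Lambda:=\mathbb C\langle\langle \widetilde Q\rangle\rangle/\widetilde{\mathcal J}$ and $\Lambda:=\mathbb C\langle\langle Q\rangle\rangle/\mathcal J$ (neither is assumed finite-dimensional). Via $\widehat\rho$, every left $\Lambda$-module is a left $\widetilde\Lambda$-module. $\widetilde B\in\mathbb Z^{(n+m)\times n}$ has entries $\widetilde b_{ij}=\#\{\text{arrows } j\to i\text{ in }\widetilde Q\}-\#\{\text{arrows } i\to j\text{ in }\widetilde Q\}$, and $B$ is its top $n\times n$ submatrix. A decorated representation of $\Lambda$ is a pair $\mathcal M=(M,\mathbf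 v)$ with $M$ a finite-dimensional left $\Lambda$-module and $\mathbf v\in\mathbb Z_{\ge0}^{n+m}$; it is supported in $[n]$ if $M_j=0$ and $v_j=0$ for all $j\in\{n+1,\dots,n+m\}$. $S(i)$ is the simple module at vertex $i$. For $\mathcal M$ supported in $[n]$, the extended $\mathbf g$-vector $\widetilde{\mathbf g}_{\mathcal M}^{\widetilde\Lambda}=(\widetilde g_i)_{i=1}^{n+m}$ is $\widetilde g_i=-\dim\mathrm{Hom}_{\widetilde\Lambda}(S(i),M)+\dim\mathrm{Ext}^1_{\widetilde\Lambda}(S(i),M)+v_i$. Let $R:=\mathbb Q[x_{n+1}^{\pm1},\dots,x_{n+m}^{\pm1}]$. For $\mathcal M=(M,\mathbf v)$ supported in $[n]$, $$CC_{\widetilde\Lambda}(\mathcal M):=\sum_{\mathbf e\in\mathbb Z_{\ge0}^n}\chi(\mathrm{Gr}_{\mathbf e}(M))\,\mathbf x^{\widetilde B\mathbf e+\widetilde{\mathbf g}_{\mathcal M}^{\widetilde\Lambda}},\qquad \mathbf x^{\mathbf f}:=x_1^{f_1}\cdots x_{n+m}^{f_{n+m}},$$ where $\mathrm{Gr}_{\mathbf e}(M)$ is the quiver Grassmannian of subrepresentations of $M$ with dimension vector $\mathbf e$ and $\chi$ is the Euler characteristic; for a set $\mathscr M$, $CC_{\widetilde\Lambda}(\mathscr M)=\{CC_{\widetilde\Lambda}(\mathcal M)\mid\mathcal M\in\mathscr M\}$. The Caldero–Chapoton algebra $\mathcal{CC}_{\widetilde\Lambda}(\Lambda)$ is the $R$-submodule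 of $R[x_1^{\pm1},\dots,x_n^{\pm1}]$ spanned by all $CC_{\widetilde\Lambda}(\mathcal M)$, $\mathcal M$ a decorated representation of $\Lambda$ supported in $[n]$. Principal coefficients: $Q_{\mathrm{prin}}$ is obtained from $Q$ by deleting the vertices $n+1,\dots,n+m$ and adding $n$ vertices $1',\dots,n'$ and exactly one arrow $j\to j'$ for each $j\in[n]$; $j'$ is numbered $n+j$. $\Lambda_{\mathrm{prin}}:=\mathbb C\langle\langle Q_{\mathrm{prin}}\rangle\rangle/\mathcal J_{\mathrm{prin}}$, with $\mathcal J_{\mathrm{prin}}$ the two-sided ideal generated by $\mathcal J$. $R_{\mathrm{prin}}:=\mathbb Q[x_{n+1}^{\pm1},\dots,x_{n+n}^{\pm1}]$. Let $B_{\mathrm{prin}}=\begin{bmatrix}B\\ I_n\end{bmatrix}\in\mathbb Z^{(n+n)\times n}$ ($I_n$ the identity matrix). Decorated representations $\mathcal M=(M,\mathbf v)$ of $\Lambda$ supported in $[n]$ are viewed as decorated representations of $\Lambda_{\mathrm{prin}}$ supported on the vertices $[n]$ of $Q_{\mathrm{prin}}$ (so that $M_{j'}=0$ and the entry of $\mathbf v$ at $j'$ is $0$ for all $j\in[n]$). For such $\mathcal M$, the extended $\mathbf g$-vector $\widetilde{\mathbf g}_{\mathcal M}^{\Lambda_{\mathrm{prin}}}\in\mathbb Z^{n+n}$ has $i$-th entry $-\dim\mathrm{Hom}_{\Lambda_{\mathrm{prin}}}(S(i),M)+\dim\mathrm{Ext}^1_{\Lambda_{\mathrm{prin}}}(S(i),M)+v_i$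 for $i\in[n+n]$, and $$CC_{\Lambda_{\mathrm{prin}}}(\mathcal M):=\sum_{\mathbf e\in\mathbb Z_{\ge0}^n}\chi(\mathrm{Gr}_{\mathbf e}(M))\,\mathbf x^{B_{\mathrm{prin}}\mathbf e+\widetilde{\mathbf g}_{\mathcal M}^{\Lambda_{\mathrm{prin}}}},\qquad \mathbf x^{\mathbf f}:=x_1^{f_1}\cdots x_{n+n}^{f_{n+n}}\ \text{ for }\mathbf f\in\mathbb Z^{n+n};$$ for a set $\mathscr M$ of decorated representations of $\Lambda$ supported in $[n]$, $CC_{\Lambda_{\mathrm{prin}}}(\mathscr M)=\{CC_{\Lambda_{\mathrm{prin}}}(\mathcal M)\mid\mathcal M\in\mathscr M\}$. The Caldero–Chapoton algebra $\mathcal{CC}_{\Lambda_{\mathrm{prin}}}(\Lambda)$ is the $R_{\mathrm{prin}}$-submodule of $R_{\mathrm{prin}}[x_1^{\pm1},\dots,x_n^{\pm1}]$ spanned by all $CC_{\Lambda_{\mathrm{prin}}}(\mathcal M)$, $\mathcal M$ a decorated representation of $\Lambda$ supported in $[n]$. *)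

theory Defs
  imports
    "HOL-Algebra.QuotRing"
    "HOL-Algebra.Ideal_Product"
    "HOL-Homology.Homology"
    "HOL-Library.Poly_Mapping"
    "Jordan_Normal_Form.VS_Connect"
    "Graph_Theory.Graph_Theory"
begin

hide_const (open) Multiset.mult Polynomial.smult Wellorder_Constructions.zero

section \<open>Complete path algebras\<close>

text \<open>
  A path is a pair of its starting vertex and the list of its arrows in the order in which they are
  traversed; \<open>(u, [])\<close> is the trivial path at \<open>u\<close>. An element of the complete path algebra is an
  arbitrary complex-valued function on paths, extended by zero to all pairs that are not paths.
\<close>

type_synonym 'a path_series = "nat \<times> 'a list \<Rightarrow> complex"

definition paths :: "(nat, 'a) pre_digraph \<Rightarrow> (nat \<times> 'a list) set" where
  "paths Q = {(u, p). \<exists>v. pre_digraph.awalk Q u p v}"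

text \<open>
  Paths compose from right to left: in the product \<open>f g\<close>, the coefficient of a path collects all its
  factorisations in which the path taken from \<open>g\<close> is traversed first. The sum is finite even though
  \<open>f\<close> and \<open>g\<close> may have infinite support.
\<close>

definition path_algebra :: "(nat, 'a) pre_digraph \<Rightarrow> 'a path_series ring" where
  "path_algebra Q = \<lparr>
     carrier = {f. \<forall>x. x \<notin> paths Q \<longrightarrow> f x = 0},
     mult = (\<lambda>f g. \<lambda>(u, p). \<Sum>k\<le>length p.
               f (pre_digraph.awlast Q u (take k p), drop k p) * g (u, take k p)),
     one = (\<lambda>(u, p). if u \<in> verts Q \<and> p = [] then 1 else 0),
     zero = (\<lambda>_. 0),
     add = (\<lambda>f g x. f x + g x)\<rparr>"

definition idem :: "nat \<Rightarrow> 'a path_series" where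
  "idem i = (\<lambda>x. if x = (i, []) then 1 else 0)"

definition const_series :: "(nat, 'a) pre_digraph \<Rightarrow> complex \<Rightarrow> 'a path_series" where
  "const_series Q c = (\<lambda>(u, p). if u \<in> verts Q \<and> p = [] then c else 0)"

definition arrow_ideal :: "(nat, 'a) pre_digraph \<Rightarrow> 'a path_series set" where
  "arrow_ideal Q = {f \<in> carrier (path_algebra Q). \<forall>u. f (u, []) = 0}"

primrec ideal_power :: "('r, 's) ring_scheme \<Rightarrow> 'r set \<Rightarrow> nat \<Rightarrow> 'r set" where
  "ideal_power R I 0 = carrier R"
| "ideal_power R I (Suc k) = ideal_prod R I (ideal_power R I k)"

definition adic_topology :: "('r, 's) ring_scheme \<Rightarrow> 'r set \<Rightarrow> 'r topology" where
  "adic_topology R I = topology (\<lambda>U. U \<subseteq> carrier R \<and>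
     (\<forall>x\<in>U. \<exists>k. ideal_power R I k +>\<^bsub>R\<^esub> x \<subseteq> U))"

text \<open>The algebra \<open>path_algebra Q Quot J\<close> has as elements the cosets \<open>J +> f\<close>.\<close>

abbreviation quot_algebra ::
  "(nat, 'a) pre_digraph \<Rightarrow> 'a path_series set \<Rightarrow> 'a path_series set ring" where
  "quot_algebra Q J \<equiv> path_algebra Q Quot J"

abbreviation coset_of ::
  "(nat, 'a) pre_digraph \<Rightarrow> 'a path_series set \<Rightarrow> 'a path_series \<Rightarrow> 'a path_series set" where
  "coset_of Q J f \<equiv> J +>\<^bsub>path_algebra Q\<^esub> f"

section \<open>Left modules over not necessarily commutative rings\<close>

text \<open>
  The locale \<open>Module.module\<close> requires a commutative ring. We reuse its records; the fields \<open>mult\<close> and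
  \<open>one\<close> of a module record are meaningless.
\<close>

locale left_module = R?: ring R + M?: abelian_group M
  for R :: "('r, 's) ring_scheme" (structure) and M :: "('r, 'v, 't) module_scheme" (structure) +
  assumes smult_closed:
      "\<lbrakk>a \<in> carrier R; x \<in> carrier M\<rbrakk> \<Longrightarrow> a \<odot>\<^bsub>M\<^esub> x \<in> carrier M"
    and smult_l_distr:
      "\<lbrakk>a \<in> carrier R; b \<in> carrier R; x \<in> carrier M\<rbrakk>
        \<Longrightarrow> (a \<oplus>\<^bsub>R\<^esub> b) \<odot>\<^bsub>M\<^esub> x = a \<odot>\<^bsub>M\<^esub> x \<oplus>\<^bsub>M\<^esub> b \<odot>\<^bsub>M\<^esub> x"
    and smult_r_distr:
      "\<lbrakk>a \<in> carrier R; x \<in> carrier M; y \<in> carrier M\<rbrakk>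
        \<Longrightarrow> a \<odot>\<^bsub>M\<^esub> (x \<oplus>\<^bsub>M\<^esub> y) = a \<odot>\<^bsub>M\<^esub> x \<oplus>\<^bsub>M\<^esub> a \<odot>\<^bsub>M\<^esub> y"
    and smult_assoc:
      "\<lbrakk>a \<in> carrier R; b \<in> carrier R; x \<in> carrier M\<rbrakk>
        \<Longrightarrow> (a \<otimes>\<^bsub>R\<^esub> b) \<odot>\<^bsub>M\<^esub> x = a \<odot>\<^bsub>M\<^esub> (b \<odot>\<^bsub>M\<^esub> x)"
    and smult_one: "x \<in> carrier M \<Longrightarrow> \<one>\<^bsub>R\<^esub> \<odot>\<^bsub>M\<^esub> x = x"

definition restrict_scalars :: "('s \<Rightarrow> 'r) \<Rightarrow> ('r, 'v) module \<Rightarrow> ('s, 'v) module" where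
  "restrict_scalars \<phi> M = \<lparr>carrier = carrier M, mult = mult M, one = one M,
     zero = zero M, add = add M, smult = (\<lambda>s x. \<phi> s \<odot>\<^bsub>M\<^esub> x)\<rparr>"

abbreviation complex_field :: "complex ring" where
  "complex_field \<equiv> class_ring"

abbreviation cdim :: "(complex, 'v) module \<Rightarrow> nat" where
  "cdim V \<equiv> vectorspace.dim complex_field V"

definition quotient_space ::
  "(complex, 'v) module \<Rightarrow> 'v set \<Rightarrow> (complex, 'v set) module" where
  "quotient_space V W = \<lparr>carrier = a_rcosets\<^bsub>V\<^esub> W, mult = undefined, one = undefined,
     zero = W, add = set_add V, smult = (\<lambda>c X. set_add V W ((\<lambda>x. c \<odot>\<^bsub>V\<^esub> x) ` X))\<rparr>"

text \<open>
  In the following, a complex algebra is a ring \<open>R\<close> together with its structure map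
  \<open>\<eta> :: complex \<Rightarrow> 'r\<close>. Homomorphisms are represented by functions that are \<open>undefined\<close> outside the
  carrier of their domain.
\<close>

definition hom_set ::
  "('r, 's) ring_scheme \<Rightarrow> ('r, 'x) module \<Rightarrow> ('r, 'v) module \<Rightarrow> ('x \<Rightarrow> 'v) set" where
  "hom_set R X M = module_hom R X M \<inter> extensional (carrier X)"

definition hom_space ::
  "('r, 's) ring_scheme \<Rightarrow> (complex \<Rightarrow> 'r) \<Rightarrow> ('r, 'x) module \<Rightarrow> ('r, 'v) module
    \<Rightarrow> (complex, 'x \<Rightarrow> 'v) module" where
  "hom_space R \<eta> X M = \<lparr>carrier = hom_set R X M, mult = undefined, one = undefined,
     zero = (\<lambda>x\<in>carrier X. \<zero>\<^bsub>M\<^esub>),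
     add = (\<lambda>f g. \<lambda>x\<in>carrier X. f x \<oplus>\<^bsub>M\<^esub> g x),
     smult = (\<lambda>c f. \<lambda>x\<in>carrier X. \<eta> c \<odot>\<^bsub>M\<^esub> f x)\<rparr>"

definition free_module :: "('r, 's) ring_scheme \<Rightarrow> 'x set \<Rightarrow> ('r, 'x \<Rightarrow> 'r) module" where
  "free_module R S = \<lparr>carrier = {f \<in> S \<rightarrow>\<^sub>E carrier R. finite {x \<in> S. f x \<noteq> \<zero>\<^bsub>R\<^esub>}},
     mult = undefined, one = undefined,
     zero = (\<lambda>x\<in>S. \<zero>\<^bsub>R\<^esub>),
     add = (\<lambda>f g. \<lambda>x\<in>S. f x \<oplus>\<^bsub>R\<^esub> g x),
     smult = (\<lambda>r f. \<lambda>x\<in>S. r \<otimes>\<^bsub>R\<^esub> f x)\<rparr>"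

definition free_eval ::
  "('r, 's) ring_scheme \<Rightarrow> ('r, 'x) module \<Rightarrow> ('x \<Rightarrow> 'r) \<Rightarrow> 'x" where
  "free_eval R X f = finsum X (\<lambda>x. f x \<odot>\<^bsub>X\<^esub> x) {x \<in> carrier X. f x \<noteq> \<zero>\<^bsub>R\<^esub>}"

definition syzygy :: "('r, 's) ring_scheme \<Rightarrow> ('r, 'x) module \<Rightarrow> ('r, 'x \<Rightarrow> 'r) module" where
  "syzygy R X = (free_module R (carrier X))\<lparr>carrier :=
     {f \<in> carrier (free_module R (carrier X)). free_eval R X f = \<zero>\<^bsub>X\<^esub>}\<rparr>"

text \<open>
  Writing \<open>0 \<rightarrow> K \<rightarrow> F \<rightarrow> X \<rightarrow> 0\<close> for the presentation of \<open>X\<close> by the free module \<open>F\<close> on its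
  underlying set, Ext^1(X, M) is the cokernel of the restriction map Hom(F, M) to Hom(K, M).
\<close>

definition ext1_space ::
  "('r, 's) ring_scheme \<Rightarrow> (complex \<Rightarrow> 'r) \<Rightarrow> ('r, 'x) module \<Rightarrow> ('r, 'v) module
    \<Rightarrow> (complex, (('x \<Rightarrow> 'r) \<Rightarrow> 'v) set) module" where
  "ext1_space R \<eta> X M = quotient_space (hom_space R \<eta> (syzygy R X) M)
     ((\<lambda>h. restrict h (carrier (syzygy R X))) ` hom_set R (free_module R (carrier X)) M)"

section \<open>Decorated representations and extended g-vectors\<close>

definition scalar ::
  "(nat, 'a) pre_digraph \<Rightarrow> 'a path_series set \<Rightarrow> complex \<Rightarrow> 'a path_series set" where
  "scalar Q J c = coset_of Q J (const_series Q c)"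

abbreviation vector_space_of ::
  "(nat, 'a) pre_digraph \<Rightarrow> 'a path_series set \<Rightarrow> ('a path_series set, 'v) module
    \<Rightarrow> (complex, 'v) module" where
  "vector_space_of Q J M \<equiv> restrict_scalars (scalar Q J) M"

definition vertex_part ::
  "(nat, 'a) pre_digraph \<Rightarrow> 'a path_series set \<Rightarrow> ('a path_series set, 'v) module
    \<Rightarrow> nat \<Rightarrow> 'v set \<Rightarrow> 'v set" where
  "vertex_part Q J M i N = (\<lambda>x. coset_of Q J (idem i) \<odot>\<^bsub>M\<^esub> x) ` N"

text \<open>
  The decoration is a function on all natural numbers that vanishes outside the vertex set. The
  modules may have any subset of the type \<open>'v\<close> as carrier; every finite-dimensional module has an
  isomorphic copy of this form as soon as \<open>'v\<close> has at least the cardinality of the continuum, for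
  instance for \<open>'v = nat \<Rightarrow> complex\<close>.
\<close>

type_synonym ('a, 'v) decorated = "('a path_series set, 'v) module \<times> (nat \<Rightarrow> nat)"

definition decorated_reps ::
  "(nat, 'a) pre_digraph \<Rightarrow> 'a path_series set \<Rightarrow> ('a, 'v) decorated set" where
  "decorated_reps Q J = {(M, v). left_module (quot_algebra Q J) M \<and>
     vectorspace.fin_dim complex_field (vector_space_of Q J M) \<and> (\<forall>j. j \<notin> verts Q \<longrightarrow> v j = 0)}"

definition supported_reps ::
  "nat \<Rightarrow> (nat, 'a) pre_digraph \<Rightarrow> 'a path_series set \<Rightarrow> ('a, 'v) decorated set" where
  "supported_reps n Q J = {(M, v) \<in> decorated_reps Q J.
     \<forall>j \<in> verts Q - {1..n}. vertex_part Q J M j (carrier M) = {\<zero>\<^bsub>M\<^esub>} \<and> v j = 0}"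

text \<open>
  For \<open>J\<close> contained in the arrow ideal, the coefficient of the trivial path at \<open>i\<close> is the same for all
  elements of a coset of \<open>J\<close>; a coset acts on the simple module at \<open>i\<close> through this coefficient.
\<close>

definition simple_module :: "nat \<Rightarrow> ('a path_series set, complex) module" where
  "simple_module i = \<lparr>carrier = UNIV, mult = (*), one = 1, zero = 0, add = (+),
     smult = (\<lambda>X z. the_elem ((\<lambda>f. f (i, [])) ` X) * z)\<rparr>"

definition g_vector ::
  "(nat, 'a) pre_digraph \<Rightarrow> 'a path_series set \<Rightarrow> ('a, 'v) decorated \<Rightarrow> nat \<Rightarrow> int" where
  "g_vector Q J = (\<lambda>(M, v) i.
     - int (cdim (hom_space (quot_algebra Q J) (scalar Q J) (simple_module i) M))
     + int (cdim (ext1_space (quot_algebra Q J) (scalar Q J) (simple_module i) M))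
     + int (v i))"

section \<open>Quiver Grassmannians and Euler characteristics\<close>

text \<open>
  The topology on a complex vector space generated by all linear functionals; in finite dimension
  this is the Euclidean one.
\<close>

definition vs_topology :: "(complex, 'v) module \<Rightarrow> 'v topology" where
  "vs_topology V = topology_generated_by
     {{x \<in> carrier V. \<phi> x \<in> U} | \<phi> U. \<phi> \<in> module_hom complex_field V
        \<lparr>carrier = UNIV, mult = (*), one = 1, zero = 0, add = (+), smult = (*)\<rparr> \<and> open U}"

definition frames :: "(complex, 'v) module \<Rightarrow> nat \<Rightarrow> (nat \<Rightarrow> 'v) set" where
  "frames V k = {b \<in> {..<k} \<rightarrow>\<^sub>E carrier V. inj_on b {..<k} \<and>
     \<not> LinearCombinations.module.lin_dep complex_field V (b ` {..<k})}"

definition frame_span :: "(complex, 'v) module \<Rightarrow> nat \<Rightarrow> (nat \<Rightarrow> 'v) \<Rightarrow> 'v set" where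
  "frame_span V k b = LinearCombinations.module.span complex_field V (b ` {..<k})"

text \<open>The set of \<open>k\<close>-dimensional subspaces with the quotient topology from the space of \<open>k\<close>-frames.\<close>

definition grassmannian :: "(complex, 'v) module \<Rightarrow> nat \<Rightarrow> 'v set topology" where
  "grassmannian V k = topology (\<lambda>U. U \<subseteq> frame_span V k ` frames V k \<and>
     openin (subtopology (product_topology (\<lambda>_. vs_topology V) {..<k}) (frames V k))
       {b \<in> frames V k. frame_span V k b \<in> U})"

definition quiver_grassmannian ::
  "(nat, 'a) pre_digraph \<Rightarrow> 'a path_series set \<Rightarrow> ('a path_series set, 'v) module
    \<Rightarrow> (nat \<Rightarrow> nat) \<Rightarrow> 'v set topology" where
  "quiver_grassmannian Q J M e =
     subtopology (grassmannian (vector_space_of Q J M) (\<Sum>i\<in>verts Q. e i))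
       {N. Module.submodule N (quot_algebra Q J) M \<and>
           (\<forall>i\<in>verts Q. cdim ((vector_space_of Q J M)\<lparr>carrier := vertex_part Q J M i N\<rparr>) = e i)}"

definition abelian_rank :: "('g, 's) monoid_scheme \<Rightarrow> nat" where
  "abelian_rank G = Sup {card S | S. finite S \<and> S \<subseteq> carrier G \<and>
     (\<forall>c :: 'g \<Rightarrow> int. (\<Otimes>\<^bsub>G\<^esub>x\<in>S. x [^]\<^bsub>G\<^esub> c x) = \<one>\<^bsub>G\<^esub> \<longrightarrow> (\<forall>x\<in>S. c x = 0))}"

text \<open>
  Only meaningful if all homology groups have finite rank and almost all of them have rank zero, as
  is the case for complex projective varieties.
\<close>

definition euler_char :: "'x topology \<Rightarrow> int" where
  "euler_char X = (\<Sum>p | abelian_rank (homology_group (int p) X) \<noteq> 0.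
     (-1) ^ p * int (abelian_rank (homology_group (int p) X)))"

section \<open>Laurent polynomials\<close>

text \<open>Exponent vectors are finitely supported maps from variable indices to integers.\<close>

type_synonym laurent = "(nat \<Rightarrow>\<^sub>0 int) \<Rightarrow>\<^sub>0 rat"

definition laurent_ring :: "nat set \<Rightarrow> laurent set" where
  "laurent_ring I = {f. \<forall>a \<in> Poly_Mapping.keys f. Poly_Mapping.keys a \<subseteq> I}"

definition monomial :: "nat \<Rightarrow> (nat \<Rightarrow> int) \<Rightarrow> laurent" where
  "monomial N f = Poly_Mapping.single (Abs_poly_mapping (\<lambda>i. if i \<in> {1..N} then f i else 0)) 1"

text \<open>
  The submodule spanned by a set, over the Laurent polynomials in the last \<open>m\<close> variables, inside the
  Laurent polynomials in all \<open>n + m\<close> variables.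
\<close>

definition laurent_span :: "nat \<Rightarrow> nat \<Rightarrow> laurent set \<Rightarrow> laurent set" where
  "laurent_span n m S = (\<lambda>W. W \<subseteq> laurent_ring {1..n + m} \<and> 0 \<in> W \<and>
     (\<forall>x\<in>W. \<forall>y\<in>W. x + y \<in> W) \<and>
     (\<forall>r\<in>laurent_ring {n + 1..n + m}. \<forall>x\<in>W. r * x \<in> W)) hull S"

section \<open>Caldero--Chapoton functions\<close>

definition mutable_part :: "nat \<Rightarrow> (nat, 'a) pre_digraph \<Rightarrow> (nat, 'a) pre_digraph" where
  "mutable_part n Qt = Qt\<lparr>arcs := {a \<in> arcs Qt. tail Qt a \<in> {1..n} \<and> head Qt a \<in> {1..n}}\<rparr>"

text \<open>
  The continuous algebra homomorphism that fixes the vertex idempotents and the arrows of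
  \<open>mutable_part n Qt\<close> and kills all other arrows keeps the coefficients of the paths of
  \<open>mutable_part n Qt\<close> and forgets those of all other paths.
\<close>

definition rho :: "nat \<Rightarrow> (nat, 'a) pre_digraph \<Rightarrow> 'a path_series \<Rightarrow> 'a path_series" where
  "rho n Qt f = (\<lambda>x. if x \<in> paths (mutable_part n Qt) then f x else 0)"

definition b_matrix :: "(nat, 'a) pre_digraph \<Rightarrow> nat \<Rightarrow> nat \<Rightarrow> int" where
  "b_matrix Qt i j = int (card {a \<in> arcs Qt. tail Qt a = j \<and> head Qt a = i})
                   - int (card {a \<in> arcs Qt. tail Qt a = i \<and> head Qt a = j})"

definition b_matrix_prin :: "nat \<Rightarrow> (nat, 'a) pre_digraph \<Rightarrow> nat \<Rightarrow> nat \<Rightarrow> int" where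
  "b_matrix_prin n Qt i j = (if i \<le> n then b_matrix Qt i j else if i = n + j then 1 else 0)"

text \<open>
  The shape common to both Caldero--Chapoton functions: \<open>N\<close> variables, exponents \<open>B e + g\<close>, and
  coefficients the Euler characteristics of the spaces \<open>Gr e\<close>.
\<close>

definition cc_sum ::
  "nat \<Rightarrow> nat \<Rightarrow> (nat \<Rightarrow> nat \<Rightarrow> int) \<Rightarrow> (nat \<Rightarrow> int) \<Rightarrow> ((nat \<Rightarrow> nat) \<Rightarrow> 'x topology)
    \<Rightarrow> laurent" where
  "cc_sum n N B g Gr = (\<Sum>e | (\<forall>i. i \<notin> {1..n} \<longrightarrow> e i = 0) \<and> euler_char (Gr e) \<noteq> 0.
     of_int (euler_char (Gr e)) * monomial N (\<lambda>i. (\<Sum>j = 1..n. B i j * int (e j)) + g i))"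

text \<open>
  \<open>rho\<close> maps a coset of \<open>Jt\<close> onto a coset of \<open>rho ` Jt\<close>; this is the induced map on quotients.
\<close>

definition inflate ::
  "nat \<Rightarrow> (nat, 'a) pre_digraph \<Rightarrow> ('a, 'v) decorated \<Rightarrow> ('a, 'v) decorated" where
  "inflate n Qt = (\<lambda>(M, v). (restrict_scalars (\<lambda>X. rho n Qt ` X) M, v))"

definition CC ::
  "nat \<Rightarrow> nat \<Rightarrow> (nat, 'a) pre_digraph \<Rightarrow> 'a path_series set \<Rightarrow> ('a, 'v) decorated
    \<Rightarrow> laurent" where
  "CC n m Qt Jt Mv = cc_sum n (n + m) (b_matrix Qt) (g_vector Qt Jt (inflate n Qt Mv))
     (quiver_grassmannian (mutable_part n Qt) (rho n Qt ` Jt) (fst Mv))"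

section \<open>Principal coefficients\<close>

text \<open>The arrow \<open>Inr j\<close> goes from \<open>j\<close> to the additional vertex \<open>n + j\<close>.\<close>

definition prin_quiver :: "nat \<Rightarrow> (nat, 'a) pre_digraph \<Rightarrow> (nat, 'a + nat) pre_digraph" where
  "prin_quiver n Q = \<lparr>verts = {1..n + n}, arcs = Inl ` arcs Q \<union> Inr ` {1..n},
     tail = case_sum (tail Q) (\<lambda>j. j), head = case_sum (head Q) (\<lambda>j. n + j)\<rparr>"

text \<open>
  Since all arrows of \<open>Q\<close> lie between the vertices in \<open>{1..n}\<close>, the paths of \<open>prin_quiver n Q\<close>
  starting in \<open>{1..n}\<close> and using only arrows \<open>Inl a\<close> are the paths of \<open>Q\<close> starting in \<open>{1..n}\<close>.
  The next two maps extend, respectively restrict, series along this identification.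
\<close>

definition prin_embed :: "nat \<Rightarrow> 'a path_series \<Rightarrow> ('a + nat) path_series" where
  "prin_embed n f = (\<lambda>(u, p). if u \<in> {1..n} \<and> set p \<subseteq> range Inl then f (u, map projl p) else 0)"

definition prin_ideal ::
  "nat \<Rightarrow> (nat, 'a) pre_digraph \<Rightarrow> 'a path_series set \<Rightarrow> ('a + nat) path_series set" where
  "prin_ideal n Q J = genideal (path_algebra (prin_quiver n Q)) (prin_embed n ` J)"

definition prin_project :: "nat \<Rightarrow> ('a + nat) path_series \<Rightarrow> 'a path_series" where
  "prin_project n f = (\<lambda>(u, p). if u \<in> {1..n} then f (u, map Inl p) else 0)"

text \<open>
  \<open>prin_project\<close> is multiplicative, sends the unit to the sum of the idempotents at \<open>{1..n}\<close> (which
  acts as the identity on modules supported there), and maps a coset of \<open>prin_ideal n Q J\<close> onto a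
  coset of \<open>J\<close>. The resulting module over the principal algebra is zero at the additional vertices.
\<close>

definition prin_inflate :: "nat \<Rightarrow> ('a, 'v) decorated \<Rightarrow> ('a + nat, 'v) decorated" where
  "prin_inflate n = (\<lambda>(M, v). (restrict_scalars (\<lambda>X. prin_project n ` X) M, v))"

definition CC_prin ::
  "nat \<Rightarrow> (nat, 'a) pre_digraph \<Rightarrow> 'a path_series set \<Rightarrow> ('a, 'v) decorated \<Rightarrow> laurent" where
  "CC_prin n Qt Jt Mv = (let Q = mutable_part n Qt; J = rho n Qt ` Jt in
     cc_sum n (n + n) (b_matrix_prin n Qt)
       (g_vector (prin_quiver n Q) (prin_ideal n Q J) (prin_inflate n Mv))
       (quiver_grassmannian Q J (fst Mv)))"

section \<open>Caldero--Chapoton algebras\<close>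

definition CC_algebra ::
  "nat \<Rightarrow> nat \<Rightarrow> (nat, 'a) pre_digraph \<Rightarrow> 'a path_series set \<Rightarrow> 'v itself \<Rightarrow> laurent set" where
  "CC_algebra n m Qt Jt _ = laurent_span n m (CC n m Qt Jt `
     (supported_reps n (mutable_part n Qt) (rho n Qt ` Jt) :: ('a, 'v) decorated set))"

definition CC_algebra_prin ::
  "nat \<Rightarrow> (nat, 'a) pre_digraph \<Rightarrow> 'a path_series set \<Rightarrow> 'v itself \<Rightarrow> laurent set" where
  "CC_algebra_prin n Qt Jt _ = laurent_span n n (CC_prin n Qt Jt `
     (supported_reps n (mutable_part n Qt) (rho n Qt ` Jt) :: ('a, 'v) decorated set))"

end

theory Submission
  imports Defs
begin

text \<open>
  Put \<open>F\<^sub>M(y) = \<Sum>\<^sub>e \<chi>(Gr\<^sub>e(M)) y\<^sup>e\<close>. Both Caldero--Chapoton functions of \<open>M\<close> are monomial multiples of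
  values of \<open>F\<^sub>M\<close>: for the algebra with frozen vertices each \<open>y\<^sub>j\<close> is replaced by the monomial whose
  exponent is the \<open>j\<close>-th column of the extended matrix, and for principal coefficients this column is
  that of the principal matrix. The monomials in front are given by the extended g-vectors. The theorem rests on two
  facts.

  The first is that the two extended g-vectors agree at the vertices in \<open>{1..n}\<close>
  (\<open>g_vector_inflate\<close>, \<open>g_vector_prin_inflate\<close>): there both equal the g-vector over the algebra \<open>\<Lambda>\<close> of
  the mutable part. An extension of the simple module at \<open>i\<close> by a module supported in \<open>{1..n}\<close> is again
  supported there, so it is a module over \<open>\<Lambda>\<close>. To make this precise, Ext^1 of a one-dimensional module
  is described by derivations modulo inner derivations (\<open>cdim_ext1_space_character\<close>). Restriction along
  a homomorphism does not change this quotient as soon as derivations vanish on its kernel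
  (\<open>cdim_ext1_space_pullback\<close>), and for the two homomorphisms to \<open>\<Lambda>\<close> in question the vanishing is a
  computation with the Leibniz rule and the idempotents at the vertices outside \<open>{1..n}\<close>.

  The second is a grading. Let \<open>x\<^sub>i\<close> have the \<open>i\<close>-th unit vector as its degree for \<open>i \<le> n\<close>, and let
  \<open>x\<close> with index \<open>n + j\<close> have the negative of the \<open>j\<close>-th column of \<open>B\<close>. Then all Caldero--Chapoton
  functions with principal coefficients are homogeneous. In a linear relation that expresses one of them
  through others, only the homogeneous components of the coefficients in the appropriate degrees matter.
  Setting \<open>x\<^sub>i\<close> to \<open>1\<close> for \<open>i \<le> n\<close>, replacing \<open>x\<close> with index \<open>n + j\<close> by the monomial given by the \<open>j\<close>-th
  column of the extended matrix, and multiplying by monomials turns this part of the relation into a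
  relation between the other Caldero--Chapoton functions. Its coefficients have exponent zero at
  \<open>{1..n}\<close>, because the degrees are computed from g-vectors that agree there; so they lie in the
  ground ring (\<open>cc_sum_in_span_if_prin\<close>). The entries of the g-vectors at the other vertices only contribute
  invertible factors from the ground rings.
\<close>

section \<open>Dimensions of vector spaces and quotients\<close>

lemma vectorspace_complexI:
  assumes "module complex_field V"
  shows "vectorspace complex_field V"
proof -
  have "field (complex_field :: complex ring)"
    by (rule class_field)
  with assms show ?thesis by (simp add: vectorspace_def)
qed

lemma generating_set_image:
  assumes V: "vectorspace K V" and V': "vectorspace K V'" and T: "T \<in> module_hom K V V'"
    and bij: "bij_betw T (carrier V) (carrier V')"
    and A: "finite A" "A \<subseteq> carrier V" "LinearCombinations.module.span K V A = carrier V"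
  shows "\<exists>A'. finite A' \<and> card A' = card A \<and> A' \<subseteq> carrier V' \<and>
    LinearCombinations.module.span K V' A' = carrier V'"
proof -
  interpret V: vectorspace K V by (rule V)
  interpret V': vectorspace K V' by (rule V')
  interpret T: mod_hom K V V' T
    by unfold_locales (rule T)
  have inj: "inj_on T (carrier V)" and im: "T ` carrier V = carrier V'"
    using bij by (auto simp: bij_betw_def)
  have injA: "inj_on T A" using inj A(2) inj_on_subset by blast
  have TA: "T ` A \<subseteq> carrier V'" using A(2) im by blast
  have fs: "T (V.lincomb a B) = V'.lincomb (a \<circ> inv_into A T) (T ` B)"
    if "B \<subseteq> A" "finite B" "a \<in> B \<rightarrow> carrier K" for a B
    using that(2) that
  proof (induction B rule: finite_induct)
    case empty
    have "T \<zero>\<^bsub>V\<^esub> = \<zero>\<^bsub>V'\<^esub>" by simp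
    then show ?case by (simp add: V.lincomb_def V'.lincomb_def)
  next
    case (insert x B)
    have x: "x \<in> carrier V" and B: "B \<subseteq> carrier V" using insert.prems A(2) by auto
    have inv: "inv_into A T (T y) = y" if "y \<in> insert x B" for y
      using injA insert.prems(1) that by (auto intro: inv_into_f_f)
    have notin: "T x \<notin> T ` B"
      using insert.hyps(2) injA insert.prems(1) by (auto simp: inj_on_def)
    have "V.lincomb a (insert x B) = a x \<odot>\<^bsub>V\<^esub> x \<oplus>\<^bsub>V\<^esub> V.lincomb a B"
      using V.lincomb_insert[of B a x] insert x B by auto
    moreover have "V.lincomb a B \<in> carrier V"
      using insert.prems B by (intro V.lincomb_closed) auto
    moreover have "a x \<in> carrier K" using insert.prems by auto
    ultimately have "T (V.lincomb a (insert x B)) = a x \<odot>\<^bsub>V'\<^esub> T x \<oplus>\<^bsub>V'\<^esub> T (V.lincomb a B)"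
      using x by (simp add: T.f_add T.f_smult)
    also have "T (V.lincomb a B) = V'.lincomb (a \<circ> inv_into A T) (T ` B)"
      using insert by (auto simp: comp_def)
    also have "a x \<odot>\<^bsub>V'\<^esub> T x \<oplus>\<^bsub>V'\<^esub> \<dots> = V'.lincomb (a \<circ> inv_into A T) (insert (T x) (T ` B))"
    proof -
      have "insert (T x) (T ` B) \<subseteq> carrier V'" using im x B by auto
      moreover have "(a \<circ> inv_into A T) \<in> T ` B \<union> {T x} \<rightarrow> carrier K"
        using insert.prems inv by auto
      ultimately show ?thesis
        using V'.lincomb_insert[of "T ` B" "a \<circ> inv_into A T" "T x"] insert.hyps(1) notin inv
        by auto
    qed
    finally show ?case unfolding image_insert .
  qed
  have "V'.span (T ` A) = carrier V'"
  proof
    show "V'.span (T ` A) \<subseteq> carrier V'" using TA by (rule V'.span_is_subset2)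
  next
    show "carrier V' \<subseteq> V'.span (T ` A)"
    proof
      fix y assume "y \<in> carrier V'"
      then obtain x where x: "x \<in> carrier V" "y = T x" using im by auto
      then obtain a B where aB: "x = V.lincomb a B" "finite B" "B \<subseteq> A" "a \<in> B \<rightarrow> carrier K"
        using A(3) unfolding V.span_def by blast
      have "a \<circ> inv_into A T \<in> T ` B \<rightarrow> carrier K"
        using aB injA by (auto simp: subsetD)
      then show "y \<in> V'.span (T ` A)"
        unfolding V'.span_def using fs[of B a] aB x by blast
    qed
  qed
  moreover have "card (T ` A) = card A" using card_image[OF injA] by simp
  ultimately show ?thesis using A(1) TA by blast
qed

text \<open>
  The dimension is the least size of a finite generating set. A linear bijection transports such sets
  in both directions, so it preserves the dimension also when none exists.
\<close>

lemma dim_eq_if_linear_bijection: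
  assumes V: "vectorspace K V" and V': "vectorspace K V'"
    and T: "T \<in> module_hom K V V'" and bij: "bij_betw T (carrier V) (carrier V')"
  shows "vectorspace.dim K V = vectorspace.dim K V'"
proof -
  interpret V: vectorspace K V by (rule V)
  interpret V': vectorspace K V' by (rule V')
  interpret T: mod_hom K V V' T
    by unfold_locales (rule T)
  let ?T' = "inv_into (carrier V) T"
  have bij': "bij_betw ?T' (carrier V') (carrier V)"
    using bij by (rule bij_betw_inv_into)
  have TT': "T (?T' y) = y" and T'c: "?T' y \<in> carrier V" if "y \<in> carrier V'" for y
    using that bij by (auto simp: bij_betw_def f_inv_into_f inv_into_into)
  have T'T: "?T' (T x) = x" if "x \<in> carrier V" for x
    using that bij by (auto simp: bij_betw_def)
  have T': "?T' \<in> module_hom K V' V"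
  proof -
    have "?T' (x \<oplus>\<^bsub>V'\<^esub> y) = ?T' x \<oplus>\<^bsub>V\<^esub> ?T' y" if "x \<in> carrier V'" "y \<in> carrier V'" for x y
      using T'T[of "?T' x \<oplus>\<^bsub>V\<^esub> ?T' y"] that TT' T'c by (simp add: T.f_add)
    moreover have "?T' (c \<odot>\<^bsub>V'\<^esub> x) = c \<odot>\<^bsub>V\<^esub> ?T' x" if "c \<in> carrier K" "x \<in> carrier V'" for c x
      using T'T[of "c \<odot>\<^bsub>V\<^esub> ?T' x"] that TT' T'c by (simp add: T.f_smult)
    ultimately show ?thesis using T'c by (auto simp: module_hom_def)
  qed
  show ?thesis
    unfolding V.dim_def V'.dim_def
    using generating_set_image[OF V V' T bij] generating_set_image[OF V' V T' bij']
    by (intro arg_cong[where f=Least] ext) blast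
qed

context
  fixes V :: "(complex, 'v) module" and W
  assumes V: "module complex_field V" and W: "additive_subgroup W V"
    and Wc: "\<forall>c. \<forall>x\<in>W. c \<odot>\<^bsub>V\<^esub> x \<in> W"
begin

interpretation V: module complex_field V
  rewrites "carrier complex_field = UNIV" and "mult complex_field = (*)" 
    and "add complex_field = (+)" and "one complex_field = 1" and "zero complex_field = 0"
  by (rule V) simp_all

interpretation W: abelian_subgroup W V
  by (rule abelian_subgroupI3[OF W V.abelian_group_axioms])

lemma quotient_smult_coset:
  assumes x: "x \<in> carrier V"
  shows "c \<odot>\<^bsub>quotient_space V W\<^esub> (W +>\<^bsub>V\<^esub> x) = W +>\<^bsub>V\<^esub> (c \<odot>\<^bsub>V\<^esub> x)"
proof -
  have Wsub: "W \<subseteq> carrier V" by (rule W.a_subset)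
  have 1: "w \<oplus>\<^bsub>V\<^esub> c \<odot>\<^bsub>V\<^esub> (w' \<oplus>\<^bsub>V\<^esub> x) = (w \<oplus>\<^bsub>V\<^esub> c \<odot>\<^bsub>V\<^esub> w') \<oplus>\<^bsub>V\<^esub> c \<odot>\<^bsub>V\<^esub> x" if "w \<in> W" "w' \<in> W" for w w'
    using that Wsub x by (auto simp: V.smult_r_distr V.a_assoc subsetD)
  have 2: "w \<oplus>\<^bsub>V\<^esub> c \<odot>\<^bsub>V\<^esub> w' \<in> W" if "w \<in> W" "w' \<in> W" for w w'
    using that Wc by (simp add: W.a_closed)
  have 3: "w \<oplus>\<^bsub>V\<^esub> c \<odot>\<^bsub>V\<^esub> \<zero>\<^bsub>V\<^esub> = w" if "w \<in> W" for w
    using that Wsub by (auto simp: subsetD)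
  have 0: "\<zero>\<^bsub>V\<^esub> \<in> W" by (rule W.zero_closed)
  show ?thesis
  proof (intro equalityI subsetI)
    fix y assume "y \<in> c \<odot>\<^bsub>quotient_space V W\<^esub> (W +>\<^bsub>V\<^esub> x)"
    then obtain w w' where "w \<in> W" "w' \<in> W" "y = w \<oplus>\<^bsub>V\<^esub> c \<odot>\<^bsub>V\<^esub> (w' \<oplus>\<^bsub>V\<^esub> x)"
      unfolding quotient_space_def by (auto simp: set_add_def' a_r_coset_def')
    then show "y \<in> W +>\<^bsub>V\<^esub> (c \<odot>\<^bsub>V\<^esub> x)"
      using 1 2 by (auto simp: a_r_coset_def')
  next
    fix y assume "y \<in> W +>\<^bsub>V\<^esub> (c \<odot>\<^bsub>V\<^esub> x)"
    then obtain w where w: "w \<in> W" "y = w \<oplus>\<^bsub>V\<^esub> c \<odot>\<^bsub>V\<^esub> x" by (auto simp: a_r_coset_def')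
    have "y = w \<oplus>\<^bsub>V\<^esub> c \<odot>\<^bsub>V\<^esub> (\<zero>\<^bsub>V\<^esub> \<oplus>\<^bsub>V\<^esub> x)" using w x by simp
    then have "\<exists>a\<in>W. \<exists>b\<in>W. y = a \<oplus>\<^bsub>V\<^esub> c \<odot>\<^bsub>V\<^esub> (b \<oplus>\<^bsub>V\<^esub> x)"
      using w(1) 0 by blast
    then show "y \<in> c \<odot>\<^bsub>quotient_space V W\<^esub> (W +>\<^bsub>V\<^esub> x)"
      unfolding quotient_space_def by (auto simp: set_add_def' a_r_coset_def')
  qed
qed

lemma quotient_add_coset:
  assumes "x \<in> carrier V" "y \<in> carrier V"
  shows "(W +>\<^bsub>V\<^esub> x) \<oplus>\<^bsub>quotient_space V W\<^esub> (W +>\<^bsub>V\<^esub> y) = W +>\<^bsub>V\<^esub> (x \<oplus>\<^bsub>V\<^esub> y)"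
  using assms by (simp add: quotient_space_def W.a_rcos_sum)

lemma carrier_quotient_space: "carrier (quotient_space V W) = (\<lambda>x. W +>\<^bsub>V\<^esub> x) ` carrier V"
  by (auto simp: quotient_space_def A_RCOSETS_def')

lemma module_quotient_space: "module complex_field (quotient_space V W)"
proof (rule moduleI)
  show "cring complex_field" by (rule module.axioms(1)[OF V])
  show "abelian_group (quotient_space V W)"
  proof (rule abelian_groupI)
    have 0: "\<zero>\<^bsub>quotient_space V W\<^esub> = W +>\<^bsub>V\<^esub> \<zero>\<^bsub>V\<^esub>"
      by (simp add: quotient_space_def W.a_subset)
    then show "\<zero>\<^bsub>quotient_space V W\<^esub> \<in> carrier (quotient_space V W)"
      by (simp add: carrier_quotient_space)
    show "\<zero>\<^bsub>quotient_space V W\<^esub> \<oplus>\<^bsub>quotient_space V W\<^esub> X = X"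
      if "X \<in> carrier (quotient_space V W)" for X
      using that by (auto simp: 0 carrier_quotient_space quotient_add_coset)
    show "\<exists>Y\<in>carrier (quotient_space V W). Y \<oplus>\<^bsub>quotient_space V W\<^esub> X = \<zero>\<^bsub>quotient_space V W\<^esub>"
      if X: "X \<in> carrier (quotient_space V W)" for X
    proof -
      obtain x where "x \<in> carrier V" "X = W +>\<^bsub>V\<^esub> x"
        using X by (auto simp: carrier_quotient_space)
      then show ?thesis
        by (intro bexI[of _ "W +>\<^bsub>V\<^esub> (\<ominus>\<^bsub>V\<^esub> x)"])
          (auto simp: 0 carrier_quotient_space quotient_add_coset V.l_neg)
    qed
      show "X \<oplus>\<^bsub>quotient_space V W\<^esub> Y = Y \<oplus>\<^bsub>quotient_space V W\<^esub> X"
      if X: "X \<in> carrier (quotient_space V W)" and Y: "Y \<in> carrier (quotient_space V W)" for X Y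
    proof -
      obtain x y where "x \<in> carrier V" "X = W +>\<^bsub>V\<^esub> x" "y \<in> carrier V" "Y = W +>\<^bsub>V\<^esub> y"
        using X Y unfolding carrier_quotient_space by blast
      then show ?thesis by (simp add: quotient_add_coset V.a_comm)
    qed
  qed (auto simp: carrier_quotient_space quotient_add_coset V.a_assoc)
qed (auto simp: carrier_quotient_space quotient_smult_coset quotient_add_coset
  V.smult_l_distr V.smult_r_distr V.smult_assoc1)

end

text \<open>
  The map \<open>T\<close> carries the coset of \<open>x\<close> onto the coset of \<open>T x\<close>, and the condition on preimages makes
  the induced map on cosets injective. Ext spaces are compared in this way, since they are quotients of
  spaces of homomorphisms.
\<close>

lemma cdim_quotient_space_eq:
  assumes V: "module complex_field V" and W: "additive_subgroup W V"
    and Wc: "\<forall>c. \<forall>x\<in>W. c \<odot>\<^bsub>V\<^esub> x \<in> W"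
    and V': "module complex_field V'" and W': "additive_subgroup W' V'"
    and Wc': "\<forall>c. \<forall>x\<in>W'. c \<odot>\<^bsub>V'\<^esub> x \<in> W'"
    and T: "T \<in> module_hom complex_field V V'" and surj: "carrier V' \<subseteq> T ` carrier V"
    and TW: "\<And>x. x \<in> carrier V \<Longrightarrow> T x \<in> W' \<longleftrightarrow> x \<in> W"
  shows "cdim (quotient_space V W) = cdim (quotient_space V' W')"
proof -
  interpret V: module complex_field V by (rule V)
  interpret V': module complex_field V' by (rule V')
  interpret W: abelian_subgroup W V
    by (rule abelian_subgroupI3[OF W V.abelian_group_axioms])
  interpret W': abelian_subgroup W' V'
    by (rule abelian_subgroupI3[OF W' V'.abelian_group_axioms])
  interpret T: mod_hom complex_field V V' T
    by unfold_locales (rule T)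
  have Tcoset: "T ` (W +>\<^bsub>V\<^esub> x) = W' +>\<^bsub>V'\<^esub> T x" if x: "x \<in> carrier V" for x
  proof (intro equalityI subsetI)
    fix y assume "y \<in> T ` (W +>\<^bsub>V\<^esub> x)"
    then obtain w where w: "w \<in> W" "y = T (w \<oplus>\<^bsub>V\<^esub> x)" by (auto simp: a_r_coset_def')
    then have "w \<in> carrier V" using W.a_subset by auto
    then show "y \<in> W' +>\<^bsub>V'\<^esub> T x" using w x TW by (auto simp: a_r_coset_def' T.f_add)
  next
    fix y assume "y \<in> W' +>\<^bsub>V'\<^esub> T x"
    then obtain w' where w': "w' \<in> W'" "y = w' \<oplus>\<^bsub>V'\<^esub> T x" by (auto simp: a_r_coset_def')
    then obtain w where w: "w \<in> carrier V" "w' = T w" using surj W'.a_subset by auto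
    then have "w \<in> W" using TW w' by simp
    then show "y \<in> T ` (W +>\<^bsub>V\<^esub> x)"
      using w w' x by (auto simp: a_r_coset_def' T.f_add intro!: image_eqI[of _ T "w \<oplus>\<^bsub>V\<^esub> x"])
  qed
  note q = carrier_quotient_space[OF V W Wc] quotient_add_coset[OF V W Wc] quotient_smult_coset[OF V W Wc]
    carrier_quotient_space[OF V' W' Wc'] quotient_add_coset[OF V' W' Wc'] quotient_smult_coset[OF V' W' Wc']
  have hom: "(\<lambda>X. T ` X) \<in> module_hom complex_field (quotient_space V W) (quotient_space V' W')"
  proof -
    have "T ` X \<in> carrier (quotient_space V' W')" if X: "X \<in> carrier (quotient_space V W)" for X
    proof -
      obtain x where "x \<in> carrier V" "X = W +>\<^bsub>V\<^esub> x"
        using X carrier_quotient_space[OF V W Wc] by auto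
      then show ?thesis using Tcoset[of x] T.f_im[of x] carrier_quotient_space[OF V' W' Wc'] by simp
    qed
    moreover have "T ` (X \<oplus>\<^bsub>quotient_space V W\<^esub> Y) = T ` X \<oplus>\<^bsub>quotient_space V' W'\<^esub> T ` Y"
      if "X \<in> carrier (quotient_space V W)" "Y \<in> carrier (quotient_space V W)" for X Y
    proof -
      obtain x y where "x \<in> carrier V" "X = W +>\<^bsub>V\<^esub> x" "y \<in> carrier V" "Y = W +>\<^bsub>V\<^esub> y"
        using \<open>X \<in> _\<close> \<open>Y \<in> _\<close> carrier_quotient_space[OF V W Wc] by auto
      then show ?thesis
        by (simp only: q Tcoset T.f_add T.f_im V.a_closed)
    qed
    moreover have "T ` (c \<odot>\<^bsub>quotient_space V W\<^esub> X) = c \<odot>\<^bsub>quotient_space V' W'\<^esub> T ` X"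
      if "X \<in> carrier (quotient_space V W)" for c X
    proof -
      obtain x where "x \<in> carrier V" "X = W +>\<^bsub>V\<^esub> x"
        using \<open>X \<in> _\<close> carrier_quotient_space[OF V W Wc] by auto
      then show ?thesis
        using Tcoset[of x] Tcoset[of "c \<odot>\<^bsub>V\<^esub> x"] by (simp add: quotient_smult_coset[OF V W Wc] quotient_smult_coset[OF V' W' Wc'])
    qed
    ultimately show ?thesis by (simp add: module_hom_def)
  qed
  have "inj_on (\<lambda>X. T ` X) (carrier (quotient_space V W))"
  proof (rule inj_onI)
    fix X Y assume "X \<in> carrier (quotient_space V W)" "Y \<in> carrier (quotient_space V W)"
      and eq: "T ` X = T ` Y"
    then obtain x y where x: "x \<in> carrier V" "X = W +>\<^bsub>V\<^esub> x" and y: "y \<in> carrier V" "Y = W +>\<^bsub>V\<^esub> y"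
      by (auto simp: q)
    have "W' +>\<^bsub>V'\<^esub> T x = W' +>\<^bsub>V'\<^esub> T y" using eq x y Tcoset by simp
    then have "T x \<in> W' +>\<^bsub>V'\<^esub> T y" using W'.a_rcos_self[of "T x"] x by simp
    then have "T x \<ominus>\<^bsub>V'\<^esub> T y \<in> W'" using x y W'.a_rcos_module
      by (simp add: a_minus_def)
    moreover have "T x \<ominus>\<^bsub>V'\<^esub> T y = T (x \<ominus>\<^bsub>V\<^esub> y)"
      using x y T.f_add[of x "\<ominus>\<^bsub>V\<^esub> y"] by (simp add: a_minus_def)
    ultimately have "x \<ominus>\<^bsub>V\<^esub> y \<in> W" using TW[OF V.minus_closed[OF x(1) y(1)]] by argo
    then have "x \<in> W +>\<^bsub>V\<^esub> y" using W.a_rcos_module x y by (simp add: a_minus_def)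
    then show "X = Y" using W.a_repr_independence'[OF _ y(1), of x] x y W.abelian_subgroup_axioms by simp
  qed
  moreover have "(\<lambda>X. T ` X) ` carrier (quotient_space V W) = carrier (quotient_space V' W')"
  proof -
    have "T ` carrier V = carrier V'" using surj by auto
    moreover have "(\<lambda>x. T ` (W +>\<^bsub>V\<^esub> x)) ` carrier V = (\<lambda>x. W' +>\<^bsub>V'\<^esub> T x) ` carrier V"
      by (rule image_cong[OF refl Tcoset])
    ultimately have "(\<lambda>x. T ` (W +>\<^bsub>V\<^esub> x)) ` carrier V = (\<lambda>y. W' +>\<^bsub>V'\<^esub> y) ` carrier V'"
      by (metis image_image)
    then show ?thesis
      using carrier_quotient_space[OF V W Wc] carrier_quotient_space[OF V' W' Wc']
      by (simp add: image_image)
  qed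
  ultimately have "bij_betw (\<lambda>X. T ` X) (carrier (quotient_space V W)) (carrier (quotient_space V' W'))"
    by (simp add: bij_betw_def)
  then show ?thesis
    by (rule dim_eq_if_linear_bijection[OF
        vectorspace_complexI[OF module_quotient_space[OF V W Wc]]
        vectorspace_complexI[OF module_quotient_space[OF V' W' Wc']] hom])
qed

section \<open>Extensions of one-dimensional modules as derivations\<close>

text \<open>
  Homomorphisms and derivations both form spaces of functions with pointwise operations; \<open>A\<close> is the
  domain outside of which the functions are \<open>undefined\<close>.
\<close>

definition function_space ::
  "(complex \<Rightarrow> 'r) \<Rightarrow> 'x set \<Rightarrow> ('r, 'v) module \<Rightarrow> ('x \<Rightarrow> 'v) set \<Rightarrow> (complex, 'x \<Rightarrow> 'v) module" where
  "function_space \<eta> A N H = \<lparr>carrier = H, mult = undefined, one = undefined,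
     zero = (\<lambda>x\<in>A. \<zero>\<^bsub>N\<^esub>), add = (\<lambda>f g. \<lambda>x\<in>A. f x \<oplus>\<^bsub>N\<^esub> g x), smult = (\<lambda>c f. \<lambda>x\<in>A. \<eta> c \<odot>\<^bsub>N\<^esub> f x)\<rparr>"

lemma hom_space_eq_function_space:
  "hom_space R \<eta> X M = function_space \<eta> (carrier X) M (hom_set R X M)"
  by (simp add: hom_space_def function_space_def)

lemma function_space_simps [simp]:
  "carrier (function_space \<eta> A N H) = H"
  "\<zero>\<^bsub>function_space \<eta> A N H\<^esub> = (\<lambda>x\<in>A. \<zero>\<^bsub>N\<^esub>)"
  "f \<oplus>\<^bsub>function_space \<eta> A N H\<^esub> g = (\<lambda>x\<in>A. f x \<oplus>\<^bsub>N\<^esub> g x)"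
  "c \<odot>\<^bsub>function_space \<eta> A N H\<^esub> f = (\<lambda>x\<in>A. \<eta> c \<odot>\<^bsub>N\<^esub> f x)"
  by (simp_all add: function_space_def)

lemma additive_subgroup_if_subspace:
  assumes V: "module complex_field V" and sub: "W \<subseteq> carrier V" and ne: "W \<noteq> {}"
    and add: "\<And>x y. x \<in> W \<Longrightarrow> y \<in> W \<Longrightarrow> x \<oplus>\<^bsub>V\<^esub> y \<in> W"
    and smult: "\<And>c x. x \<in> W \<Longrightarrow> c \<odot>\<^bsub>V\<^esub> x \<in> W"
  shows "additive_subgroup W V"
proof -
  interpret V: module complex_field V by (rule V)
  obtain x where x: "x \<in> W" using ne by blast
  have "(0 :: complex) \<odot>\<^bsub>V\<^esub> x = \<zero>\<^bsub>V\<^esub>" using V.smult_l_null[of x] x sub by auto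
  then have 0: "\<zero>\<^bsub>V\<^esub> \<in> W" using smult[OF x, of 0] by simp
  have neg: "\<ominus>\<^bsub>V\<^esub> y \<in> W" if y: "y \<in> W" for y
  proof -
    have "(- 1 :: complex) \<odot>\<^bsub>V\<^esub> y = \<ominus>\<^bsub>V\<^esub> (1 \<odot>\<^bsub>V\<^esub> y)"
      using V.smult_l_minus[of 1 y] y sub by (auto simp: class_ring_simps)
    then have "(- 1 :: complex) \<odot>\<^bsub>V\<^esub> y = \<ominus>\<^bsub>V\<^esub> y" using V.smult_one[of y] y sub by auto
    then show ?thesis using smult[OF y, of "- 1"] by simp
  qed
  show ?thesis
    by (intro additive_subgroup.intro group.subgroupI)
      (use V.a_group sub ne add neg in \<open>auto simp: a_inv_def\<close>)
qed

text \<open>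
  The one-dimensional module on which \<open>r\<close> acts as the number \<open>\<epsilon> r\<close>. The simple modules at the vertices
  are of this form.
\<close>

definition character_module :: "('r \<Rightarrow> complex) \<Rightarrow> ('r, complex) module" where
  "character_module \<epsilon> = \<lparr>carrier = UNIV, mult = (*), one = 1, zero = 0, add = (+),
     smult = (\<lambda>r z. \<epsilon> r * z)\<rparr>"

lemma character_module_simps [simp]:
  "carrier (character_module \<epsilon>) = UNIV" "\<zero>\<^bsub>character_module \<epsilon>\<^esub> = 0"
  "x \<oplus>\<^bsub>character_module \<epsilon>\<^esub> y = x + y" "r \<odot>\<^bsub>character_module \<epsilon>\<^esub> z = \<epsilon> r * z"
  by (simp_all add: character_module_def)

lemma abelian_group_character_module: "abelian_group (character_module \<epsilon>)"
  by (rule abelian_groupI) (auto simp: algebra_simps intro: exI[of _ "- _"] add.left_inverse)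

text \<open>
  These are the cocycles of extensions of \<open>character_module \<epsilon>\<close> by \<open>N\<close>: if \<open>w\<close> is a lift of \<open>1\<close> to the
  extension, then \<open>r w = \<epsilon> r w + d r\<close> for a function \<open>d\<close> with values in \<open>N\<close>, and associativity of the
  action is the twisted Leibniz rule. Together with the Leibniz rule, the vanishing on scalars makes \<open>d\<close>
  complex linear.
\<close>

definition derivations ::
  "('r, 's) ring_scheme \<Rightarrow> (complex \<Rightarrow> 'r) \<Rightarrow> ('r \<Rightarrow> complex) \<Rightarrow> ('r, 'v) module \<Rightarrow> ('r \<Rightarrow> 'v) set" where
  "derivations R \<eta> \<epsilon> N = {d \<in> carrier R \<rightarrow>\<^sub>E carrier N.
     (\<forall>r\<in>carrier R. \<forall>s\<in>carrier R. d (r \<oplus>\<^bsub>R\<^esub> s) = d r \<oplus>\<^bsub>N\<^esub> d s) \<and>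
     (\<forall>r\<in>carrier R. \<forall>s\<in>carrier R. d (r \<otimes>\<^bsub>R\<^esub> s) = r \<odot>\<^bsub>N\<^esub> d s \<oplus>\<^bsub>N\<^esub> \<eta> (\<epsilon> s) \<odot>\<^bsub>N\<^esub> d r) \<and>
     (\<forall>c. d (\<eta> c) = \<zero>\<^bsub>N\<^esub>)}"

abbreviation derivation_space ::
  "('r, 's) ring_scheme \<Rightarrow> (complex \<Rightarrow> 'r) \<Rightarrow> ('r \<Rightarrow> complex) \<Rightarrow> ('r, 'v) module
    \<Rightarrow> (complex, 'r \<Rightarrow> 'v) module" where
  "derivation_space R \<eta> \<epsilon> N \<equiv> function_space \<eta> (carrier R) N (derivations R \<eta> \<epsilon> N)"

text \<open>
  The amount by which the cocycle changes when the lift of \<open>1\<close> is moved by \<open>m\<close>.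
\<close>

definition inner_derivation ::
  "('r, 's) ring_scheme \<Rightarrow> (complex \<Rightarrow> 'r) \<Rightarrow> ('r \<Rightarrow> complex) \<Rightarrow> ('r, 'v) module \<Rightarrow> 'v \<Rightarrow> 'r \<Rightarrow> 'v" where
  "inner_derivation R \<eta> \<epsilon> N m = (\<lambda>r\<in>carrier R. r \<odot>\<^bsub>N\<^esub> m \<ominus>\<^bsub>N\<^esub> \<eta> (\<epsilon> r) \<odot>\<^bsub>N\<^esub> m)"

abbreviation inner_derivations ::
  "('r, 's) ring_scheme \<Rightarrow> (complex \<Rightarrow> 'r) \<Rightarrow> ('r \<Rightarrow> complex) \<Rightarrow> ('r, 'v) module \<Rightarrow> ('r \<Rightarrow> 'v) set" where
  "inner_derivations R \<eta> \<epsilon> N \<equiv> inner_derivation R \<eta> \<epsilon> N ` carrier N"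

locale augmented_algebra = ring R for R :: "('r, 's) ring_scheme" (structure) +
  fixes \<eta> :: "complex \<Rightarrow> 'r" and \<epsilon> :: "'r \<Rightarrow> complex"
  assumes eta_closed [simp, intro]: "\<eta> c \<in> carrier R"
    and eta_add: "\<eta> (c + c') = \<eta> c \<oplus> \<eta> c'"
    and eta_mult: "\<eta> (c * c') = \<eta> c \<otimes> \<eta> c'"
    and eta_one: "\<eta> 1 = \<one>"
    and eta_central: "r \<in> carrier R \<Longrightarrow> \<eta> c \<otimes> r = r \<otimes> \<eta> c"
    and eps_add: "r \<in> carrier R \<Longrightarrow> s \<in> carrier R \<Longrightarrow> \<epsilon> (r \<oplus> s) = \<epsilon> r + \<epsilon> s"
    and eps_mult: "r \<in> carrier R \<Longrightarrow> s \<in> carrier R \<Longrightarrow> \<epsilon> (r \<otimes> s) = \<epsilon> r * \<epsilon> s"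
    and eps_eta [simp]: "\<epsilon> (\<eta> c) = c"
begin

lemma eta_zero: "\<eta> 0 = \<zero>"
  using eta_add[of 0 0] eta_closed[of 0] by simp

lemma eps_zero: "\<epsilon> \<zero> = 0"
  using eps_eta[of 0] by (simp add: eta_zero)

lemma eps_one: "\<epsilon> \<one> = 1"
  using eps_eta[of 1] by (simp add: eta_one)

lemma eps_minus: "r \<in> carrier R \<Longrightarrow> s \<in> carrier R \<Longrightarrow> \<epsilon> (r \<ominus> s) = \<epsilon> r - \<epsilon> s"
  using eps_add[of "r \<ominus> s" s] by (simp add: a_minus_def a_assoc l_neg)

abbreviation "S \<equiv> character_module \<epsilon>"
abbreviation "F \<equiv> free_module R (UNIV :: complex set)"
abbreviation "K \<equiv> syzygy R S"

text \<open>
  The presentation of \<open>S\<close> used in \<open>ext1_space\<close> has one generator for each complex number. Sending the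
  generator of \<open>z\<close> to \<open>\<eta> z\<close> is a map from this free module to \<open>R\<close>, and the evaluation onto \<open>S\<close> is this
  map followed by \<open>\<epsilon>\<close>. It reduces the large presentation to the small one given by \<open>\<epsilon>\<close> itself.
\<close>

definition contract :: "(complex \<Rightarrow> 'r) \<Rightarrow> 'r" where
  "contract f = (\<Oplus>z\<in>{z. f z \<noteq> \<zero>}. f z \<otimes> \<eta> z)"

lemma carrier_F: "f \<in> carrier F \<longleftrightarrow> (\<forall>z. f z \<in> carrier R) \<and> finite {z. f z \<noteq> \<zero>}"
  by (auto simp: free_module_def PiE_def)

lemma F_simps: "f \<oplus>\<^bsub>F\<^esub> g = (\<lambda>z. f z \<oplus> g z)" "r \<odot>\<^bsub>F\<^esub> f = (\<lambda>z. r \<otimes> f z)" "\<zero>\<^bsub>F\<^esub> = (\<lambda>z. \<zero>)"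
  by (simp_all add: free_module_def restrict_def)

lemma contract_superset:
  assumes f: "f \<in> carrier F" and B: "finite B" "{z. f z \<noteq> \<zero>} \<subseteq> B"
  shows "contract f = (\<Oplus>z\<in>B. f z \<otimes> \<eta> z)"
  unfolding contract_def
  by (rule add.finprod_mono_neutral_cong_left[OF B(1) B(2)]) (use f in \<open>auto simp: carrier_F\<close>)

lemma contract_closed: "f \<in> carrier F \<Longrightarrow> contract f \<in> carrier R"
  by (auto simp: contract_def carrier_F)

lemma F_add_closed: 
  assumes "f \<in> carrier F" "g \<in> carrier F" 
  shows "(\<lambda>z. f z \<oplus> g z) \<in> carrier F"
proof -
  have "{z. f z \<oplus> g z \<noteq> \<zero>} \<subseteq> {z. f z \<noteq> \<zero>} \<union> {z. g z \<noteq> \<zero>}" by auto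
  with assms show ?thesis by (auto simp: carrier_F intro: finite_subset)
qed

lemma F_smult_closed: 
  assumes "f \<in> carrier F" "r \<in> carrier R" 
  shows "(\<lambda>z. r \<otimes> f z) \<in> carrier F"
proof -
  have "{z. r \<otimes> f z \<noteq> \<zero>} \<subseteq> {z. f z \<noteq> \<zero>}" using assms by auto
  with assms show ?thesis by (auto simp: carrier_F intro: finite_subset)
qed

lemma contract_add:
  assumes f: "f \<in> carrier F" and g: "g \<in> carrier F"
  shows "contract (\<lambda>z. f z \<oplus> g z) = contract f \<oplus> contract g"
proof -
  let ?B = "{z. f z \<noteq> \<zero>} \<union> {z. g z \<noteq> \<zero>}"
  have B: "finite ?B" using f g by (simp add: carrier_F)
  have "contract (\<lambda>z. f z \<oplus> g z) = (\<Oplus>z\<in>?B. (f z \<oplus> g z) \<otimes> \<eta> z)"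
    by (rule contract_superset[OF F_add_closed[OF f g] B]) auto
  also have "\<dots> = (\<Oplus>z\<in>?B. f z \<otimes> \<eta> z \<oplus> g z \<otimes> \<eta> z)"
    using f g by (intro add.finprod_cong') (auto simp: carrier_F l_distr)
  also have "\<dots> = (\<Oplus>z\<in>?B. f z \<otimes> \<eta> z) \<oplus> (\<Oplus>z\<in>?B. g z \<otimes> \<eta> z)"
    using f g by (intro add.finprod_multf) (auto simp: carrier_F)
  also have "\<dots> = contract f \<oplus> contract g"
    using contract_superset[OF f B] contract_superset[OF g B] by simp
  finally show ?thesis .
qed

lemma contract_smult:
  assumes f: "f \<in> carrier F" and r: "r \<in> carrier R"
  shows "contract (\<lambda>z. r \<otimes> f z) = r \<otimes> contract f"
proof -
  let ?B = "{z. f z \<noteq> \<zero>}"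
  have B: "finite ?B" using f by (simp add: carrier_F)
  have "contract (\<lambda>z. r \<otimes> f z) = (\<Oplus>z\<in>?B. (r \<otimes> f z) \<otimes> \<eta> z)"
    by (rule contract_superset[OF F_smult_closed[OF f r] B]) (use r in auto)
  also have "\<dots> = (\<Oplus>z\<in>?B. r \<otimes> (f z \<otimes> \<eta> z))"
    using f r by (intro add.finprod_cong') (auto simp: carrier_F m_assoc)
  also have "\<dots> = r \<otimes> contract f"
    unfolding contract_def
    by (rule finsum_rdistr[OF B r, symmetric]) (use f in \<open>auto simp: carrier_F\<close>)
  finally show ?thesis .
qed

lemma contract_single:
  assumes r: "r \<in> carrier R"
  shows "contract (\<lambda>z. if z = 1 then r else \<zero>) = r"
proof -
  have f: "(\<lambda>z. if z = (1 :: complex) then r else \<zero>) \<in> carrier F"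
    using r by (auto simp: carrier_F intro: finite_subset[of _ "{1}"])
  have "contract (\<lambda>z. if z = 1 then r else \<zero>) = (\<Oplus>z\<in>{1}. (if z = 1 then r else \<zero>) \<otimes> \<eta> z)"
    by (rule contract_superset[OF f]) auto
  also have "\<dots> = r" using r by (simp add: eta_one)
  finally show ?thesis .
qed

lemma single_in_F:
  assumes r: "r \<in> carrier R"
  shows "(\<lambda>z. if z = (1 :: complex) then r else \<zero>) \<in> carrier F"
  using r by (auto simp: carrier_F intro: finite_subset[of _ "{1}"])

lemma free_eval_eq_eps_contract:
  assumes f: "f \<in> carrier F"
  shows "free_eval R S f = \<epsilon> (contract f)"
proof -
  interpret S: abelian_group S by (rule abelian_group_character_module)
  have "finsum S (\<lambda>z. f z \<odot>\<^bsub>S\<^esub> z) B = \<epsilon> (\<Oplus>z\<in>B. f z \<otimes> \<eta> z)" if "finite B" for B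
    using that
  proof (induction B rule: finite_induct)
    case empty
    then show ?case by (simp add: eps_zero)
  next
    case (insert x B)
    have fz: "f z \<in> carrier R" for z using f by (simp add: carrier_F)
    have "finsum S (\<lambda>z. f z \<odot>\<^bsub>S\<^esub> z) (insert x B) = f x \<odot>\<^bsub>S\<^esub> x \<oplus>\<^bsub>S\<^esub> finsum S (\<lambda>z. f z \<odot>\<^bsub>S\<^esub> z) B"
      using insert.hyps by (intro S.finsum_insert) auto
    moreover have "(\<Oplus>z\<in>insert x B. f z \<otimes> \<eta> z) = f x \<otimes> \<eta> x \<oplus> (\<Oplus>z\<in>B. f z \<otimes> \<eta> z)"
      using insert.hyps fz by (intro finsum_insert) auto
    moreover have "(\<Oplus>z\<in>B. f z \<otimes> \<eta> z) \<in> carrier R"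
      using fz by auto
    ultimately show ?case using insert.IH fz by (simp add: eps_add eps_mult)
  qed
  moreover have "finite {z. f z \<noteq> \<zero>}" using f by (simp add: carrier_F)
  ultimately show ?thesis by (simp add: free_eval_def contract_def)
qed

lemma carrier_K: "f \<in> carrier K \<longleftrightarrow> f \<in> carrier F \<and> \<epsilon> (contract f) = 0"
  by (auto simp: syzygy_def free_eval_eq_eps_contract)

lemma K_simps: "f \<oplus>\<^bsub>K\<^esub> g = (\<lambda>z. f z \<oplus> g z)" "r \<odot>\<^bsub>K\<^esub> f = (\<lambda>z. r \<otimes> f z)"
  by (simp_all add: syzygy_def F_simps)

text \<open>
  Since \<open>\<epsilon>\<close> kills \<open>r \<ominus> \<eta> (\<epsilon> r)\<close>, this multiple of the generator of \<open>1\<close> is a relation. A homomorphism on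
  the relations is determined up to restrictions from the free module by its values here, and these
  values form a derivation.
\<close>

definition kernel_element :: "'r \<Rightarrow> complex \<Rightarrow> 'r" where
  "kernel_element r = (\<lambda>z. if z = 1 then r \<ominus> \<eta> (\<epsilon> r) else \<zero>)"

lemma contract_kernel_element: "r \<in> carrier R \<Longrightarrow> contract (kernel_element r) = r \<ominus> \<eta> (\<epsilon> r)"
  by (simp add: kernel_element_def contract_single)

lemma kernel_element_in_K: "r \<in> carrier R \<Longrightarrow> kernel_element r \<in> carrier K"
  using single_in_F[of "r \<ominus> \<eta> (\<epsilon> r)"]
  by (simp add: carrier_K contract_kernel_element eps_minus) (simp add: kernel_element_def)

lemma kernel_element_add:
  "r \<in> carrier R \<Longrightarrow> s \<in> carrier R \<Longrightarrow> kernel_element (r \<oplus> s) = kernel_element r \<oplus>\<^bsub>K\<^esub> kernel_element s"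
  by (auto simp: kernel_element_def K_simps eps_add eta_add a_minus_def minus_add a_ac intro!: ext)

text \<open>
  The source of the Leibniz rule: \<open>r s - \<epsilon> (r s)\<close> is \<open>r (s - \<epsilon> s) + \<epsilon> s (r - \<epsilon> r)\<close>.
\<close>

lemma kernel_element_mult:
  assumes r: "r \<in> carrier R" and s: "s \<in> carrier R"
  shows "kernel_element (r \<otimes> s) = r \<odot>\<^bsub>K\<^esub> kernel_element s \<oplus>\<^bsub>K\<^esub> \<eta> (\<epsilon> s) \<odot>\<^bsub>K\<^esub> kernel_element r"
proof -
  have "r \<otimes> s \<ominus> \<eta> (\<epsilon> (r \<otimes> s)) = r \<otimes> (s \<ominus> \<eta> (\<epsilon> s)) \<oplus> \<eta> (\<epsilon> s) \<otimes> (r \<ominus> \<eta> (\<epsilon> r))"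
  proof -
    define a where "a = \<eta> (\<epsilon> s)"
    define b where "b = \<eta> (\<epsilon> r)"
    have ab: "a \<in> carrier R" "b \<in> carrier R" by (auto simp: a_def b_def)
    have "\<eta> (\<epsilon> (r \<otimes> s)) = a \<otimes> b"
      using r s by (simp add: eps_mult eta_mult[symmetric] mult.commute a_def b_def)
    moreover have "a \<otimes> r = r \<otimes> a" using r by (simp add: eta_central a_def)
    moreover have "x \<ominus> y = (x \<ominus> z) \<oplus> (z \<ominus> y)"
      if "x \<in> carrier R" "y \<in> carrier R" "z \<in> carrier R" for x y z
      using that by (simp add: a_minus_def a_assoc r_neg1)
    from this[of "r \<otimes> s" "a \<otimes> b" "r \<otimes> a"]
    have "r \<otimes> s \<ominus> a \<otimes> b = (r \<otimes> s \<ominus> r \<otimes> a) \<oplus> (r \<otimes> a \<ominus> a \<otimes> b)"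
      using r s ab by simp
    ultimately show ?thesis
      unfolding a_def[symmetric] b_def[symmetric] using r s ab
      by (simp add: a_minus_def r_distr r_minus)
  qed
  then show ?thesis using r s by (auto simp: kernel_element_def K_simps intro!: ext)
qed

lemma kernel_element_eta: "kernel_element (\<eta> c) = (\<lambda>z. \<zero>)"
  by (auto simp: kernel_element_def a_minus_def r_neg)

end

context left_module
begin

lemma smult_zero_right: "r \<in> carrier R \<Longrightarrow> r \<odot>\<^bsub>M\<^esub> \<zero>\<^bsub>M\<^esub> = \<zero>\<^bsub>M\<^esub>"
  using smult_r_distr[of r "\<zero>\<^bsub>M\<^esub>" "\<zero>\<^bsub>M\<^esub>"] smult_closed[of r "\<zero>\<^bsub>M\<^esub>"] by simp

lemma smult_zero_left: "x \<in> carrier M \<Longrightarrow> \<zero> \<odot>\<^bsub>M\<^esub> x = \<zero>\<^bsub>M\<^esub>"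
  using smult_l_distr[of \<zero> \<zero> x] smult_closed[of \<zero> x] by simp

end

locale augmented_module = augmented_algebra R \<eta> \<epsilon> + N: left_module R N
  for R :: "('r, 's) ring_scheme" (structure) and \<eta> \<epsilon> and N :: "('r, 'v) module"
begin

lemmas smult_zero_right = N.smult_zero_right and smult_zero_left = N.smult_zero_left

lemma smult_minus_right:
  assumes "r \<in> carrier R" "x \<in> carrier N"
  shows "r \<odot>\<^bsub>N\<^esub> (\<ominus>\<^bsub>N\<^esub> x) = \<ominus>\<^bsub>N\<^esub> (r \<odot>\<^bsub>N\<^esub> x)"
proof (rule N.minus_equality[symmetric])
  show "r \<odot>\<^bsub>N\<^esub> (\<ominus>\<^bsub>N\<^esub> x) \<oplus>\<^bsub>N\<^esub> r \<odot>\<^bsub>N\<^esub> x = \<zero>\<^bsub>N\<^esub>"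
    using assms by (simp add: N.smult_r_distr[symmetric] N.l_neg smult_zero_right)
qed (use assms N.smult_closed in auto)

lemma smult_minus_left:
  assumes "r \<in> carrier R" "x \<in> carrier N"
  shows "(\<ominus> r) \<odot>\<^bsub>N\<^esub> x = \<ominus>\<^bsub>N\<^esub> (r \<odot>\<^bsub>N\<^esub> x)"
proof (rule N.minus_equality[symmetric])
  show "(\<ominus> r) \<odot>\<^bsub>N\<^esub> x \<oplus>\<^bsub>N\<^esub> r \<odot>\<^bsub>N\<^esub> x = \<zero>\<^bsub>N\<^esub>"
    using assms by (simp add: N.smult_l_distr[symmetric] l_neg smult_zero_left)
qed (use assms N.smult_closed in auto)

lemma eta_smult_commute:
  assumes "r \<in> carrier R" "x \<in> carrier N"
  shows "\<eta> c \<odot>\<^bsub>N\<^esub> (r \<odot>\<^bsub>N\<^esub> x) = r \<odot>\<^bsub>N\<^esub> (\<eta> c \<odot>\<^bsub>N\<^esub> x)"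
  using assms by (simp add: N.smult_assoc[symmetric] eta_central)

lemma module_function_space:
  assumes H: "H \<subseteq> A \<rightarrow>\<^sub>E carrier N" and ne: "H \<noteq> {}"
    and add: "\<And>f g. f \<in> H \<Longrightarrow> g \<in> H \<Longrightarrow> (\<lambda>x\<in>A. f x \<oplus>\<^bsub>N\<^esub> g x) \<in> H"
    and smult: "\<And>c f. f \<in> H \<Longrightarrow> (\<lambda>x\<in>A. \<eta> c \<odot>\<^bsub>N\<^esub> f x) \<in> H"
  shows "module complex_field (function_space \<eta> A N H)"
proof -
  have val: "f x \<in> carrier N" if "f \<in> H" "x \<in> A" for f x using H that by auto
  show ?thesis
  proof (rule moduleI)
    show "cring (complex_field :: complex ring)"
      by (rule domain.axioms(1)[OF field.axioms(1)[OF class_field]])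
    have ext: "f = g" if "f \<in> H" "g \<in> H" "\<And>x. x \<in> A \<Longrightarrow> f x = g x" for f g
      using H that by (intro extensionalityI[of _ A]) (auto simp: PiE_def)
    have zero: "(\<lambda>x\<in>A. \<zero>\<^bsub>N\<^esub>) \<in> H"
    proof -
      obtain f where f: "f \<in> H" using ne by blast
      have "(\<lambda>x\<in>A. \<eta> 0 \<odot>\<^bsub>N\<^esub> f x) = (\<lambda>x\<in>A. \<zero>\<^bsub>N\<^esub>)"
        using val[OF f] by (intro restrict_ext) (auto simp: eta_zero smult_zero_left)
      then show ?thesis using smult[OF f, of 0] by simp
    qed
    have neg: "(\<lambda>x\<in>A. \<ominus>\<^bsub>N\<^esub> f x) \<in> H" if f: "f \<in> H" for f
    proof -
      have "\<eta> (- 1) = \<ominus> \<one>"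
        using eta_add[of "- 1" 1] by (intro minus_equality[symmetric]) (auto simp: eta_zero eta_one)
      then have "\<eta> (- 1) \<odot>\<^bsub>N\<^esub> y = \<ominus>\<^bsub>N\<^esub> y" if "y \<in> carrier N" for y
        using that by (simp add: smult_minus_left N.smult_one)
      then have "(\<lambda>x\<in>A. \<eta> (- 1) \<odot>\<^bsub>N\<^esub> f x) = (\<lambda>x\<in>A. \<ominus>\<^bsub>N\<^esub> f x)"
        using val[OF f] by (intro restrict_ext) auto
      then show ?thesis using smult[OF f, of "- 1"] by simp
    qed
    show "abelian_group (function_space \<eta> A N H)"
    proof (rule abelian_groupI)
      fix f assume f: "f \<in> carrier (function_space \<eta> A N H)"
      show "\<exists>g\<in>carrier (function_space \<eta> A N H). g \<oplus>\<^bsub>function_space \<eta> A N H\<^esub> f = \<zero>\<^bsub>function_space \<eta> A N H\<^esub>"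
        using f neg[of f] val[of f] by (intro bexI[of _ "\<lambda>x\<in>A. \<ominus>\<^bsub>N\<^esub> f x"]) (auto simp: N.l_neg intro!: restrict_ext)
      show "\<zero>\<^bsub>function_space \<eta> A N H\<^esub> \<oplus>\<^bsub>function_space \<eta> A N H\<^esub> f = f"
        using ext[OF add[OF zero, of f], of f] f val[of f] by auto
    qed (use add zero val in \<open>auto simp: N.a_ac intro!: restrict_ext\<close>)
    show "\<one>\<^bsub>complex_field\<^esub> \<odot>\<^bsub>function_space \<eta> A N H\<^esub> f = f" if "f \<in> carrier (function_space \<eta> A N H)" for f
      using ext[OF smult[of f 1], of f] that val[of f] by (auto simp: eta_one N.smult_one)
  qed (use smult add val in \<open>auto simp: N.smult_l_distr N.smult_r_distr eta_add eta_mult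
    N.smult_assoc N.smult_closed intro!: restrict_ext\<close>)
qed

lemma derivationsD:
  assumes "d \<in> derivations R \<eta> \<epsilon> N"
  shows "r \<in> carrier R \<Longrightarrow> d r \<in> carrier N"
    and "r \<in> carrier R \<Longrightarrow> s \<in> carrier R \<Longrightarrow> d (r \<oplus> s) = d r \<oplus>\<^bsub>N\<^esub> d s"
    and "r \<in> carrier R \<Longrightarrow> s \<in> carrier R \<Longrightarrow>
      d (r \<otimes> s) = r \<odot>\<^bsub>N\<^esub> d s \<oplus>\<^bsub>N\<^esub> \<eta> (\<epsilon> s) \<odot>\<^bsub>N\<^esub> d r"
    and "d (\<eta> c) = \<zero>\<^bsub>N\<^esub>"
    and "d \<in> extensional (carrier R)"
  using assms by (auto simp: derivations_def PiE_def Pi_def)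

lemma derivation_minus:
  assumes d: "d \<in> derivations R \<eta> \<epsilon> N" and "r \<in> carrier R" "s \<in> carrier R"
  shows "d (r \<ominus> s) = d r \<ominus>\<^bsub>N\<^esub> d s"
proof -
  have "d r = d (r \<ominus> s) \<oplus>\<^bsub>N\<^esub> d s"
    using assms derivationsD(2)[OF d, of "r \<ominus> s" s] by (simp add: a_minus_def a_assoc l_neg)
  then show ?thesis
    using assms derivationsD(1)[OF d] by (simp add: a_minus_def N.a_assoc N.r_neg N.minus_eq)
qed

lemma derivationsI:
  assumes "\<And>r. r \<in> carrier R \<Longrightarrow> d r \<in> carrier N"
    and "\<And>r s. r \<in> carrier R \<Longrightarrow> s \<in> carrier R \<Longrightarrow> d (r \<oplus> s) = d r \<oplus>\<^bsub>N\<^esub> d s"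
    and "\<And>r s. r \<in> carrier R \<Longrightarrow> s \<in> carrier R \<Longrightarrow>
      d (r \<otimes> s) = r \<odot>\<^bsub>N\<^esub> d s \<oplus>\<^bsub>N\<^esub> \<eta> (\<epsilon> s) \<odot>\<^bsub>N\<^esub> d r"
    and "\<And>c. d (\<eta> c) = \<zero>\<^bsub>N\<^esub>"
  shows "(\<lambda>r\<in>carrier R. d r) \<in> derivations R \<eta> \<epsilon> N"
  using assms by (auto simp: derivations_def)

lemma derivation_add:
  assumes d: "d \<in> derivations R \<eta> \<epsilon> N" and e: "e \<in> derivations R \<eta> \<epsilon> N"
  shows "(\<lambda>r\<in>carrier R. d r \<oplus>\<^bsub>N\<^esub> e r) \<in> derivations R \<eta> \<epsilon> N"
  using derivationsD(1-4)[OF d] derivationsD(1-4)[OF e]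
  by (intro derivationsI) (auto simp: N.a_ac N.smult_r_distr N.smult_closed)

lemma derivation_smult:
  assumes d: "d \<in> derivations R \<eta> \<epsilon> N"
  shows "(\<lambda>r\<in>carrier R. \<eta> c \<odot>\<^bsub>N\<^esub> d r) \<in> derivations R \<eta> \<epsilon> N"
proof (rule derivationsI)
  fix r s assume rs: "r \<in> carrier R" "s \<in> carrier R"
  note dc = derivationsD(1)[OF d]
  have "\<eta> c \<odot>\<^bsub>N\<^esub> (r \<odot>\<^bsub>N\<^esub> d s) = r \<odot>\<^bsub>N\<^esub> (\<eta> c \<odot>\<^bsub>N\<^esub> d s)"
    and "\<eta> c \<odot>\<^bsub>N\<^esub> (\<eta> (\<epsilon> s) \<odot>\<^bsub>N\<^esub> d r) = \<eta> (\<epsilon> s) \<odot>\<^bsub>N\<^esub> (\<eta> c \<odot>\<^bsub>N\<^esub> d r)"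
    using rs dc by (auto intro: eta_smult_commute)
  then show "\<eta> c \<odot>\<^bsub>N\<^esub> d (r \<otimes> s) =
      r \<odot>\<^bsub>N\<^esub> (\<eta> c \<odot>\<^bsub>N\<^esub> d s) \<oplus>\<^bsub>N\<^esub> \<eta> (\<epsilon> s) \<odot>\<^bsub>N\<^esub> (\<eta> c \<odot>\<^bsub>N\<^esub> d r)"
    using rs dc by (simp add: derivationsD(3)[OF d] N.smult_r_distr N.smult_closed)
qed (use derivationsD(1-4)[OF d] in \<open>auto simp: N.smult_r_distr N.smult_closed smult_zero_right\<close>)

lemma inner_derivation_in_derivations:
  assumes m: "m \<in> carrier N"
  shows "inner_derivation R \<eta> \<epsilon> N m \<in> derivations R \<eta> \<epsilon> N"
proof -
  have closed: "r \<odot>\<^bsub>N\<^esub> m \<in> carrier N" if "r \<in> carrier R" for r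
    using that m by (rule N.smult_closed)
  have telescope: "(a \<ominus>\<^bsub>N\<^esub> b) \<oplus>\<^bsub>N\<^esub> (b \<ominus>\<^bsub>N\<^esub> c) = a \<ominus>\<^bsub>N\<^esub> c" if "a \<in> carrier N" "b \<in> carrier N" "c \<in> carrier N" for a b c
    using that by (simp add: N.minus_eq N.a_assoc N.r_neg1)
  show ?thesis
    unfolding inner_derivation_def
  proof (rule derivationsI)
    fix r s assume rs: "r \<in> carrier R" "s \<in> carrier R"
    then show "(r \<oplus> s) \<odot>\<^bsub>N\<^esub> m \<ominus>\<^bsub>N\<^esub> \<eta> (\<epsilon> (r \<oplus> s)) \<odot>\<^bsub>N\<^esub> m =
        r \<odot>\<^bsub>N\<^esub> m \<ominus>\<^bsub>N\<^esub> \<eta> (\<epsilon> r) \<odot>\<^bsub>N\<^esub> m \<oplus>\<^bsub>N\<^esub> (s \<odot>\<^bsub>N\<^esub> m \<ominus>\<^bsub>N\<^esub> \<eta> (\<epsilon> s) \<odot>\<^bsub>N\<^esub> m)"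
      using m closed by (simp add: N.smult_l_distr eps_add eta_add N.minus_eq N.minus_add N.a_ac)
    let ?a = "\<eta> (\<epsilon> s)" and ?b = "\<eta> (\<epsilon> r)"
    have "(r \<otimes> s) \<odot>\<^bsub>N\<^esub> m = r \<odot>\<^bsub>N\<^esub> (s \<odot>\<^bsub>N\<^esub> m)"
      using rs m by (rule N.smult_assoc)
    moreover have "\<eta> (\<epsilon> (r \<otimes> s)) \<odot>\<^bsub>N\<^esub> m = ?a \<odot>\<^bsub>N\<^esub> (?b \<odot>\<^bsub>N\<^esub> m)"
      using rs m by (simp add: eps_mult mult.commute[of "\<epsilon> r"] eta_mult N.smult_assoc)
    moreover have "r \<odot>\<^bsub>N\<^esub> (s \<odot>\<^bsub>N\<^esub> m \<ominus>\<^bsub>N\<^esub> ?a \<odot>\<^bsub>N\<^esub> m) = r \<odot>\<^bsub>N\<^esub> (s \<odot>\<^bsub>N\<^esub> m) \<ominus>\<^bsub>N\<^esub> r \<odot>\<^bsub>N\<^esub> (?a \<odot>\<^bsub>N\<^esub> m)"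
      using rs closed by (simp add: N.minus_eq N.smult_r_distr smult_minus_right)
    moreover have "?a \<odot>\<^bsub>N\<^esub> (r \<odot>\<^bsub>N\<^esub> m) = r \<odot>\<^bsub>N\<^esub> (?a \<odot>\<^bsub>N\<^esub> m)"
      using rs(1) m by (rule eta_smult_commute)
    then have "?a \<odot>\<^bsub>N\<^esub> (r \<odot>\<^bsub>N\<^esub> m \<ominus>\<^bsub>N\<^esub> ?b \<odot>\<^bsub>N\<^esub> m) = r \<odot>\<^bsub>N\<^esub> (?a \<odot>\<^bsub>N\<^esub> m) \<ominus>\<^bsub>N\<^esub> ?a \<odot>\<^bsub>N\<^esub> (?b \<odot>\<^bsub>N\<^esub> m)"
      using rs closed m by (simp add: N.minus_eq N.smult_r_distr smult_minus_right N.smult_closed)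
    ultimately show "(r \<otimes> s) \<odot>\<^bsub>N\<^esub> m \<ominus>\<^bsub>N\<^esub> \<eta> (\<epsilon> (r \<otimes> s)) \<odot>\<^bsub>N\<^esub> m =
        r \<odot>\<^bsub>N\<^esub> (s \<odot>\<^bsub>N\<^esub> m \<ominus>\<^bsub>N\<^esub> ?a \<odot>\<^bsub>N\<^esub> m) \<oplus>\<^bsub>N\<^esub> ?a \<odot>\<^bsub>N\<^esub> (r \<odot>\<^bsub>N\<^esub> m \<ominus>\<^bsub>N\<^esub> ?b \<odot>\<^bsub>N\<^esub> m)"
      using rs closed by (simp add: telescope N.smult_closed)
  qed (use closed in \<open>auto simp: N.minus_eq N.r_neg\<close>)
qed

lemma inner_derivation_add:
  assumes "m \<in> carrier N" "m' \<in> carrier N"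
  shows "inner_derivation R \<eta> \<epsilon> N (m \<oplus>\<^bsub>N\<^esub> m') =
    (\<lambda>r\<in>carrier R. inner_derivation R \<eta> \<epsilon> N m r \<oplus>\<^bsub>N\<^esub> inner_derivation R \<eta> \<epsilon> N m' r)"
  unfolding inner_derivation_def
  by (rule restrict_ext) (use assms in \<open>simp add: N.smult_r_distr N.minus_eq N.minus_add N.a_ac N.smult_closed\<close>)

lemma inner_derivation_smult:
  assumes "m \<in> carrier N"
  shows "inner_derivation R \<eta> \<epsilon> N (\<eta> c \<odot>\<^bsub>N\<^esub> m) = (\<lambda>r\<in>carrier R. \<eta> c \<odot>\<^bsub>N\<^esub> inner_derivation R \<eta> \<epsilon> N m r)"
  unfolding inner_derivation_def
proof (rule restrict_ext, subst restrict_apply', assumption)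
  fix r assume r: "r \<in> carrier R"
  have "\<eta> c \<odot>\<^bsub>N\<^esub> (r \<odot>\<^bsub>N\<^esub> m) = r \<odot>\<^bsub>N\<^esub> (\<eta> c \<odot>\<^bsub>N\<^esub> m)"
    and "\<eta> c \<odot>\<^bsub>N\<^esub> (\<eta> (\<epsilon> r) \<odot>\<^bsub>N\<^esub> m) = \<eta> (\<epsilon> r) \<odot>\<^bsub>N\<^esub> (\<eta> c \<odot>\<^bsub>N\<^esub> m)"
    using r assms by (auto intro: eta_smult_commute)
  then show "r \<odot>\<^bsub>N\<^esub> (\<eta> c \<odot>\<^bsub>N\<^esub> m) \<ominus>\<^bsub>N\<^esub> \<eta> (\<epsilon> r) \<odot>\<^bsub>N\<^esub> (\<eta> c \<odot>\<^bsub>N\<^esub> m) =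
      \<eta> c \<odot>\<^bsub>N\<^esub> (r \<odot>\<^bsub>N\<^esub> m \<ominus>\<^bsub>N\<^esub> \<eta> (\<epsilon> r) \<odot>\<^bsub>N\<^esub> m)"
    using r assms by (simp add: N.smult_r_distr N.minus_eq smult_minus_right N.smult_closed)
qed

lemma module_derivation_space: "module complex_field (derivation_space R \<eta> \<epsilon> N)"
proof (rule module_function_space)
  show "derivations R \<eta> \<epsilon> N \<noteq> {}" using inner_derivation_in_derivations[of "\<zero>\<^bsub>N\<^esub>"] by auto
qed (auto simp: derivation_add derivation_smult, auto simp: derivations_def)

lemma inner_derivations_subgroup: "additive_subgroup (inner_derivations R \<eta> \<epsilon> N) (derivation_space R \<eta> \<epsilon> N)"
  using inner_derivation_in_derivations
  by (intro additive_subgroup_if_subspace module_derivation_space)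
    (auto simp: inner_derivation_add[symmetric] inner_derivation_smult[symmetric] N.smult_closed)

lemma inner_derivations_smult:
  "\<forall>c. \<forall>d\<in>inner_derivations R \<eta> \<epsilon> N. c \<odot>\<^bsub>derivation_space R \<eta> \<epsilon> N\<^esub> d \<in> inner_derivations R \<eta> \<epsilon> N"
  by (auto simp: inner_derivation_smult[symmetric] N.smult_closed)

lemma hom_set_iff:
  "f \<in> hom_set R X N \<longleftrightarrow> f \<in> carrier X \<rightarrow>\<^sub>E carrier N \<and>
    (\<forall>x\<in>carrier X. \<forall>y\<in>carrier X. f (x \<oplus>\<^bsub>X\<^esub> y) = f x \<oplus>\<^bsub>N\<^esub> f y) \<and>
    (\<forall>r\<in>carrier R. \<forall>x\<in>carrier X. f (r \<odot>\<^bsub>X\<^esub> x) = r \<odot>\<^bsub>N\<^esub> f x)"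
  by (auto simp: hom_set_def module_hom_def PiE_def)

lemma module_hom_space:
  assumes add: "\<And>x y. x \<in> carrier X \<Longrightarrow> y \<in> carrier X \<Longrightarrow> x \<oplus>\<^bsub>X\<^esub> y \<in> carrier X"
    and smult: "\<And>r x. r \<in> carrier R \<Longrightarrow> x \<in> carrier X \<Longrightarrow> r \<odot>\<^bsub>X\<^esub> x \<in> carrier X"
  shows "module complex_field (hom_space R \<eta> X N)"
  unfolding hom_space_eq_function_space
proof (rule module_function_space)
  have "(\<lambda>x\<in>carrier X. \<zero>\<^bsub>N\<^esub>) \<in> hom_set R X N"
    using add smult by (auto simp: hom_set_iff smult_zero_right)
  then show "hom_set R X N \<noteq> {}" by blast
  show "(\<lambda>x\<in>carrier X. f x \<oplus>\<^bsub>N\<^esub> g x) \<in> hom_set R X N" if "f \<in> hom_set R X N" "g \<in> hom_set R X N" for f g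
  proof -
    have "f x \<in> carrier N" "g x \<in> carrier N" if "x \<in> carrier X" for x
      using that \<open>f \<in> _\<close> \<open>g \<in> _\<close> by (auto simp: hom_set_iff)
    then show ?thesis
      using that add smult by (auto simp: hom_set_iff N.a_ac N.smult_r_distr)
  qed
  show "(\<lambda>x\<in>carrier X. \<eta> c \<odot>\<^bsub>N\<^esub> f x) \<in> hom_set R X N" if "f \<in> hom_set R X N" for c f
  proof -
    have "f x \<in> carrier N" if "x \<in> carrier X" for x
      using that \<open>f \<in> _\<close> by (auto simp: hom_set_iff)
    then show ?thesis
      using that add smult
      by (auto simp: hom_set_iff N.smult_closed N.smult_r_distr intro: eta_smult_commute)
  qed
qed (auto simp: hom_set_iff)

end

context augmented_module
begin

lemma carrier_F_closed:
  shows "f \<in> carrier F \<Longrightarrow> g \<in> carrier F \<Longrightarrow> f \<oplus>\<^bsub>F\<^esub> g \<in> carrier F"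
    and "f \<in> carrier F \<Longrightarrow> r \<in> carrier R \<Longrightarrow> r \<odot>\<^bsub>F\<^esub> f \<in> carrier F"
  by (simp_all add: F_simps F_add_closed F_smult_closed)

lemma carrier_K_closed:
  shows "f \<in> carrier K \<Longrightarrow> g \<in> carrier K \<Longrightarrow> f \<oplus>\<^bsub>K\<^esub> g \<in> carrier K"
    and "f \<in> carrier K \<Longrightarrow> r \<in> carrier R \<Longrightarrow> r \<odot>\<^bsub>K\<^esub> f \<in> carrier K"
  by (simp_all add: K_simps carrier_K F_add_closed F_smult_closed contract_add contract_smult
      eps_add eps_mult contract_closed)

definition derivation_of_hom :: "((complex \<Rightarrow> 'r) \<Rightarrow> 'v) \<Rightarrow> 'r \<Rightarrow> 'v" where
  "derivation_of_hom h = (\<lambda>r\<in>carrier R. h (kernel_element r))"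

lemma hom_K_D:
  assumes "h \<in> hom_set R K N"
  shows "f \<in> carrier K \<Longrightarrow> h f \<in> carrier N"
    and "f \<in> carrier K \<Longrightarrow> g \<in> carrier K \<Longrightarrow> h (f \<oplus>\<^bsub>K\<^esub> g) = h f \<oplus>\<^bsub>N\<^esub> h g"
    and "r \<in> carrier R \<Longrightarrow> f \<in> carrier K \<Longrightarrow> h (r \<odot>\<^bsub>K\<^esub> f) = r \<odot>\<^bsub>N\<^esub> h f"
    and "h \<in> extensional (carrier K)"
  using assms by (auto simp: hom_set_iff PiE_def Pi_def)

lemma derivation_of_hom_in_derivations:
  assumes h: "h \<in> hom_set R K N"
  shows "derivation_of_hom h \<in> derivations R \<eta> \<epsilon> N"
  unfolding derivation_of_hom_def
proof (rule derivationsI)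
  fix r s assume rs: "r \<in> carrier R" "s \<in> carrier R"
  note [simp] = kernel_element_in_K carrier_K_closed
  show "h (kernel_element (r \<oplus> s)) = h (kernel_element r) \<oplus>\<^bsub>N\<^esub> h (kernel_element s)"
    using rs by (simp add: kernel_element_add hom_K_D[OF h])
  show "h (kernel_element (r \<otimes> s)) =
      r \<odot>\<^bsub>N\<^esub> h (kernel_element s) \<oplus>\<^bsub>N\<^esub> \<eta> (\<epsilon> s) \<odot>\<^bsub>N\<^esub> h (kernel_element r)"
    using rs by (simp add: kernel_element_mult hom_K_D[OF h])
next
  fix c
  have k: "kernel_element (\<eta> c) \<in> carrier K" by (simp add: kernel_element_in_K)
  have "\<zero> \<odot>\<^bsub>K\<^esub> kernel_element (\<eta> c) = kernel_element (\<eta> c)"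
    by (simp add: kernel_element_eta K_simps)
  then have "h (kernel_element (\<eta> c)) = \<zero> \<odot>\<^bsub>N\<^esub> h (kernel_element (\<eta> c))"
    using hom_K_D(3)[OF h zero_closed k] by simp
  then show "h (kernel_element (\<eta> c)) = \<zero>\<^bsub>N\<^esub>"
    using hom_K_D(1)[OF h k] by (simp add: smult_zero_left)
qed (simp add: hom_K_D[OF h] kernel_element_in_K)

lemma derivation_of_hom_linear:
  "derivation_of_hom \<in> module_hom complex_field (hom_space R \<eta> K N) (derivation_space R \<eta> \<epsilon> N)"
  using derivation_of_hom_in_derivations
  by (auto simp: module_hom_def hom_space_eq_function_space derivation_of_hom_def kernel_element_in_K intro!: restrict_ext)

text \<open>
  The derivation \<open>d\<close> is induced by \<open>d \<circ> contract\<close>. This composite is linear on relations \<open>f\<close>, because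
  \<open>\<epsilon> (contract f) = 0\<close> removes the second term of the Leibniz rule.
\<close>

lemma derivation_of_hom_surj:
  assumes d: "d \<in> derivations R \<eta> \<epsilon> N"
  shows "\<exists>h\<in>hom_set R K N. derivation_of_hom h = d"
proof -
  define h where "h = (\<lambda>f\<in>carrier K. d (contract f))"
  have cK: "contract f \<in> carrier R" "f \<in> carrier F" "\<epsilon> (contract f) = 0" if "f \<in> carrier K" for f
    using that by (auto simp: carrier_K contract_closed)
  have dR: "d r \<in> carrier N" if "r \<in> carrier R" for r using derivationsD(1)[OF d that] .
  have "h \<in> hom_set R K N"
    unfolding hom_set_iff
  proof (intro conjI ballI)
    show "h \<in> carrier K \<rightarrow>\<^sub>E carrier N" using cK dR by (auto simp: h_def)
  next
    fix f g assume fg: "f \<in> carrier K" "g \<in> carrier K"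
    then show "h (f \<oplus>\<^bsub>K\<^esub> g) = h f \<oplus>\<^bsub>N\<^esub> h g"
      using carrier_K_closed(1)[OF fg] cK by (simp add: h_def K_simps contract_add derivationsD(2)[OF d])
  next
    fix r f assume rf: "r \<in> carrier R" "f \<in> carrier K"
    then show "h (r \<odot>\<^bsub>K\<^esub> f) = r \<odot>\<^bsub>N\<^esub> h f"
      using carrier_K_closed(2)[OF rf(2,1)] cK
      by (simp add: h_def K_simps contract_smult derivationsD(3)[OF d] eta_zero smult_zero_left dR N.smult_closed)
  qed
  moreover have "derivation_of_hom h = d"
  proof (rule extensionalityI[of _ "carrier R"])
    fix r assume r: "r \<in> carrier R"
    have "derivation_of_hom h r = d (r \<ominus> \<eta> (\<epsilon> r))"
      using r by (simp add: derivation_of_hom_def h_def kernel_element_in_K contract_kernel_element)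
    also have "\<dots> = d r"
      using r by (simp add: derivation_minus[OF d] derivationsD(4)[OF d] N.minus_eq dR)
    finally show "derivation_of_hom h r = d r" .
  qed (auto simp: derivation_of_hom_def derivationsD(5)[OF d])
  ultimately show ?thesis by blast
qed

text \<open>
  A homomorphism on the free module induces the inner derivation of its value at the generator of \<open>1\<close>.
  Conversely, let \<open>h\<close> induce the inner derivation of \<open>m\<close>. Subtracting from \<open>f\<close> the multiple
  \<open>contract f\<close> of the generator of \<open>1\<close> gives a relation, and prescribing the value \<open>m\<close> at that generator
  extends \<open>h\<close> to the free module. On a relation \<open>f\<close> the extension agrees with \<open>h\<close>, because the subtracted
  multiple is then the kernel element of \<open>contract f\<close>, where \<open>h\<close> is known.
\<close>

lemma derivation_of_hom_inner_iff:
  assumes h: "h \<in> hom_set R K N"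
  shows "derivation_of_hom h \<in> inner_derivations R \<eta> \<epsilon> N \<longleftrightarrow>
    h \<in> (\<lambda>H. restrict H (carrier K)) ` hom_set R F N"
proof
  assume "h \<in> (\<lambda>H. restrict H (carrier K)) ` hom_set R F N"
  then obtain H where H: "H \<in> hom_set R F N" and hH: "h = restrict H (carrier K)" by blast
  define b :: "complex \<Rightarrow> 'r" where "b = (\<lambda>z. if z = 1 then \<one> else \<zero>)"
  have b: "b \<in> carrier F" unfolding b_def by (rule single_in_F) simp
  have kb: "kernel_element r = (r \<ominus> \<eta> (\<epsilon> r)) \<odot>\<^bsub>F\<^esub> b" if "r \<in> carrier R" for r
    using that by (auto simp: kernel_element_def b_def F_simps intro!: ext)
  have Hb: "H b \<in> carrier N" using H b by (auto simp: hom_set_iff)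
  have "derivation_of_hom h = inner_derivation R \<eta> \<epsilon> N (H b)"
    unfolding derivation_of_hom_def inner_derivation_def
  proof (rule restrict_ext)
    fix r assume r: "r \<in> carrier R"
    have "h (kernel_element r) = H (kernel_element r)"
      using r by (simp add: hH kernel_element_in_K)
    also have "\<dots> = (r \<ominus> \<eta> (\<epsilon> r)) \<odot>\<^bsub>N\<^esub> H b"
      using r H b by (simp add: kb hom_set_iff)
    also have "\<dots> = r \<odot>\<^bsub>N\<^esub> H b \<ominus>\<^bsub>N\<^esub> \<eta> (\<epsilon> r) \<odot>\<^bsub>N\<^esub> H b"
      using r Hb by (simp add: a_minus_def N.smult_l_distr smult_minus_left)
    finally show "h (kernel_element r) = r \<odot>\<^bsub>N\<^esub> H b \<ominus>\<^bsub>N\<^esub> \<eta> (\<epsilon> r) \<odot>\<^bsub>N\<^esub> H b" .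
  qed
  then show "derivation_of_hom h \<in> inner_derivations R \<eta> \<epsilon> N" using Hb by blast
next
  assume "derivation_of_hom h \<in> inner_derivations R \<eta> \<epsilon> N"
  then obtain m where m: "m \<in> carrier N" and hm: "derivation_of_hom h = inner_derivation R \<eta> \<epsilon> N m"
    by blast
  have hk: "h (kernel_element r) = r \<odot>\<^bsub>N\<^esub> m \<ominus>\<^bsub>N\<^esub> \<eta> (\<epsilon> r) \<odot>\<^bsub>N\<^esub> m" if "r \<in> carrier R" for r
    using fun_cong[OF hm, of r] that by (simp add: derivation_of_hom_def inner_derivation_def)
  define s where "s f = (\<lambda>z. if z = (1 :: complex) then contract f else \<zero>)" for f
  define p where "p f = (\<lambda>z. f z \<ominus> s f z)" for f
  define H where "H = (\<lambda>f\<in>carrier F. h (p f) \<oplus>\<^bsub>N\<^esub> contract f \<odot>\<^bsub>N\<^esub> m)"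
  have s: "s f \<in> carrier F" if "f \<in> carrier F" for f
    unfolding s_def by (rule single_in_F) (use that contract_closed in auto)
  have pF: "p f = (\<lambda>z. f z \<oplus> (\<ominus> \<one>) \<otimes> s f z)" if "f \<in> carrier F" for f
    using s[OF that] by (auto simp: p_def a_minus_def carrier_F l_minus intro!: ext)
  have pK: "p f \<in> carrier K" if f: "f \<in> carrier F" for f
  proof -
    have "contract (s f) = contract f" unfolding s_def by (rule contract_single) (simp add: f contract_closed)
    then have "contract (p f) = contract f \<oplus> (\<ominus> \<one>) \<otimes> contract f"
      using f s[OF f] by (simp add: pF contract_add contract_smult F_smult_closed)
    then have "contract (p f) = \<zero>" using f by (simp add: l_minus contract_closed r_neg)
    then show ?thesis using f s[OF f] by (simp add: carrier_K eps_zero) (simp add: pF F_add_closed F_smult_closed)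
  qed
  have p_add: "p (f \<oplus>\<^bsub>F\<^esub> g) = p f \<oplus>\<^bsub>K\<^esub> p g" if fg: "f \<in> carrier F" "g \<in> carrier F" for f g
  proof
    fix z
    have c: "f z \<in> carrier R" "g z \<in> carrier R" "contract f \<in> carrier R" "contract g \<in> carrier R"
      using fg by (auto simp: carrier_F contract_closed)
    then show "p (f \<oplus>\<^bsub>F\<^esub> g) z = (p f \<oplus>\<^bsub>K\<^esub> p g) z"
      using fg by (simp add: p_def s_def F_simps K_simps contract_add a_minus_def minus_add a_ac)
  qed
  have p_smult: "p (r \<odot>\<^bsub>F\<^esub> f) = r \<odot>\<^bsub>K\<^esub> p f" if rf: "r \<in> carrier R" "f \<in> carrier F" for r f
  proof
    fix z
    have c: "f z \<in> carrier R" "contract f \<in> carrier R"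
      using rf by (auto simp: carrier_F contract_closed)
    then show "p (r \<odot>\<^bsub>F\<^esub> f) z = (r \<odot>\<^bsub>K\<^esub> p f) z"
      using rf by (simp add: p_def s_def F_simps K_simps contract_smult a_minus_def r_distr r_minus)
  qed
  have "H \<in> hom_set R F N"
    unfolding hom_set_iff
  proof (intro conjI ballI)
    show "H \<in> carrier F \<rightarrow>\<^sub>E carrier N"
      using m by (auto simp: H_def hom_K_D(1)[OF h] pK N.smult_closed contract_closed)
  next
    fix f g assume fg: "f \<in> carrier F" "g \<in> carrier F"
    then have c: "contract f \<odot>\<^bsub>N\<^esub> m \<in> carrier N" "contract g \<odot>\<^bsub>N\<^esub> m \<in> carrier N" "h (p f) \<in> carrier N" "h (p g) \<in> carrier N"
      using m by (auto simp: N.smult_closed contract_closed hom_K_D(1)[OF h] pK)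
    have "h (p (f \<oplus>\<^bsub>F\<^esub> g)) = h (p f) \<oplus>\<^bsub>N\<^esub> h (p g)"
      using fg by (simp add: p_add hom_K_D(2)[OF h] pK)
    moreover have "contract (f \<oplus>\<^bsub>F\<^esub> g) \<odot>\<^bsub>N\<^esub> m = contract f \<odot>\<^bsub>N\<^esub> m \<oplus>\<^bsub>N\<^esub> contract g \<odot>\<^bsub>N\<^esub> m"
      using fg m by (simp add: F_simps contract_add N.smult_l_distr contract_closed)
    ultimately show "H (f \<oplus>\<^bsub>F\<^esub> g) = H f \<oplus>\<^bsub>N\<^esub> H g"
      using fg c carrier_F_closed(1)[OF fg] by (simp add: H_def N.a_ac)
  next
    fix r f assume rf: "r \<in> carrier R" "f \<in> carrier F"
    then have c: "contract f \<odot>\<^bsub>N\<^esub> m \<in> carrier N" "h (p f) \<in> carrier N"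
      using m by (auto simp: N.smult_closed contract_closed hom_K_D(1)[OF h] pK)
    have "h (p (r \<odot>\<^bsub>F\<^esub> f)) = r \<odot>\<^bsub>N\<^esub> h (p f)"
      using rf by (simp add: p_smult hom_K_D(3)[OF h] pK)
    moreover have "contract (r \<odot>\<^bsub>F\<^esub> f) \<odot>\<^bsub>N\<^esub> m = r \<odot>\<^bsub>N\<^esub> (contract f \<odot>\<^bsub>N\<^esub> m)"
      using rf m by (simp add: F_simps contract_smult N.smult_assoc contract_closed)
    ultimately show "H (r \<odot>\<^bsub>F\<^esub> f) = r \<odot>\<^bsub>N\<^esub> H f"
      using rf c carrier_F_closed(2)[OF rf(2,1)] by (simp add: H_def N.smult_r_distr)
  qed
  moreover have "h = restrict H (carrier K)"
  proof (rule extensionalityI[of _ "carrier K"])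
    fix f assume f: "f \<in> carrier K"
    then have fF: "f \<in> carrier F" and e: "\<epsilon> (contract f) = 0" by (auto simp: carrier_K)
    then have cf: "contract f \<in> carrier R" by (simp add: contract_closed)
    have k: "kernel_element (contract f) = s f"
      using cf by (auto simp: kernel_element_def s_def e eta_zero a_minus_def intro!: ext)
    then have sK: "s f \<in> carrier K" using kernel_element_in_K[OF cf] by simp
    have "h (s f) = contract f \<odot>\<^bsub>N\<^esub> m"
      using hk[OF cf] cf m by (simp add: k e eta_zero smult_zero_left N.minus_eq N.smult_closed)
    moreover have "f = p f \<oplus>\<^bsub>K\<^esub> s f"
      using fF s[OF fF] by (auto simp: p_def K_simps a_minus_def a_assoc l_neg carrier_F intro!: ext)
    ultimately show "h f = restrict H (carrier K) f"
      using hom_K_D(2)[OF h pK[OF fF] sK] f fF by (simp add: H_def)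
  qed (auto simp: hom_K_D(4)[OF h])
  ultimately show "h \<in> (\<lambda>H. restrict H (carrier K)) ` hom_set R F N" by blast
qed

theorem cdim_ext1_space_character:
  "cdim (ext1_space R \<eta> S N) =
    cdim (quotient_space (derivation_space R \<eta> \<epsilon> N) (inner_derivations R \<eta> \<epsilon> N))"
proof -
  let ?W = "(\<lambda>H. restrict H (carrier K)) ` hom_set R F N"
  have FN: "module complex_field (hom_space R \<eta> F N)"
    by (rule module_hom_space) (auto simp: carrier_F_closed)
  have KN: "module complex_field (hom_space R \<eta> K N)"
    by (rule module_hom_space) (auto simp: carrier_K_closed)
  interpret FN: module complex_field "hom_space R \<eta> F N" by (rule FN)
  have KF: "f \<in> carrier F" if "f \<in> carrier K" for f using that by (simp add: carrier_K)
  have Kops: "f \<oplus>\<^bsub>K\<^esub> g = f \<oplus>\<^bsub>F\<^esub> g" "r \<odot>\<^bsub>K\<^esub> f = r \<odot>\<^bsub>F\<^esub> f" for f g r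
    by (simp_all add: K_simps F_simps)
  have sub: "?W \<subseteq> hom_set R K N"
    using KF carrier_K_closed by (auto simp: hom_set_iff Kops[symmetric]) (auto simp: Kops)
  have Wadd: "(\<lambda>f\<in>carrier K. restrict H (carrier K) f \<oplus>\<^bsub>N\<^esub> restrict H' (carrier K) f) \<in> ?W"
    if "H \<in> hom_set R F N" "H' \<in> hom_set R F N" for H H'
    using FN.a_closed[of H H'] that KF
    by (auto simp: hom_space_eq_function_space intro!: image_eqI[of _ _ "\<lambda>f\<in>carrier F. H f \<oplus>\<^bsub>N\<^esub> H' f"] restrict_ext)
  have Wsmult: "(\<lambda>f\<in>carrier K. \<eta> c \<odot>\<^bsub>N\<^esub> restrict H (carrier K) f) \<in> ?W"
    if "H \<in> hom_set R F N" for c H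
    using FN.smult_closed[of c H] that KF
    by (auto simp: hom_space_eq_function_space intro!: image_eqI[of _ _ "\<lambda>f\<in>carrier F. \<eta> c \<odot>\<^bsub>N\<^esub> H f"] restrict_ext)
  have Wc: "\<forall>c. \<forall>h\<in>?W. c \<odot>\<^bsub>hom_space R \<eta> K N\<^esub> h \<in> ?W"
    using Wsmult by (auto simp: hom_space_eq_function_space)
  have W: "additive_subgroup ?W (hom_space R \<eta> K N)"
  proof (rule additive_subgroup_if_subspace[OF KN])
    show "?W \<noteq> {}" using FN.zero_closed by (auto simp: hom_space_eq_function_space)
  qed (use sub Wadd Wsmult in \<open>auto simp: hom_space_eq_function_space\<close>)
  have "cdim (quotient_space (hom_space R \<eta> K N) ?W) =
      cdim (quotient_space (derivation_space R \<eta> \<epsilon> N) (inner_derivations R \<eta> \<epsilon> N))"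
  proof (rule cdim_quotient_space_eq[OF KN W Wc module_derivation_space inner_derivations_subgroup
        inner_derivations_smult derivation_of_hom_linear])
    show "carrier (derivation_space R \<eta> \<epsilon> N) \<subseteq> derivation_of_hom ` carrier (hom_space R \<eta> K N)"
      using derivation_of_hom_surj by (auto simp: hom_space_eq_function_space image_iff)
  qed (simp add: hom_space_eq_function_space derivation_of_hom_inner_iff)
  then show ?thesis by (simp add: ext1_space_def)
qed

end

section \<open>Pulling back along a homomorphism onto a corner\<close>

lemma restrict_scalars_simps [simp]:
  "carrier (restrict_scalars \<phi> N) = carrier N" "\<zero>\<^bsub>restrict_scalars \<phi> N\<^esub> = \<zero>\<^bsub>N\<^esub>"
  "x \<oplus>\<^bsub>restrict_scalars \<phi> N\<^esub> y = x \<oplus>\<^bsub>N\<^esub> y" "r \<odot>\<^bsub>restrict_scalars \<phi> N\<^esub> x = \<phi> r \<odot>\<^bsub>N\<^esub> x"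
  by (simp_all add: restrict_scalars_def)

lemma a_minus_restrict_scalars [simp]: "x \<ominus>\<^bsub>restrict_scalars \<phi> N\<^esub> y = x \<ominus>\<^bsub>N\<^esub> y"
  by (simp add: a_minus_def a_inv_def m_inv_def)

lemma abelian_group_restrict_scalars:
  assumes "abelian_group N" shows "abelian_group (restrict_scalars \<phi> N)"
proof -
  interpret abelian_group N by (rule assms)
  show ?thesis
  proof (rule abelian_groupI)
    fix x assume "x \<in> carrier (restrict_scalars \<phi> N)"
    then show "\<exists>y\<in>carrier (restrict_scalars \<phi> N). y \<oplus>\<^bsub>restrict_scalars \<phi> N\<^esub> x = \<zero>\<^bsub>restrict_scalars \<phi> N\<^esub>"
      by (intro bexI[of _ "\<ominus>\<^bsub>N\<^esub> x"]) (auto simp: l_neg)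
  qed (auto simp: a_ac)
qed

text \<open>
  The image of \<open>\<phi>\<close> is the corner of \<open>R\<close> cut out by the idempotent \<open>\<phi> \<one>\<close>, and \<open>N\<close> lives on this corner. The
  condition on derivations says that every extension of the one-dimensional module by \<open>N\<close> over \<open>A\<close> is
  annihilated by the kernel of \<open>\<phi>\<close>, so that it is an extension over the corner.
\<close>

locale corner_pullback =
  A: augmented_algebra A \<eta>A \<epsilon>A + augmented_module R \<eta> \<epsilon> N
  for A :: "('a, 'c) ring_scheme" and \<eta>A \<epsilon>A
    and R :: "('r, 's) ring_scheme" (structure) and \<eta> \<epsilon> and N :: "('r, 'v) module" +
  fixes \<phi> :: "'a \<Rightarrow> 'r"
  assumes phi_closed [simp, intro]: "x \<in> carrier A \<Longrightarrow> \<phi> x \<in> carrier R"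
    and phi_add: "x \<in> carrier A \<Longrightarrow> y \<in> carrier A \<Longrightarrow> \<phi> (x \<oplus>\<^bsub>A\<^esub> y) = \<phi> x \<oplus> \<phi> y"
    and phi_mult: "x \<in> carrier A \<Longrightarrow> y \<in> carrier A \<Longrightarrow> \<phi> (x \<otimes>\<^bsub>A\<^esub> y) = \<phi> x \<otimes> \<phi> y"
    and phi_one_smult: "m \<in> carrier N \<Longrightarrow> \<phi> \<one>\<^bsub>A\<^esub> \<odot>\<^bsub>N\<^esub> m = m"
    and phi_corner: "r \<in> carrier R \<Longrightarrow> \<exists>x\<in>carrier A. \<phi> x = \<phi> \<one>\<^bsub>A\<^esub> \<otimes> r"
    and phi_eta: "\<phi> (\<eta>A c) = \<phi> \<one>\<^bsub>A\<^esub> \<otimes> \<eta> c"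
    and eps_phi: "x \<in> carrier A \<Longrightarrow> \<epsilon> (\<phi> x) = \<epsilon>A x"
    and derivation_kernel: "d \<in> derivations A \<eta>A \<epsilon>A (restrict_scalars \<phi> N) \<Longrightarrow> x \<in> carrier A \<Longrightarrow>
      \<phi> x = \<zero> \<Longrightarrow> d x = \<zero>\<^bsub>N\<^esub>"
begin

abbreviation "e \<equiv> \<phi> \<one>\<^bsub>A\<^esub>"

abbreviation "N' \<equiv> restrict_scalars \<phi> N"

lemma e_closed: "e \<in> carrier R"
  by simp

lemma e_mult_smult:
  assumes "r \<in> carrier R" "m \<in> carrier N"
  shows "(e \<otimes> r) \<odot>\<^bsub>N\<^esub> m = r \<odot>\<^bsub>N\<^esub> m"
  using assms by (simp add: N.smult_assoc phi_one_smult N.smult_closed)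

lemma phi_eta_smult: "m \<in> carrier N \<Longrightarrow> \<phi> (\<eta>A c) \<odot>\<^bsub>N\<^esub> m = \<eta> c \<odot>\<^bsub>N\<^esub> m"
  by (simp add: phi_eta e_mult_smult)

lemma eps_e: "\<epsilon> e = 1"
  by (simp add: eps_phi A.eps_one)

lemma eps_e_mult: "r \<in> carrier R \<Longrightarrow> \<epsilon> (e \<otimes> r) = \<epsilon> r"
  by (simp add: eps_mult eps_e)

lemma e_mult_phi: "x \<in> carrier A \<Longrightarrow> e \<otimes> \<phi> x = \<phi> x"
  using phi_mult[of "\<one>\<^bsub>A\<^esub>" x] by simp

text \<open>
  Writing \<open>e r\<close> as \<open>\<phi> x = \<phi> (x \<one>)\<close> shows that \<open>e\<close> fixes it also from the right.
\<close>

lemma e_mult_e: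
  assumes r: "r \<in> carrier R"
  shows "e \<otimes> r \<otimes> e = e \<otimes> r"
proof -
  obtain x where "x \<in> carrier A" "\<phi> x = e \<otimes> r" using phi_corner[OF r] by blast
  then show ?thesis using phi_mult[of x "\<one>\<^bsub>A\<^esub>"] by simp
qed

lemma left_module_restrict_scalars: "left_module A N'"
proof (intro left_module.intro left_module_axioms.intro)
  show "abelian_group N'" by (rule abelian_group_restrict_scalars) unfold_locales
qed (auto simp: A.ring_axioms phi_one_smult phi_add phi_mult N.smult_l_distr N.smult_r_distr
    N.smult_assoc N.smult_closed)

sublocale N': augmented_module A \<eta>A \<epsilon>A N'
  by (intro augmented_module.intro A.augmented_algebra_axioms left_module_restrict_scalars)

lemma hom_set_pullback: "hom_set A A.S N' = hom_set R S N"
proof (intro equalityI subsetI)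
  fix h assume "h \<in> hom_set A A.S N'"
  then have h: "h \<in> UNIV \<rightarrow>\<^sub>E carrier N" "\<And>z w. h (z + w) = h z \<oplus>\<^bsub>N\<^esub> h w"
    "\<And>x z. x \<in> carrier A \<Longrightarrow> h (\<epsilon>A x * z) = \<phi> x \<odot>\<^bsub>N\<^esub> h z"
    by (auto simp: N'.hom_set_iff)
  have "h (\<epsilon> r * z) = r \<odot>\<^bsub>N\<^esub> h z" if r: "r \<in> carrier R" for r z
  proof -
    obtain x where x: "x \<in> carrier A" "\<phi> x = e \<otimes> r" using phi_corner[OF r] by blast
    have "h (\<epsilon>A x * z) = (e \<otimes> r) \<odot>\<^bsub>N\<^esub> h z" using h(3)[OF x(1)] x(2) by simp
    moreover have "\<epsilon>A x = \<epsilon> r" using eps_phi[OF x(1)] x(2) eps_e_mult[OF r] by simp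
    moreover have "h z \<in> carrier N" using h(1) by auto
    ultimately show ?thesis using r by (simp add: e_mult_smult)
  qed
  with h show "h \<in> hom_set R S N" by (auto simp: hom_set_iff)
next
  fix h assume "h \<in> hom_set R S N"
  then show "h \<in> hom_set A A.S N'"
    by (auto simp: hom_set_iff N'.hom_set_iff eps_phi[symmetric])
qed

theorem cdim_hom_space_pullback: "cdim (hom_space A \<eta>A A.S N') = cdim (hom_space R \<eta> S N)"
proof (rule dim_eq_if_linear_bijection)
  show "vectorspace complex_field (hom_space A \<eta>A A.S N')"
    by (rule vectorspace_complexI[OF N'.module_hom_space]) auto
  show "vectorspace complex_field (hom_space R \<eta> S N)"
    by (rule vectorspace_complexI[OF module_hom_space]) auto
  show "(\<lambda>h. h) \<in> module_hom complex_field (hom_space A \<eta>A A.S N') (hom_space R \<eta> S N)"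
  proof -
    have "h z \<in> carrier N" if "h \<in> hom_set R S N" for h z
      using that by (auto simp: hom_set_iff)
    then show ?thesis
      by (auto simp: module_hom_def hom_space_eq_function_space hom_set_pullback phi_eta_smult
          intro!: restrict_ext)
  qed
  show "bij_betw (\<lambda>h. h) (carrier (hom_space A \<eta>A A.S N')) (carrier (hom_space R \<eta> S N))"
    by (simp add: bij_betw_def hom_space_eq_function_space hom_set_pullback)
qed

definition pull :: "('r \<Rightarrow> 'v) \<Rightarrow> 'a \<Rightarrow> 'v" where
  "pull d = (\<lambda>x\<in>carrier A. d (\<phi> x))"

text \<open>
  The idempotent \<open>e\<close> acts on \<open>N\<close> as the identity and has augmentation \<open>1\<close>, so the Leibniz rule reads
  \<open>d e = d e + d e\<close>.
\<close>

lemma derivation_e: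
  assumes d: "d \<in> derivations R \<eta> \<epsilon> N"
  shows "d e = \<zero>\<^bsub>N\<^esub>"
proof -
  have c: "d e \<in> carrier N" using derivationsD(1)[OF d] by simp
  have "d (e \<otimes> e) = e \<odot>\<^bsub>N\<^esub> d e \<oplus>\<^bsub>N\<^esub> \<eta> 1 \<odot>\<^bsub>N\<^esub> d e"
    by (simp add: derivationsD(3)[OF d] eps_e)
  then have "d e = d e \<oplus>\<^bsub>N\<^esub> d e"
    using c by (simp add: e_mult_phi eta_one phi_one_smult N.smult_one)
  then show ?thesis using c by simp
qed

lemma derivation_e_mult:
  assumes d: "d \<in> derivations R \<eta> \<epsilon> N" and r: "r \<in> carrier R"
  shows "d (e \<otimes> r) = d r"
  using derivationsD(3)[OF d e_closed r] derivationsD(1)[OF d r]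
  by (simp add: derivation_e[OF d] smult_zero_right phi_one_smult)

lemma pull_in_derivations:
  assumes d: "d \<in> derivations R \<eta> \<epsilon> N"
  shows "pull d \<in> derivations A \<eta>A \<epsilon>A N'"
  unfolding pull_def
proof (rule N'.derivationsI)
  fix x y assume xy: "x \<in> carrier A" "y \<in> carrier A"
  show "d (\<phi> (x \<oplus>\<^bsub>A\<^esub> y)) = d (\<phi> x) \<oplus>\<^bsub>N'\<^esub> d (\<phi> y)"
    using xy by (simp add: phi_add derivationsD(2)[OF d])
  show "d (\<phi> (x \<otimes>\<^bsub>A\<^esub> y)) = x \<odot>\<^bsub>N'\<^esub> d (\<phi> y) \<oplus>\<^bsub>N'\<^esub> \<eta>A (\<epsilon>A y) \<odot>\<^bsub>N'\<^esub> d (\<phi> x)"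
    using xy by (simp add: phi_mult derivationsD(3)[OF d] derivationsD(1)[OF d] eps_phi phi_eta_smult)
next
  fix c
  show "d (\<phi> (\<eta>A c)) = \<zero>\<^bsub>N'\<^esub>"
    by (simp add: phi_eta derivation_e_mult[OF d] derivationsD(4)[OF d])
qed (simp add: derivationsD(1)[OF d])

text \<open>
  The preimage of \<open>d'\<close> sends \<open>r\<close> to the value of \<open>d'\<close> at any \<open>x\<close> with \<open>\<phi> x = e r\<close>. This does not depend on
  \<open>x\<close>, because \<open>d'\<close> vanishes on the kernel of \<open>\<phi>\<close>. In the Leibniz rule, products of such \<open>x\<close> are again
  admissible since \<open>e r e s = e r s\<close>.
\<close>

lemma pull_surj:
  assumes d': "d' \<in> derivations A \<eta>A \<epsilon>A N'"
  shows "\<exists>d\<in>derivations R \<eta> \<epsilon> N. pull d = d'"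
proof -
  define \<psi> where "\<psi> y = (SOME x. x \<in> carrier A \<and> \<phi> x = e \<otimes> y)" for y
  have psi: "\<psi> y \<in> carrier A" "\<phi> (\<psi> y) = e \<otimes> y" if "y \<in> carrier R" for y
    using someI_ex[of "\<lambda>x. x \<in> carrier A \<and> \<phi> x = e \<otimes> y"] phi_corner[OF that]
    unfolding \<psi>_def by blast+
  define d where "d = (\<lambda>y\<in>carrier R. d' (\<psi> y))"
  have d'c: "d' x \<in> carrier N" if "x \<in> carrier A" for x using N'.derivationsD(1)[OF d' that] by simp
  have d'_eq: "d' x = d' x'" if x: "x \<in> carrier A" "x' \<in> carrier A" and eq: "\<phi> x = \<phi> x'" for x x'
  proof -
    have "\<phi> x' \<oplus> \<phi> (x \<ominus>\<^bsub>A\<^esub> x') = \<phi> x'"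
      using x phi_add[of "x \<ominus>\<^bsub>A\<^esub> x'" x'] eq
      by (simp add: a_comm A.minus_eq A.a_assoc A.l_neg)
    then have "\<phi> (x \<ominus>\<^bsub>A\<^esub> x') = \<zero>" using x by simp
    then have "d' (x \<ominus>\<^bsub>A\<^esub> x') = \<zero>\<^bsub>N\<^esub>" using derivation_kernel[OF d'] x by simp
    then have "d' x \<ominus>\<^bsub>N\<^esub> d' x' = \<zero>\<^bsub>N\<^esub>" using N'.derivation_minus[OF d' x] by simp
    then show ?thesis using d'c x by simp
  qed
  have key: "d r = d' x" if "x \<in> carrier A" "r \<in> carrier R" "\<phi> x = e \<otimes> r" for r x
    using that psi[of r] by (simp add: d_def) (metis d'_eq)
  have "d \<in> derivations R \<eta> \<epsilon> N"
    unfolding d_def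
  proof (rule derivationsI)
    show "d' (\<psi> r) \<in> carrier N" if "r \<in> carrier R" for r using d'c psi that by simp
  next
    fix r s assume rs: "r \<in> carrier R" "s \<in> carrier R"
    have "\<phi> (\<psi> r \<oplus>\<^bsub>A\<^esub> \<psi> s) = e \<otimes> (r \<oplus> s)"
      using rs psi by (simp add: phi_add r_distr)
    then have "d (r \<oplus> s) = d' (\<psi> r \<oplus>\<^bsub>A\<^esub> \<psi> s)" using key psi rs by simp
    then show "d' (\<psi> (r \<oplus> s)) = d' (\<psi> r) \<oplus>\<^bsub>N\<^esub> d' (\<psi> s)"
      using rs psi by (simp add: d_def N'.derivationsD(2)[OF d'])
    have "e \<otimes> r \<otimes> (e \<otimes> s) = e \<otimes> (r \<otimes> s)"
      using rs e_mult_e[of r] by (simp add: m_assoc[symmetric])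
    then have "\<phi> (\<psi> r \<otimes>\<^bsub>A\<^esub> \<psi> s) = e \<otimes> (r \<otimes> s)"
      using rs psi by (simp add: phi_mult)
    then have 1: "d (r \<otimes> s) = d' (\<psi> r \<otimes>\<^bsub>A\<^esub> \<psi> s)" using key psi rs by simp
    have "\<epsilon>A (\<psi> s) = \<epsilon> s"
      using rs psi eps_phi[of "\<psi> s"] by (simp add: eps_e_mult)
    then show "d' (\<psi> (r \<otimes> s)) = r \<odot>\<^bsub>N\<^esub> d' (\<psi> s) \<oplus>\<^bsub>N\<^esub> \<eta> (\<epsilon> s) \<odot>\<^bsub>N\<^esub> d' (\<psi> r)"
      using 1 rs psi d'c by (simp add: d_def N'.derivationsD(3)[OF d'] e_mult_smult phi_eta_smult)
  next
    fix c
    have "d (\<eta> c) = d' (\<eta>A c)" by (rule key) (simp_all add: phi_eta)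
    then show "d' (\<psi> (\<eta> c)) = \<zero>\<^bsub>N\<^esub>" using N'.derivationsD(4)[OF d'] by (simp add: d_def)
  qed
  moreover have "pull d = d'"
  proof (rule extensionalityI[of _ "carrier A"])
    fix x assume x: "x \<in> carrier A"
    then have "d (\<phi> x) = d' x" by (intro key) (simp_all add: e_mult_phi)
    then show "pull d x = d' x" using x by (simp add: pull_def)
  qed (auto simp: pull_def N'.derivationsD(5)[OF d'])
  ultimately show ?thesis by blast
qed

lemma pull_inj:
  assumes d: "d \<in> derivations R \<eta> \<epsilon> N" and d': "d' \<in> derivations R \<eta> \<epsilon> N" and eq: "pull d = pull d'"
  shows "d = d'"
proof (rule extensionalityI[of _ "carrier R"])
  fix r assume r: "r \<in> carrier R"
  obtain x where x: "x \<in> carrier A" "\<phi> x = e \<otimes> r" using phi_corner[OF r] by blast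
  have "d (e \<otimes> r) = d' (e \<otimes> r)" using fun_cong[OF eq, of x] x by (simp add: pull_def)
  then show "d r = d' r" using r by (simp add: derivation_e_mult d d')
qed (auto simp: derivationsD(5)[OF d] derivationsD(5)[OF d'])

lemma pull_inner_derivation:
  assumes m: "m \<in> carrier N"
  shows "pull (inner_derivation R \<eta> \<epsilon> N m) = inner_derivation A \<eta>A \<epsilon>A N' m"
  unfolding pull_def inner_derivation_def
  by (rule restrict_ext) (use m in \<open>simp add: eps_phi phi_eta_smult\<close>)

theorem cdim_ext1_space_pullback: "cdim (ext1_space A \<eta>A A.S N') = cdim (ext1_space R \<eta> S N)"
proof -
  have lin: "pull \<in> module_hom complex_field (derivation_space R \<eta> \<epsilon> N) (derivation_space A \<eta>A \<epsilon>A N')"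
  proof -
    have "pull (\<lambda>r\<in>carrier R. d r \<oplus>\<^bsub>N\<^esub> d' r) = (\<lambda>x\<in>carrier A. pull d x \<oplus>\<^bsub>N\<^esub> pull d' x)" for d d'
      unfolding pull_def by (rule restrict_ext) simp
    moreover have "pull (\<lambda>r\<in>carrier R. \<eta> c \<odot>\<^bsub>N\<^esub> d r) = (\<lambda>x\<in>carrier A. \<phi> (\<eta>A c) \<odot>\<^bsub>N\<^esub> pull d x)"
      if "d \<in> derivations R \<eta> \<epsilon> N" for c d
      unfolding pull_def by (rule restrict_ext) (simp add: phi_eta_smult derivationsD(1)[OF that])
    ultimately show ?thesis by (auto simp: module_hom_def pull_in_derivations)
  qed
  have iff: "pull d \<in> inner_derivations A \<eta>A \<epsilon>A N' \<longleftrightarrow> d \<in> inner_derivations R \<eta> \<epsilon> N"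
    if d: "d \<in> derivations R \<eta> \<epsilon> N" for d
  proof
    assume "pull d \<in> inner_derivations A \<eta>A \<epsilon>A N'"
    then obtain m where m: "m \<in> carrier N" "pull d = inner_derivation A \<eta>A \<epsilon>A N' m" by auto
    then have "d = inner_derivation R \<eta> \<epsilon> N m"
      by (intro pull_inj d inner_derivation_in_derivations) (simp_all add: pull_inner_derivation)
    with m show "d \<in> inner_derivations R \<eta> \<epsilon> N" by blast
  qed (auto simp: pull_inner_derivation)
  have "cdim (quotient_space (derivation_space R \<eta> \<epsilon> N) (inner_derivations R \<eta> \<epsilon> N)) =
      cdim (quotient_space (derivation_space A \<eta>A \<epsilon>A N') (inner_derivations A \<eta>A \<epsilon>A N'))"
  proof (rule cdim_quotient_space_eq[OF module_derivation_space inner_derivations_subgroup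
        inner_derivations_smult N'.module_derivation_space N'.inner_derivations_subgroup
        N'.inner_derivations_smult lin])
    show "carrier (derivation_space A \<eta>A \<epsilon>A N') \<subseteq> pull ` carrier (derivation_space R \<eta> \<epsilon> N)"
      using pull_surj by (auto simp: image_iff)
  qed (use iff in auto)
  then show ?thesis
    by (simp only: cdim_ext1_space_character N'.cdim_ext1_space_character)
qed

end

section \<open>Complete path algebras and their quotients\<close>

lemma in_carrier_path_algebra: "f \<in> carrier (path_algebra Q) \<longleftrightarrow> (\<forall>x. x \<notin> paths Q \<longrightarrow> f x = 0)"
  by (simp add: path_algebra_def)

lemma path_algebra_simps:
  "f \<oplus>\<^bsub>path_algebra Q\<^esub> g = (\<lambda>x. f x + g x)"
  "\<zero>\<^bsub>path_algebra Q\<^esub> = (\<lambda>_. 0)"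
  by (simp_all add: path_algebra_def)

lemma path_algebra_mult:
  "(f \<otimes>\<^bsub>path_algebra Q\<^esub> g) (u, p) = (\<Sum>k\<le>length p.
     f (pre_digraph.awlast Q u (take k p), drop k p) * g (u, take k p))"
  by (simp add: path_algebra_def)

text \<open>
  Combinations of trivial paths. They comprise the unit, the scalars and the vertex idempotents, and
  they act on the coefficient of a path from the left through its end and from the right through its
  start.
\<close>

definition vertex_series :: "(nat \<Rightarrow> complex) \<Rightarrow> 'a path_series" where
  "vertex_series c = (\<lambda>(u, p). if p = [] then c u else 0)"

lemma path_algebra_one: "\<one>\<^bsub>path_algebra Q\<^esub> = vertex_series (\<lambda>u. if u \<in> verts Q then 1 else 0)"
  by (auto simp: path_algebra_def vertex_series_def)

lemma const_series_eq: "const_series Q c = vertex_series (\<lambda>u. if u \<in> verts Q then c else 0)"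
  by (auto simp: const_series_def vertex_series_def)

lemma idem_eq: "idem i = vertex_series (\<lambda>u. if u = i then 1 else 0)"
  by (auto simp: idem_def vertex_series_def)

lemma vertex_series_mult:
  "(vertex_series c \<otimes>\<^bsub>path_algebra Q\<^esub> f) (u, p) = c (pre_digraph.awlast Q u p) * f (u, p)"
proof -
  have "(vertex_series c \<otimes>\<^bsub>path_algebra Q\<^esub> f) (u, p) =
      (\<Sum>k\<le>length p. if k = length p then c (pre_digraph.awlast Q u p) * f (u, p) else 0)"
    unfolding path_algebra_mult by (rule sum.cong) (auto simp: vertex_series_def)
  then show ?thesis by simp
qed

lemma mult_vertex_series: "(f \<otimes>\<^bsub>path_algebra Q\<^esub> vertex_series c) (u, p) = f (u, p) * c u"
proof -
  have "(f \<otimes>\<^bsub>path_algebra Q\<^esub> vertex_series c) (u, p) =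
      (\<Sum>k\<le>length p. if k = 0 then f (u, p) * c u else 0)"
    unfolding path_algebra_mult
    by (rule sum.cong) (auto simp: vertex_series_def pre_digraph.awalk_verts.simps)
  then show ?thesis by simp
qed

locale quiver = wf_digraph Q for Q :: "(nat, 'a) pre_digraph"
begin

lemma paths_iff: "(u, p) \<in> paths Q \<longleftrightarrow> awalk u p (awlast u p)"
  by (auto simp: paths_def)

lemma paths_append: "(u, p @ q) \<in> paths Q \<longleftrightarrow> (u, p) \<in> paths Q \<and> (awlast u p, q) \<in> paths Q"
  by (simp add: paths_iff awlast_append)

lemma paths_Nil: "(u, []) \<in> paths Q \<longleftrightarrow> u \<in> verts Q"
  by (simp add: paths_iff awalk_Nil_iff)

lemma paths_Cons: "(u, b # p) \<in> paths Q \<longleftrightarrow> b \<in> arcs Q \<and> u = tail Q b \<and> (head Q b, p) \<in> paths Q"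
  by (auto simp: paths_iff awalk_def)

lemma awlast_in_verts_if_path: "(u, p) \<in> paths Q \<Longrightarrow> awlast u p \<in> verts Q"
  unfolding paths_iff by (rule awlast_in_verts) (auto simp: awalk_def)

lemma start_in_verts_if_path: "(u, p) \<in> paths Q \<Longrightarrow> u \<in> verts Q"
  by (auto simp: paths_def awalk_def)

lemma vertex_series_closed: "(\<And>u. u \<notin> verts Q \<Longrightarrow> c u = 0) \<Longrightarrow> vertex_series c \<in> carrier (path_algebra Q)"
  by (auto simp: in_carrier_path_algebra vertex_series_def paths_Nil)

lemma path_mult_closed:
  assumes f: "f \<in> carrier (path_algebra Q)" and g: "g \<in> carrier (path_algebra Q)"
  shows "f \<otimes>\<^bsub>path_algebra Q\<^esub> g \<in> carrier (path_algebra Q)"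
  unfolding in_carrier_path_algebra
proof (intro allI impI)
  fix x assume x: "x \<notin> paths Q"
  obtain u p where [simp]: "x = (u, p)" by (cases x)
  have "f (awlast u (take k p), drop k p) * g (u, take k p) = 0" for k
    using x paths_append[of u "take k p" "drop k p"] f g by (auto simp: in_carrier_path_algebra)
  then show "(f \<otimes>\<^bsub>path_algebra Q\<^esub> g) x = 0" by (simp add: path_algebra_mult)
qed

text \<open>
  Both sides sum over all ways to cut a path into three consecutive pieces; \<open>F k j\<close> in the proof is the
  summand with cuts after \<open>k\<close> and after \<open>k + j\<close> arrows.
\<close>

lemma path_mult_assoc:
  "(f \<otimes>\<^bsub>path_algebra Q\<^esub> g) \<otimes>\<^bsub>path_algebra Q\<^esub> h = f \<otimes>\<^bsub>path_algebra Q\<^esub> (g \<otimes>\<^bsub>path_algebra Q\<^esub> h)"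
proof
  fix x :: "nat \<times> 'a list"
  obtain u p where [simp]: "x = (u, p)" by (cases x)
  let ?n = "length p"
  define F where "F k j = f (awlast u (take (k + j) p), drop (k + j) p) *
    g (awlast u (take k p), take j (drop k p)) * h (u, take k p)" for k j
  have aw: "awlast (awlast u (take k p)) (take j (drop k p)) = awlast u (take (k + j) p)" for k j
    by (simp add: take_add awlast_append)
  have "((f \<otimes>\<^bsub>path_algebra Q\<^esub> g) \<otimes>\<^bsub>path_algebra Q\<^esub> h) x = (\<Sum>k\<le>?n. \<Sum>j\<le>?n - k. F k j)"
    by (simp add: path_algebra_mult aw F_def sum_distrib_right add.commute)
  also have "\<dots> = (\<Sum>(k, j)\<in>{(k, j). k + j \<le> ?n}. F k j)"
    by (subst sum.Sigma) (auto intro!: sum.cong)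
  also have "\<dots> = (\<Sum>l\<le>?n. \<Sum>k\<le>l. F k (l - k))"
    by (rule sum.triangle_reindex_eq)
  also have "\<dots> = (f \<otimes>\<^bsub>path_algebra Q\<^esub> (g \<otimes>\<^bsub>path_algebra Q\<^esub> h)) x"
    unfolding \<open>x = (u, p)\<close> path_algebra_mult sum_distrib_left
    by (intro sum.cong) (auto simp: F_def min_absorb1 min_absorb2 mult.assoc drop_take)
  finally show "((f \<otimes>\<^bsub>path_algebra Q\<^esub> g) \<otimes>\<^bsub>path_algebra Q\<^esub> h) x =
    (f \<otimes>\<^bsub>path_algebra Q\<^esub> (g \<otimes>\<^bsub>path_algebra Q\<^esub> h)) x" .
qed

lemma ring_path_algebra: "ring (path_algebra Q)"
proof (rule ringI)
  show "abelian_group (path_algebra Q)"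
  proof (rule abelian_groupI)
    fix f assume "f \<in> carrier (path_algebra Q)"
    then show "\<exists>g\<in>carrier (path_algebra Q). g \<oplus>\<^bsub>path_algebra Q\<^esub> f = \<zero>\<^bsub>path_algebra Q\<^esub>"
      by (intro bexI[of _ "\<lambda>x. - f x"]) (auto simp: path_algebra_simps in_carrier_path_algebra)
  qed (auto simp: path_algebra_simps in_carrier_path_algebra algebra_simps)
  show "Group.monoid (path_algebra Q)"
  proof (rule monoidI)
    show "\<one>\<^bsub>path_algebra Q\<^esub> \<in> carrier (path_algebra Q)"
      unfolding path_algebra_one by (rule vertex_series_closed) simp
    fix f assume f: "f \<in> carrier (path_algebra Q)"
    show "\<one>\<^bsub>path_algebra Q\<^esub> \<otimes>\<^bsub>path_algebra Q\<^esub> f = f"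
      unfolding path_algebra_one
    proof
      fix x :: "nat \<times> 'a list"
      obtain u p where [simp]: "x = (u, p)" by (cases x)
      show "(vertex_series (\<lambda>u. if u \<in> verts Q then 1 else 0) \<otimes>\<^bsub>path_algebra Q\<^esub> f) x = f x"
        using f awlast_in_verts_if_path[of u p] by (auto simp: vertex_series_mult in_carrier_path_algebra)
    qed
    show "f \<otimes>\<^bsub>path_algebra Q\<^esub> \<one>\<^bsub>path_algebra Q\<^esub> = f"
      unfolding path_algebra_one
    proof
      fix x :: "nat \<times> 'a list"
      obtain u p where [simp]: "x = (u, p)" by (cases x)
      show "(f \<otimes>\<^bsub>path_algebra Q\<^esub> vertex_series (\<lambda>u. if u \<in> verts Q then 1 else 0)) x = f x"
        using f start_in_verts_if_path[of u p] by (auto simp: mult_vertex_series in_carrier_path_algebra)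
    qed
  qed (auto simp: path_mult_closed path_mult_assoc)
qed (auto simp: fun_eq_iff path_algebra_simps path_algebra_mult algebra_simps sum.distrib)

end

definition vertex_character :: "nat \<Rightarrow> 'a path_series set \<Rightarrow> complex" where
  "vertex_character i X = the_elem ((\<lambda>f. f (i, [])) ` X)"

lemma simple_module_eq_character_module: "simple_module i = character_module (vertex_character i)"
  by (simp add: simple_module_def character_module_def vertex_character_def)

text \<open>
  Relations without constant terms, so that the coefficient of the trivial path at a vertex is a
  character of the quotient algebra.
\<close>

locale bound_quiver = quiver Q + ideal J "path_algebra Q"
  for Q :: "(nat, 'a) pre_digraph" and J +
  assumes J_vertex: "f \<in> J \<Longrightarrow> f (u, []) = 0"
begin

abbreviation "P \<equiv> path_algebra Q"

lemma carrier_quot: "carrier (quot_algebra Q J) = (\<lambda>f. coset_of Q J f) ` carrier P"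
  by (auto simp: FactRing_def A_RCOSETS_def')

lemma quot_ops:
  assumes "f \<in> carrier P" "g \<in> carrier P"
  shows "coset_of Q J f \<oplus>\<^bsub>quot_algebra Q J\<^esub> coset_of Q J g = coset_of Q J (f \<oplus>\<^bsub>P\<^esub> g)"
    and "coset_of Q J f \<otimes>\<^bsub>quot_algebra Q J\<^esub> coset_of Q J g = coset_of Q J (f \<otimes>\<^bsub>P\<^esub> g)"
  using assms by (simp_all add: FactRing_def a_rcos_sum rcoset_mult_add)

lemma quot_one: "\<one>\<^bsub>quot_algebra Q J\<^esub> = coset_of Q J \<one>\<^bsub>P\<^esub>"
  and quot_zero: "\<zero>\<^bsub>quot_algebra Q J\<^esub> = J"
  by (simp_all add: FactRing_def)

lemma coset_eq_J_iff: "f \<in> carrier P \<Longrightarrow> coset_of Q J f = J \<longleftrightarrow> f \<in> J"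
  by (metis a_rcos_const a_rcos_self)

lemma vertex_character_coset:
  assumes f: "f \<in> carrier P"
  shows "vertex_character i (coset_of Q J f) = f (i, [])"
proof -
  have "(\<lambda>f. f (i, [])) ` coset_of Q J f = {f (i, [])}"
    using J_vertex a_rcos_self[OF f]
    by (auto simp: a_r_coset_def' path_algebra_simps image_iff)
  then show ?thesis by (simp add: vertex_character_def)
qed

lemma const_series_closed: "const_series Q c \<in> carrier P"
  unfolding const_series_eq by (rule vertex_series_closed) simp

lemma const_series_mult:
  assumes f: "f \<in> carrier P"
  shows "const_series Q c \<otimes>\<^bsub>P\<^esub> f = (\<lambda>x. c * f x)" and "f \<otimes>\<^bsub>P\<^esub> const_series Q c = (\<lambda>x. c * f x)"
proof -
  have "(const_series Q c \<otimes>\<^bsub>P\<^esub> f) (u, p) = c * f (u, p)" for u p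
    using f awlast_in_verts_if_path[of u p]
    by (auto simp: const_series_eq vertex_series_mult in_carrier_path_algebra)
  then show "const_series Q c \<otimes>\<^bsub>P\<^esub> f = (\<lambda>x. c * f x)" by auto
  have "(f \<otimes>\<^bsub>P\<^esub> const_series Q c) (u, p) = c * f (u, p)" for u p
    using f start_in_verts_if_path[of u p]
    by (auto simp: const_series_eq mult_vertex_series in_carrier_path_algebra)
  then show "f \<otimes>\<^bsub>P\<^esub> const_series Q c = (\<lambda>x. c * f x)" by auto
qed

lemma augmented_quot_algebra:
  assumes i: "i \<in> verts Q"
  shows "augmented_algebra (quot_algebra Q J) (scalar Q J) (vertex_character i)"
proof (intro augmented_algebra.intro augmented_algebra_axioms.intro)
  show "ring (quot_algebra Q J)" by (rule quotient_is_ring)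
  note cc = const_series_closed
  show "scalar Q J c \<in> carrier (quot_algebra Q J)" for c
    by (auto simp: scalar_def carrier_quot const_series_closed)
  show "scalar Q J (c + c') = scalar Q J c \<oplus>\<^bsub>quot_algebra Q J\<^esub> scalar Q J c'" for c c'
  proof -
    have "const_series Q (c + c') = const_series Q c \<oplus>\<^bsub>P\<^esub> const_series Q c'"
      by (auto simp: path_algebra_simps const_series_def)
    then show ?thesis by (simp add: scalar_def quot_ops cc)
  qed
  show "scalar Q J (c * c') = scalar Q J c \<otimes>\<^bsub>quot_algebra Q J\<^esub> scalar Q J c'" for c c'
  proof -
    have "const_series Q (c * c') = const_series Q c \<otimes>\<^bsub>P\<^esub> const_series Q c'"
      unfolding const_series_mult(1)[OF cc] by (auto simp: const_series_def)
    then show ?thesis by (simp add: scalar_def quot_ops cc)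
  qed
  show "scalar Q J 1 = \<one>\<^bsub>quot_algebra Q J\<^esub>"
    by (simp add: scalar_def quot_one path_algebra_one const_series_eq)
  show "scalar Q J c \<otimes>\<^bsub>quot_algebra Q J\<^esub> X = X \<otimes>\<^bsub>quot_algebra Q J\<^esub> scalar Q J c"
    if "X \<in> carrier (quot_algebra Q J)" for X c
    using that by (auto simp: carrier_quot scalar_def quot_ops cc const_series_mult)
  show "vertex_character i (X \<oplus>\<^bsub>quot_algebra Q J\<^esub> Y) = vertex_character i X + vertex_character i Y"
    if "X \<in> carrier (quot_algebra Q J)" "Y \<in> carrier (quot_algebra Q J)" for X Y
    using that by (auto simp: carrier_quot quot_ops vertex_character_coset path_algebra_simps
        in_carrier_path_algebra)
  show "vertex_character i (X \<otimes>\<^bsub>quot_algebra Q J\<^esub> Y) = vertex_character i X * vertex_character i Y"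
    if "X \<in> carrier (quot_algebra Q J)" "Y \<in> carrier (quot_algebra Q J)" for X Y
    using that by (auto simp: carrier_quot quot_ops vertex_character_coset path_algebra_mult
        pre_digraph.awalk_verts.simps)
  show "vertex_character i (scalar Q J c) = c" for c
    using i by (simp add: scalar_def vertex_character_coset cc) (simp add: const_series_def)
qed

end

text \<open>
  A map of series that induces a homomorphism of the quotient algebras onto a corner on which \<open>M\<close> lives.
  Both the deletion of the frozen part of a quiver and the projection from principal coefficients are of
  this kind.
\<close>

locale bound_quiver_map =
  A: bound_quiver Qh Jh + B: bound_quiver Q J + M: left_module "quot_algebra Q J" M
  for Qh :: "(nat, 'b) pre_digraph" and Jh and Q :: "(nat, 'a) pre_digraph" and J
    and M :: "('a path_series set, 'v) module" +
  fixes \<pi> :: "'b path_series \<Rightarrow> 'a path_series" and i :: nat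
  assumes i: "i \<in> verts Qh" "i \<in> verts Q"
    and pi_closed: "f \<in> carrier A.P \<Longrightarrow> \<pi> f \<in> carrier B.P"
    and pi_add: "f \<in> carrier A.P \<Longrightarrow> g \<in> carrier A.P \<Longrightarrow> \<pi> (f \<oplus>\<^bsub>A.P\<^esub> g) = \<pi> f \<oplus>\<^bsub>B.P\<^esub> \<pi> g"
    and pi_mult: "f \<in> carrier A.P \<Longrightarrow> g \<in> carrier A.P \<Longrightarrow> \<pi> (f \<otimes>\<^bsub>A.P\<^esub> g) = \<pi> f \<otimes>\<^bsub>B.P\<^esub> \<pi> g"
    and pi_J: "\<pi> ` Jh = J"
    and pi_vertex: "\<pi> f (i, []) = f (i, [])"
    and pi_one: "x \<in> carrier M \<Longrightarrow> coset_of Q J (\<pi> \<one>\<^bsub>A.P\<^esub>) \<odot>\<^bsub>M\<^esub> x = x"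
    and pi_corner: "h \<in> carrier B.P \<Longrightarrow> \<exists>f\<in>carrier A.P. \<pi> f = \<pi> \<one>\<^bsub>A.P\<^esub> \<otimes>\<^bsub>B.P\<^esub> h"
    and pi_const: "\<pi> (const_series Qh c) = \<pi> \<one>\<^bsub>A.P\<^esub> \<otimes>\<^bsub>B.P\<^esub> const_series Q c"
begin

lemma pi_coset:
  assumes f: "f \<in> carrier A.P"
  shows "\<pi> ` coset_of Qh Jh f = coset_of Q J (\<pi> f)"
proof -
  have "\<pi> ` coset_of Qh Jh f = (\<lambda>g. \<pi> (g \<oplus>\<^bsub>A.P\<^esub> f)) ` Jh"
    by (auto simp: a_r_coset_def')
  also have "\<dots> = (\<lambda>g. \<pi> g \<oplus>\<^bsub>B.P\<^esub> \<pi> f) ` Jh"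
    using f A.a_subset by (intro image_cong) (auto simp: pi_add)
  also have "\<dots> = coset_of Q J (\<pi> f)"
    by (auto simp: a_r_coset_def' pi_J[symmetric])
  finally show ?thesis .
qed

context
  fixes d
  assumes d: "d \<in> derivations (quot_algebra Qh Jh) (scalar Qh Jh) (vertex_character i)
    (restrict_scalars (\<lambda>X. \<pi> ` X) M)"
begin

lemma derivation_coset_closed: "f \<in> carrier A.P \<Longrightarrow> d (coset_of Qh Jh f) \<in> carrier M"
  using d by (auto simp: derivations_def A.carrier_quot)

lemma derivation_coset_add:
  assumes "f \<in> carrier A.P" "g \<in> carrier A.P"
  shows "d (coset_of Qh Jh (f \<oplus>\<^bsub>A.P\<^esub> g)) = d (coset_of Qh Jh f) \<oplus>\<^bsub>M\<^esub> d (coset_of Qh Jh g)"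
  using assms d by (auto simp: derivations_def A.carrier_quot A.quot_ops[symmetric])

lemma derivation_coset_zero: "d (coset_of Qh Jh \<zero>\<^bsub>A.P\<^esub>) = \<zero>\<^bsub>M\<^esub>"
  using derivation_coset_add[of "\<zero>\<^bsub>A.P\<^esub>" "\<zero>\<^bsub>A.P\<^esub>"] derivation_coset_closed[of "\<zero>\<^bsub>A.P\<^esub>"] by simp

lemma derivation_coset_mult:
  assumes "f \<in> carrier A.P" "g \<in> carrier A.P"
  shows "d (coset_of Qh Jh (f \<otimes>\<^bsub>A.P\<^esub> g)) = coset_of Q J (\<pi> f) \<odot>\<^bsub>M\<^esub> d (coset_of Qh Jh g) \<oplus>\<^bsub>M\<^esub>
    coset_of Q J (\<pi> (const_series Qh (g (i, [])))) \<odot>\<^bsub>M\<^esub> d (coset_of Qh Jh f)"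
proof -
  have "d (coset_of Qh Jh f \<otimes>\<^bsub>quot_algebra Qh Jh\<^esub> coset_of Qh Jh g) =
      \<pi> ` coset_of Qh Jh f \<odot>\<^bsub>M\<^esub> d (coset_of Qh Jh g) \<oplus>\<^bsub>M\<^esub>
      \<pi> ` scalar Qh Jh (vertex_character i (coset_of Qh Jh g)) \<odot>\<^bsub>M\<^esub> d (coset_of Qh Jh f)"
    using assms d by (auto simp: derivations_def A.carrier_quot)
  then show ?thesis
    using assms by (simp add: A.quot_ops pi_coset scalar_def A.const_series_closed A.vertex_character_coset)
qed

lemma derivation_coset_mult_if_vertex_zero:
  assumes f: "f \<in> carrier A.P" and g: "g \<in> carrier A.P" "g (i, []) = 0"
  shows "d (coset_of Qh Jh (f \<otimes>\<^bsub>A.P\<^esub> g)) = coset_of Q J (\<pi> f) \<odot>\<^bsub>M\<^esub> d (coset_of Qh Jh g)"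
proof -
  have "const_series Q 0 = \<zero>\<^bsub>B.P\<^esub>"
    by (auto simp: const_series_def path_algebra_simps)
  then have "\<pi> (const_series Qh 0) = \<zero>\<^bsub>B.P\<^esub>"
    by (simp add: pi_const pi_closed)
  then have "coset_of Q J (\<pi> (const_series Qh 0)) = \<zero>\<^bsub>quot_algebra Q J\<^esub>"
    by (simp add: B.quot_zero B.coset_eq_J_iff)
  moreover have "coset_of Q J (\<pi> f) \<in> carrier (quot_algebra Q J)"
    using f pi_closed by (auto simp: B.carrier_quot)
  ultimately show ?thesis
    using derivation_coset_mult[OF f g(1)] g(2) derivation_coset_closed[OF f] derivation_coset_closed[OF g(1)]
    by (simp add: M.smult_zero_left M.smult_closed)
qed

text \<open>
  If an idempotent acts on \<open>M\<close> as zero and has augmentation zero, then both terms of the Leibniz rule for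
  its square vanish.
\<close>

lemma derivation_coset_idempotent:
  assumes f: "f \<in> carrier A.P" "f \<otimes>\<^bsub>A.P\<^esub> f = f" "f (i, []) = 0"
    and act: "\<And>x. x \<in> carrier M \<Longrightarrow> coset_of Q J (\<pi> f) \<odot>\<^bsub>M\<^esub> x = \<zero>\<^bsub>M\<^esub>"
  shows "d (coset_of Qh Jh f) = \<zero>\<^bsub>M\<^esub>"
  using derivation_coset_mult_if_vertex_zero[OF f(1,1,3)] f(2) act derivation_coset_closed[OF f(1)] by simp

end

end

locale bound_quiver_pullback = bound_quiver_map +
  assumes pi_kernel: "d \<in> derivations (quot_algebra Qh Jh) (scalar Qh Jh) (vertex_character i)
        (restrict_scalars (\<lambda>X. \<pi> ` X) M) \<Longrightarrow> f \<in> carrier A.P \<Longrightarrow> \<pi> f = (\<lambda>_. 0) \<Longrightarrow>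
      d (coset_of Qh Jh f) = \<zero>\<^bsub>M\<^esub>"
begin

lemma corner_pullback_image: "corner_pullback (quot_algebra Qh Jh) (scalar Qh Jh) (vertex_character i)
  (quot_algebra Q J) (scalar Q J) (vertex_character i) M (\<lambda>X. \<pi> ` X)"
proof (intro corner_pullback.intro corner_pullback_axioms.intro augmented_module.intro)
  show "augmented_algebra (quot_algebra Qh Jh) (scalar Qh Jh) (vertex_character i)"
    by (rule A.augmented_quot_algebra) (rule i)
  show "augmented_algebra (quot_algebra Q J) (scalar Q J) (vertex_character i)"
    by (rule B.augmented_quot_algebra) (rule i)
  show "left_module (quot_algebra Q J) M" by (rule M.left_module_axioms)
  note ops = A.carrier_quot B.carrier_quot A.quot_ops B.quot_ops A.quot_one B.quot_zero
    pi_coset pi_closed A.quot_zero B.quot_one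
  have one: "\<one>\<^bsub>A.P\<^esub> \<in> carrier A.P" by simp
  show "\<pi> ` X \<in> carrier (quot_algebra Q J)" if "X \<in> carrier (quot_algebra Qh Jh)" for X
    using that by (auto simp: ops)
  show "\<pi> ` (X \<oplus>\<^bsub>quot_algebra Qh Jh\<^esub> Y) = \<pi> ` X \<oplus>\<^bsub>quot_algebra Q J\<^esub> \<pi> ` Y"
    if X: "X \<in> carrier (quot_algebra Qh Jh)" and Y: "Y \<in> carrier (quot_algebra Qh Jh)" for X Y
  proof -
    obtain f g where "f \<in> carrier A.P" "X = coset_of Qh Jh f" "g \<in> carrier A.P" "Y = coset_of Qh Jh g"
      using X Y by (auto simp: A.carrier_quot)
    then show ?thesis by (simp add: ops pi_add)
  qed
  show "\<pi> ` (X \<otimes>\<^bsub>quot_algebra Qh Jh\<^esub> Y) = \<pi> ` X \<otimes>\<^bsub>quot_algebra Q J\<^esub> \<pi> ` Y"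
    if X: "X \<in> carrier (quot_algebra Qh Jh)" and Y: "Y \<in> carrier (quot_algebra Qh Jh)" for X Y
  proof -
    obtain f g where "f \<in> carrier A.P" "X = coset_of Qh Jh f" "g \<in> carrier A.P" "Y = coset_of Qh Jh g"
      using X Y by (auto simp: A.carrier_quot)
    then show ?thesis by (simp add: ops pi_mult)
  qed
  show "\<pi> ` \<one>\<^bsub>quot_algebra Qh Jh\<^esub> \<odot>\<^bsub>M\<^esub> x = x" if "x \<in> carrier M" for x
    using that by (simp add: ops pi_one)
  show "\<exists>X\<in>carrier (quot_algebra Qh Jh). \<pi> ` X = \<pi> ` \<one>\<^bsub>quot_algebra Qh Jh\<^esub> \<otimes>\<^bsub>quot_algebra Q J\<^esub> Y"
    if Y: "Y \<in> carrier (quot_algebra Q J)" for Y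
  proof -
    obtain h where h: "h \<in> carrier B.P" "Y = coset_of Q J h" using Y by (auto simp: B.carrier_quot)
    obtain f where f: "f \<in> carrier A.P" "\<pi> f = \<pi> \<one>\<^bsub>A.P\<^esub> \<otimes>\<^bsub>B.P\<^esub> h" using pi_corner[OF h(1)] by blast
    have "\<pi> ` coset_of Qh Jh f = \<pi> ` \<one>\<^bsub>quot_algebra Qh Jh\<^esub> \<otimes>\<^bsub>quot_algebra Q J\<^esub> Y"
      using h f one by (simp add: ops)
    then show ?thesis using f(1) by (auto simp: A.carrier_quot)
  qed
  show "\<pi> ` scalar Qh Jh c = \<pi> ` \<one>\<^bsub>quot_algebra Qh Jh\<^esub> \<otimes>\<^bsub>quot_algebra Q J\<^esub> scalar Q J c" for c
    using one by (simp add: scalar_def ops A.const_series_closed B.const_series_closed pi_const)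
  show "vertex_character i (\<pi> ` X) = vertex_character i X" if "X \<in> carrier (quot_algebra Qh Jh)" for X
    using that by (auto simp: ops A.vertex_character_coset B.vertex_character_coset pi_vertex)
  show "d X = \<zero>\<^bsub>M\<^esub>"
    if d: "d \<in> derivations (quot_algebra Qh Jh) (scalar Qh Jh) (vertex_character i)
        (restrict_scalars (\<lambda>X. \<pi> ` X) M)"
      and X: "X \<in> carrier (quot_algebra Qh Jh)" and zero: "\<pi> ` X = \<zero>\<^bsub>quot_algebra Q J\<^esub>" for d X
  proof -
    obtain f where f: "f \<in> carrier A.P" "X = coset_of Qh Jh f" using X by (auto simp: A.carrier_quot)
    have "\<pi> f \<in> J"
      using zero f by (simp add: ops B.coset_eq_J_iff)
    then obtain g where g: "g \<in> Jh" "\<pi> g = \<pi> f" using pi_J by auto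
    then have gc: "g \<in> carrier A.P" using A.a_subset by auto
    \<comment> \<open>Because \<open>Jh\<close> maps onto \<open>J\<close>, the coset of \<open>f\<close> is represented by an element of the kernel of \<open>\<pi>\<close>.\<close>
    have split: "g \<oplus>\<^bsub>A.P\<^esub> (f \<ominus>\<^bsub>A.P\<^esub> g) = f"
      using f(1) gc by (simp add: a_minus_def A.add.m_lcomm A.r_neg)
    then have "\<pi> f \<oplus>\<^bsub>B.P\<^esub> \<pi> (f \<ominus>\<^bsub>A.P\<^esub> g) = \<pi> f"
      using pi_add[of g "f \<ominus>\<^bsub>A.P\<^esub> g"] f(1) gc g(2) by simp
    then have "\<pi> (f \<ominus>\<^bsub>A.P\<^esub> g) = (\<lambda>_. 0)"
      by (auto simp: path_algebra_simps fun_eq_iff)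
    moreover have "X = coset_of Qh Jh (f \<ominus>\<^bsub>A.P\<^esub> g)"
    proof -
      have "coset_of Qh Jh g \<oplus>\<^bsub>quot_algebra Qh Jh\<^esub> coset_of Qh Jh (f \<ominus>\<^bsub>A.P\<^esub> g) = X"
        using f gc split by (simp add: A.quot_ops)
      moreover have "coset_of Qh Jh g = \<zero>\<^bsub>quot_algebra Qh Jh\<^esub>"
        using g gc by (simp add: A.coset_eq_J_iff A.quot_zero)
      moreover have "coset_of Qh Jh (f \<ominus>\<^bsub>A.P\<^esub> g) \<in> carrier (quot_algebra Qh Jh)"
        using f gc by (auto simp: A.carrier_quot)
      ultimately show ?thesis
        using abelian_monoid.l_zero[OF abelian_group.axioms(1)[OF ring.is_abelian_group[OF A.quotient_is_ring]]]
        by metis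
    qed
    ultimately show ?thesis using pi_kernel[OF d, of "f \<ominus>\<^bsub>A.P\<^esub> g"] f(1) gc by simp
  qed
qed

theorem g_vector_pullback:
  "g_vector Qh Jh (restrict_scalars (\<lambda>X. \<pi> ` X) M, v) i = g_vector Q J (M, v) i"
proof -
  interpret C: corner_pullback "quot_algebra Qh Jh" "scalar Qh Jh" "vertex_character i"
    "quot_algebra Q J" "scalar Q J" "vertex_character i" M "\<lambda>X. \<pi> ` X"
    by (rule corner_pullback_image)
  show ?thesis
    unfolding g_vector_def simple_module_eq_character_module
    using C.cdim_hom_space_pullback C.cdim_ext1_space_pullback by simp
qed

end

section \<open>Deleting the frozen part of a quiver\<close>

lemma idealI_closed:
  fixes R (structure)
  assumes "ring R" and sub: "I \<subseteq> carrier R" and ne: "I \<noteq> {}"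
    and add: "\<And>a b. a \<in> I \<Longrightarrow> b \<in> I \<Longrightarrow> a \<oplus>\<^bsub>R\<^esub> b \<in> I"
    and l: "\<And>a x. a \<in> I \<Longrightarrow> x \<in> carrier R \<Longrightarrow> x \<otimes> a \<in> I"
    and r: "\<And>a x. a \<in> I \<Longrightarrow> x \<in> carrier R \<Longrightarrow> a \<otimes> x \<in> I"
  shows "ideal I R"
proof -
  interpret ring R by fact
  have neg: "\<ominus> a \<in> I" if a: "a \<in> I" for a
    using l[OF a, of "\<ominus> \<one>"] a sub by (auto simp: l_minus)
  show ?thesis
    by (rule idealI[OF assms(1)])
      (use a_group sub ne add neg l r in \<open>auto simp: a_inv_def intro!: group.subgroupI\<close>)
qed

lemma (in quiver) ideal_arrow_ideal: "ideal (arrow_ideal Q) (path_algebra Q)"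
proof (rule idealI_closed[OF ring_path_algebra])
  interpret P: ring "path_algebra Q" by (rule ring_path_algebra)
  have "\<zero>\<^bsub>path_algebra Q\<^esub> \<in> arrow_ideal Q" 
    by (auto simp: arrow_ideal_def path_algebra_simps in_carrier_path_algebra)
  then show "arrow_ideal Q \<noteq> {}" by blast
next
  fix a x assume a: "a \<in> arrow_ideal Q" and x: "x \<in> carrier (path_algebra Q)"
  then have "a \<in> carrier (path_algebra Q)" by (simp add: arrow_ideal_def)
  then have "x \<otimes>\<^bsub>path_algebra Q\<^esub> a \<in> carrier (path_algebra Q)"
    "a \<otimes>\<^bsub>path_algebra Q\<^esub> x \<in> carrier (path_algebra Q)"
    using x by (simp_all add: path_mult_closed)
  then show "x \<otimes>\<^bsub>path_algebra Q\<^esub> a \<in> arrow_ideal Q" "a \<otimes>\<^bsub>path_algebra Q\<^esub> x \<in> arrow_ideal Q"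
    using a by (simp_all add: arrow_ideal_def path_algebra_mult pre_digraph.awalk_verts.simps)
qed (auto simp: arrow_ideal_def path_algebra_simps in_carrier_path_algebra)

lemma awlast_mutable_part:
  "pre_digraph.awlast (mutable_part n Qt) u p = pre_digraph.awlast Qt u p"
  by (simp add: pre_digraph.awalk_verts_conv mutable_part_def)

definition arrow_series :: "(nat, 'a) pre_digraph \<Rightarrow> 'a \<Rightarrow> 'a path_series" where
  "arrow_series Q b = (\<lambda>x. if x = (tail Q b, [b]) then 1 else 0)"

lemma (in quiver) mult_arrow_series:
  "(f \<otimes>\<^bsub>path_algebra Q\<^esub> arrow_series Q b) (u, p) =
    (if u = tail Q b \<and> p \<noteq> [] \<and> hd p = b then f (head Q b, tl p) else 0)"
proof (cases "u = tail Q b \<and> p \<noteq> [] \<and> hd p = b")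
  case True
  then obtain q where p: "p = b # q" by (cases p) auto
  have "(f \<otimes>\<^bsub>path_algebra Q\<^esub> arrow_series Q b) (u, p) =
      (\<Sum>k\<le>length p. if k = 1 then f (head Q b, q) else 0)"
    unfolding path_algebra_mult
  proof (rule sum.cong[OF refl])
    fix k assume "k \<in> {..length p}"
    show "f (awlast u (take k p), drop k p) * arrow_series Q b (u, take k p) =
        (if k = 1 then f (head Q b, q) else 0)"
    proof (cases "k = 1")
      case False
      have "take k p \<noteq> [b]"
      proof
        assume "take k p = [b]"
        then have "min (length p) k = 1" by (metis length_take length_Cons list.size(3) One_nat_def)
        with False have "length p = 1" by auto
        with p \<open>k \<in> _\<close> False have "k = 0" by auto
        with \<open>take k p = [b]\<close> show False by simp
      qed
      then show ?thesis using False by (simp add: arrow_series_def)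
    qed (use True p in \<open>simp add: arrow_series_def\<close>)
  qed
  moreover have "1 \<in> {..length p}" using p by simp
  ultimately show ?thesis using True p by (simp only: sum.delta finite_atMost) simp
next
  case False
  have "arrow_series Q b (u, take k p) = 0" for k
    using False by (cases p; cases k) (auto simp: arrow_series_def)
  then show ?thesis using False by (auto simp: path_algebra_mult)
qed

locale ice_quiver = Qt: fin_digraph Qt + Jt: ideal Jt "path_algebra Qt"
  for n m :: nat and Qt :: "(nat, 'a) pre_digraph" and Jt +
  assumes verts_Qt: "verts Qt = {1..n + m}"
    and Jt_power: "Jt \<subseteq> ideal_power (path_algebra Qt) (arrow_ideal Qt) 2"
begin

abbreviation "Q \<equiv> mutable_part n Qt"
abbreviation "J \<equiv> rho n Qt ` Jt"
abbreviation "Pt \<equiv> path_algebra Qt"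
abbreviation "P \<equiv> path_algebra Q"

lemma quiver_Qt: "quiver Qt"
  by (intro quiver.intro) unfold_locales

interpretation qt: quiver Qt by (rule quiver_Qt)

lemma arcs_Q: "b \<in> arcs Q \<longleftrightarrow> b \<in> arcs Qt \<and> tail Qt b \<in> {1..n} \<and> head Qt b \<in> {1..n}"
  and verts_Q: "verts Q = {1..n + m}" and tail_Q: "tail Q = tail Qt" and head_Q: "head Q = head Qt"
  by (simp_all add: mutable_part_def verts_Qt)

lemma quiver_Q: "quiver Q"
  by (intro quiver.intro wf_digraph.intro) (auto simp: arcs_Q verts_Q tail_Q head_Q)

interpretation q: quiver Q by (rule quiver_Q)

lemma paths_Q_subset: "paths Q \<subseteq> paths Qt"
proof -
  have "(u, p) \<in> paths Qt" if "(u, p) \<in> paths Q" for u p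
    using that
    by (induction p arbitrary: u)
      (auto simp: q.paths_Nil qt.paths_Nil q.paths_Cons qt.paths_Cons verts_Qt verts_Q arcs_Q tail_Q head_Q)
  then show ?thesis by auto
qed

lemma carrier_P_subset: "carrier P \<subseteq> carrier Pt"
proof
  fix f assume "f \<in> carrier P"
  then show "f \<in> carrier Pt" 
    using paths_Q_subset by (simp add: in_carrier_path_algebra) blast
qed

lemma rho_closed: "rho n Qt f \<in> carrier P"
  by (simp add: rho_def in_carrier_path_algebra)

lemma rho_id: "f \<in> carrier P \<Longrightarrow> rho n Qt f = f"
  by (auto simp: rho_def in_carrier_path_algebra)

lemma rho_add: "rho n Qt (f \<oplus>\<^bsub>Pt\<^esub> g) = rho n Qt f \<oplus>\<^bsub>P\<^esub> rho n Qt g"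
  by (auto simp: rho_def path_algebra_simps)

lemma rho_mult: "rho n Qt (f \<otimes>\<^bsub>Pt\<^esub> g) = rho n Qt f \<otimes>\<^bsub>P\<^esub> rho n Qt g"
proof
  fix x :: "nat \<times> 'a list"
  obtain u p where [simp]: "x = (u, p)" by (cases x)
  have "f (pre_digraph.awlast Qt u (take k p), drop k p) * g (u, take k p) =
      rho n Qt f (pre_digraph.awlast Q u (take k p), drop k p) * rho n Qt g (u, take k p)"
    if "(u, p) \<in> paths Q" for k
    using that q.paths_append[of u "take k p" "drop k p"] by (simp add: rho_def awlast_mutable_part)
  moreover have "rho n Qt f (pre_digraph.awlast Q u (take k p), drop k p) * rho n Qt g (u, take k p) = 0"
    if "(u, p) \<notin> paths Q" for k
    using that q.paths_append[of u "take k p" "drop k p"] by (auto simp: rho_def)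
  ultimately show "rho n Qt (f \<otimes>\<^bsub>Pt\<^esub> g) x = (rho n Qt f \<otimes>\<^bsub>P\<^esub> rho n Qt g) x"
    by (cases "(u, p) \<in> paths Q") (simp_all add: path_algebra_mult rho_def[of _ _ "_ \<otimes>\<^bsub>_\<^esub> _"])
qed

lemma Jt_vertex: "f \<in> Jt \<Longrightarrow> f (u, []) = 0"
proof -
  assume "f \<in> Jt"
  then have "f \<in> ideal_power Pt (arrow_ideal Qt) (Suc 1)" using Jt_power by (auto simp: numeral_2_eq_2)
  then have "f \<in> ideal_prod Pt (arrow_ideal Qt) (ideal_power Pt (arrow_ideal Qt) 1)" by simp
  then show "f (u, []) = 0"
    by (induction rule: ideal_prod.induct)
      (auto simp: arrow_ideal_def path_algebra_mult path_algebra_simps pre_digraph.awalk_verts.simps)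
qed

lemma ideal_J: "ideal J P"
proof (rule idealI_closed[OF q.ring_path_algebra])
  show "J \<noteq> {}" using additive_subgroup.zero_closed[OF Jt.additive_subgroup_axioms] by blast
  show "a \<oplus>\<^bsub>P\<^esub> b \<in> J" if "a \<in> J" "b \<in> J" for a b
    using that by (auto simp: rho_add[symmetric] Jt.a_closed)
  show "x \<otimes>\<^bsub>P\<^esub> a \<in> J" if a: "a \<in> J" and x: "x \<in> carrier P" for a x
  proof -
    obtain f where f: "f \<in> Jt" "a = rho n Qt f" using a by blast
    have "x \<otimes>\<^bsub>P\<^esub> a = rho n Qt (x \<otimes>\<^bsub>Pt\<^esub> f)" using f x by (simp add: rho_mult rho_id)
    then show ?thesis using f x carrier_P_subset Jt.I_l_closed by auto
  qed
  show "a \<otimes>\<^bsub>P\<^esub> x \<in> J" if a: "a \<in> J" and x: "x \<in> carrier P" for a x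
  proof -
    obtain f where f: "f \<in> Jt" "a = rho n Qt f" using a by blast
    have "a \<otimes>\<^bsub>P\<^esub> x = rho n Qt (f \<otimes>\<^bsub>Pt\<^esub> x)" using f x by (simp add: rho_mult rho_id)
    then show ?thesis using f x carrier_P_subset Jt.I_r_closed by auto
  qed
qed (auto simp: rho_closed)

lemma bound_quiver_Qt: "bound_quiver Qt Jt"
  by (intro bound_quiver.intro bound_quiver_axioms.intro quiver_Qt Jt.ideal_axioms Jt_vertex)

lemma bound_quiver_Q: "bound_quiver Q J"
  by (intro bound_quiver.intro bound_quiver_axioms.intro quiver_Q ideal_J)
    (auto simp: rho_def Jt_vertex)

lemma frozen_idem_acts_as_zero:
  assumes supp: "(M, v) \<in> supported_reps n Q J" and j: "j \<in> {n + 1..n + m}" and x: "x \<in> carrier M"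
  shows "coset_of Q J (idem j) \<odot>\<^bsub>M\<^esub> x = \<zero>\<^bsub>M\<^esub>"
proof -
  have "vertex_part Q J M j (carrier M) = {\<zero>\<^bsub>M\<^esub>}"
    using supp j by (auto simp: supported_reps_def verts_Q)
  then show ?thesis using x by (auto simp: vertex_part_def)
qed

text \<open>
  By \<open>g_vector_pullback\<close> it suffices that a derivation \<open>D\<close> with values in \<open>M\<close> vanishes on every series
  \<open>f\<close> killed by \<open>rho\<close>. Such a series is the sum of the products \<open>f\<^sub>b b\<close> over all arrows \<open>b\<close>, where \<open>f\<^sub>b\<close>
  collects the coefficients of the paths that start with \<open>b\<close>. This sum is finite although \<open>f\<close> may have
  infinite support, so additivity of \<open>D\<close> applies, and \<open>D (f\<^sub>b b) = f\<^sub>b D b\<close>. If \<open>b\<close> is an arrow of \<open>Q\<close>, then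
  \<open>rho\<close> kills \<open>f\<^sub>b\<close>, which therefore acts on \<open>M\<close> as zero. Otherwise \<open>b\<close> starts or ends at a frozen vertex
  \<open>j\<close>. The idempotent at \<open>j\<close> acts on \<open>M\<close> as zero, so \<open>D\<close> vanishes on it and hence on \<open>b\<close>.
\<close>

theorem g_vector_inflate:
  assumes supp: "(M, v) \<in> supported_reps n Q J" and i: "i \<in> {1..n}"
  shows "g_vector Qt Jt (inflate n Qt (M, v)) i = g_vector Q J (M, v) i"
proof -
  have M: "left_module (quot_algebra Q J) M"
    using supp by (simp add: supported_reps_def decorated_reps_def)
  interpret QJ: bound_quiver Q J by (rule bound_quiver_Q)
  interpret M: left_module "quot_algebra Q J" M by (rule M)
  have rho_one: "rho n Qt \<one>\<^bsub>Pt\<^esub> = \<one>\<^bsub>P\<^esub>"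
    by (auto simp: rho_def path_algebra_one vertex_series_def q.paths_Nil fun_eq_iff verts_Qt verts_Q)
  interpret T: bound_quiver_map Qt Jt Q J M "rho n Qt" i
  proof (intro bound_quiver_map.intro bound_quiver_map_axioms.intro bound_quiver_Qt bound_quiver_Q M)
    show "\<exists>f\<in>carrier Pt. rho n Qt f = rho n Qt \<one>\<^bsub>Pt\<^esub> \<otimes>\<^bsub>P\<^esub> h" if "h \<in> carrier P" for h
      using that carrier_P_subset by (intro bexI[of _ h]) (auto simp: rho_one rho_id)
    have "rho n Qt (const_series Qt c) = const_series Q c" for c
      by (auto simp: rho_def const_series_def q.paths_Nil fun_eq_iff verts_Qt verts_Q)
    then show "rho n Qt (const_series Qt c) = rho n Qt \<one>\<^bsub>Pt\<^esub> \<otimes>\<^bsub>P\<^esub> const_series Q c" for c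
      by (simp add: rho_one QJ.const_series_closed)
    show "coset_of Q J (rho n Qt \<one>\<^bsub>Pt\<^esub>) \<odot>\<^bsub>M\<^esub> x = x" if "x \<in> carrier M" for x
      using M.smult_one[OF that] by (simp add: rho_one QJ.quot_one)
    show "rho n Qt f (i, []) = f (i, [])" for f
      using i by (simp add: rho_def q.paths_Nil verts_Q)
  qed (use i in \<open>auto simp: rho_closed rho_add rho_mult verts_Qt verts_Q\<close>)
  interpret T: bound_quiver_pullback Qt Jt Q J M "rho n Qt" i
  proof (intro bound_quiver_pullback.intro bound_quiver_pullback_axioms.intro T.bound_quiver_map_axioms)
    fix d f
    assume d: "d \<in> derivations (quot_algebra Qt Jt) (scalar Qt Jt) (vertex_character i)
        (restrict_scalars (\<lambda>X. rho n Qt ` X) M)"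
      and f: "f \<in> carrier Pt" and rho_f: "rho n Qt f = (\<lambda>_. 0)"
    let ?D = "\<lambda>f. d (coset_of Qt Jt f)"
    note D = T.derivation_coset_closed[OF d] T.derivation_coset_add[OF d]
      T.derivation_coset_mult_if_vertex_zero[OF d] T.derivation_coset_idempotent[OF d]
    have coset: "coset_of Q J (rho n Qt g) \<in> carrier (quot_algebra Q J)" for g
      using rho_closed by (auto simp: QJ.carrier_quot)
    have idem_closed: "idem j \<in> carrier Pt" if "j \<in> verts Qt" for j
      unfolding idem_eq by (rule qt.vertex_series_closed) (use that in auto)
    have rho_idem: "rho n Qt (idem j) = idem j" if "j \<in> verts Qt" for j
      using that by (auto simp: rho_def idem_def q.paths_Nil verts_Q verts_Qt)
    have idem_act: "coset_of Q J (rho n Qt (idem j)) \<odot>\<^bsub>M\<^esub> x = \<zero>\<^bsub>M\<^esub>"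
      if "j \<in> {n + 1..n + m}" "x \<in> carrier M" for j x
      using frozen_idem_acts_as_zero[OF supp that] rho_idem[of j] that(1) by (simp add: verts_Qt)
    have D_idem: "?D (idem j) = \<zero>\<^bsub>M\<^esub>" if j: "j \<in> {n + 1..n + m}" for j
    proof (rule D(4))
      show "idem j \<in> carrier Pt" using j by (intro idem_closed) (auto simp: verts_Qt)
      show "idem j \<otimes>\<^bsub>Pt\<^esub> idem j = idem j"
        unfolding idem_eq
        by (auto simp: fun_eq_iff vertex_series_mult) (auto simp: vertex_series_def pre_digraph.awalk_verts.simps)
      show "idem j (i, []) = 0" using i j by (auto simp: idem_def)
    qed (rule idem_act[OF j])
    have arrow_closed: "arrow_series Qt b \<in> carrier Pt" if "b \<in> arcs Qt" for b
      using that qt.paths_Cons[of "tail Qt b" b "[]"]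
      by (auto simp: arrow_series_def in_carrier_path_algebra qt.paths_Nil)
    have D_arrow: "?D (arrow_series Qt b) = \<zero>\<^bsub>M\<^esub>" if b: "b \<in> arcs Qt" "b \<notin> arcs Q" for b
    proof (cases "head Qt b \<in> {1..n}")
      case False
      then have h: "head Qt b \<in> {n + 1..n + m}"
        using Qt.head_in_verts[OF b(1)] by (auto simp: verts_Qt)
      have "idem (head Qt b) \<otimes>\<^bsub>Pt\<^esub> arrow_series Qt b = arrow_series Qt b"
        by (auto simp: fun_eq_iff idem_eq vertex_series_mult arrow_series_def pre_digraph.awalk_verts.simps)
      then show ?thesis
        using D(3)[of "idem (head Qt b)" "arrow_series Qt b"] h arrow_closed[OF b(1)] idem_closed
          idem_act[OF h] D(1) by (simp add: arrow_series_def verts_Qt)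
    next
      case True
      then have t: "tail Qt b \<in> {n + 1..n + m}"
        using b Qt.tail_in_verts[OF b(1)] by (auto simp: verts_Qt arcs_Q)
      have "arrow_series Qt b \<otimes>\<^bsub>Pt\<^esub> idem (tail Qt b) = arrow_series Qt b"
        by (auto simp: fun_eq_iff idem_eq mult_vertex_series arrow_series_def)
      moreover have "idem (tail Qt b) (i, []) = 0" using i t by (auto simp: idem_def)
      ultimately show ?thesis
        using D(3)[of "arrow_series Qt b" "idem (tail Qt b)"] t arrow_closed[OF b(1)] idem_closed
          D_idem[OF t] M.smult_zero_right[OF coset] by (simp add: verts_Qt)
    qed
    have "?D f = \<zero>\<^bsub>M\<^esub>" if "finite B" "B \<subseteq> arcs Qt" "f \<in> carrier Pt" "rho n Qt f = (\<lambda>_. 0)"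
      "\<And>u p. f (u, p) \<noteq> 0 \<Longrightarrow> p \<noteq> [] \<and> hd p \<in> B" for B f
      using that
    proof (induction B arbitrary: f rule: finite_induct)
      case empty
      then have "f = \<zero>\<^bsub>Pt\<^esub>" by (auto simp: path_algebra_simps fun_eq_iff)
      then show ?case using T.derivation_coset_zero[OF d] by simp
    next
      case (insert b B)
      have b: "b \<in> arcs Qt" using insert.prems by simp
      \<comment> \<open>The decomposition is peeled off one arrow at a time: \<open>r\<close> consists of the terms of \<open>f\<close> that do
        not start with \<open>b\<close>.\<close>
      define fb :: "'a path_series" where
        "fb = (\<lambda>(u, p). if u = head Qt b then f (tail Qt b, b # p) else 0)"
      define r :: "'a path_series" where
        "r = (\<lambda>(u, p). if p \<noteq> [] \<and> hd p = b then 0 else f (u, p))"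
      have f0: "f (u, p) = 0" if "(u, p) \<notin> paths Qt" for u p
        using insert.prems(2) that by (simp add: in_carrier_path_algebra)
      have fb: "fb \<in> carrier Pt"
        using f0 by (auto simp: fb_def in_carrier_path_algebra qt.paths_Cons)
      have r: "r \<in> carrier Pt"
        using f0 by (auto simp: r_def in_carrier_path_algebra)
      have split: "f = fb \<otimes>\<^bsub>Pt\<^esub> arrow_series Qt b \<oplus>\<^bsub>Pt\<^esub> r"
      proof
        fix x :: "nat \<times> 'a list"
        obtain u p where [simp]: "x = (u, p)" by (cases x)
        have "f (u, b # q) = 0" if "u \<noteq> tail Qt b" for q
          using that f0 by (auto simp: qt.paths_Cons)
        then show "f x = (fb \<otimes>\<^bsub>Pt\<^esub> arrow_series Qt b \<oplus>\<^bsub>Pt\<^esub> r) x"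
          by (cases p) (auto simp: path_algebra_simps qt.mult_arrow_series fb_def r_def)
      qed
      have "?D r = \<zero>\<^bsub>M\<^esub>"
      proof (rule insert.IH)
        show "rho n Qt r = (\<lambda>_. 0)"
        proof
          fix x show "rho n Qt r x = 0"
            using fun_cong[OF insert.prems(3), of x] by (auto simp: rho_def r_def split: prod.splits)
        qed
        show "p \<noteq> [] \<and> hd p \<in> B" if "r (u, p) \<noteq> 0" for u p
          using that insert.prems(4)[of u p] by (auto simp: r_def split: if_splits)
      qed (use insert.prems r in auto)
      moreover have "?D (fb \<otimes>\<^bsub>Pt\<^esub> arrow_series Qt b) = \<zero>\<^bsub>M\<^esub>"
      proof -
        have *: "?D (fb \<otimes>\<^bsub>Pt\<^esub> arrow_series Qt b) = coset_of Q J (rho n Qt fb) \<odot>\<^bsub>M\<^esub> ?D (arrow_series Qt b)"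
          by (rule D(3)[OF fb arrow_closed[OF b]]) (simp add: arrow_series_def)
        show ?thesis
        proof (cases "b \<in> arcs Q")
          case True
          have "rho n Qt fb = \<zero>\<^bsub>P\<^esub>"
          proof
            fix x :: "nat \<times> 'a list"
            obtain u p where [simp]: "x = (u, p)" by (cases x)
            show "rho n Qt fb x = \<zero>\<^bsub>P\<^esub> x"
              using fun_cong[OF insert.prems(3), of "(tail Qt b, b # p)"] True
              by (auto simp: rho_def fb_def path_algebra_simps q.paths_Cons tail_Q head_Q)
          qed
          then have "coset_of Q J (rho n Qt fb) = \<zero>\<^bsub>quot_algebra Q J\<^esub>"
            by (simp add: QJ.quot_zero QJ.coset_eq_J_iff)
          then show ?thesis using * D(1)[OF arrow_closed[OF b]] by (simp add: M.smult_zero_left)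
        next
          case False
          then show ?thesis using * D_arrow[OF b] M.smult_zero_right[OF coset] by simp
        qed
      qed
      moreover have "fb \<otimes>\<^bsub>Pt\<^esub> arrow_series Qt b \<in> carrier Pt"
        by (rule qt.path_mult_closed[OF fb arrow_closed[OF b]])
      ultimately show ?case
        using D(2)[OF _ r] by (subst split) simp
    qed
    moreover have "p \<noteq> [] \<and> hd p \<in> arcs Qt" if nz: "f (u, p) \<noteq> 0" for u p
    proof -
      have path: "(u, p) \<in> paths Qt" using f nz by (auto simp: in_carrier_path_algebra)
      have "p \<noteq> []"
      proof
        assume [simp]: "p = []"
        have "(u, p) \<in> paths Q" using path by (simp add: q.paths_Nil qt.paths_Nil verts_Q verts_Qt)
        then show False using fun_cong[OF rho_f, of "(u, p)"] nz by (simp add: rho_def)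
      qed
      then show ?thesis using path by (cases p) (auto simp: qt.paths_Cons)
    qed
    ultimately show "?D f = \<zero>\<^bsub>M\<^esub>"
      using f rho_f Qt.finite_arcs by blast
  qed
  show ?thesis
    using T.g_vector_pullback by (simp add: inflate_def)
qed

end

section \<open>Principal coefficients\<close>

lemma map_Inl_projl: "set p \<subseteq> range Inl \<Longrightarrow> map Inl (map projl p) = p"
  by (induction p) auto

context ice_quiver
begin

interpretation q: quiver Q by (rule quiver_Q)

abbreviation "Qp \<equiv> prin_quiver n Q"
abbreviation "Pp \<equiv> path_algebra Qp"

lemma verts_Qp: "verts Qp = {1..n + n}"
  and arcs_Qp: "arcs Qp = Inl ` arcs Q \<union> Inr ` {1..n}"
  and tail_Qp: "tail Qp (Inl b) = tail Qt b" "tail Qp (Inr j) = j"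
  and head_Qp: "head Qp (Inl b) = head Qt b" "head Qp (Inr j) = n + j"
  by (simp_all add: prin_quiver_def tail_Q head_Q)

lemma quiver_Qp: "quiver Qp"
  by (intro quiver.intro wf_digraph.intro) (auto simp: arcs_Qp verts_Qp tail_Qp head_Qp arcs_Q)

interpretation qp: quiver Qp by (rule quiver_Qp)

lemma awlast_map_Inl: "pre_digraph.awlast Qp u (map Inl p) = pre_digraph.awlast Q u p"
  by (simp add: pre_digraph.awalk_verts_conv tail_Qp head_Qp tail_Q head_Q last_map)

lemma paths_map_Inl: "u \<in> {1..n} \<Longrightarrow> (u, map Inl p) \<in> paths Qp \<longleftrightarrow> (u, p) \<in> paths Q"
  by (induction p arbitrary: u)
    (auto simp: qp.paths_Nil q.paths_Nil qp.paths_Cons q.paths_Cons verts_Qp verts_Q arcs_Qp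
      tail_Qp head_Qp tail_Q head_Q arcs_Q image_iff)

lemma awlast_in_mutable:
  assumes "(u, p) \<in> paths Q" "u \<in> {1..n}"
  shows "pre_digraph.awlast Q u p \<in> {1..n}"
  using assms
proof (induction p arbitrary: u)
  case Nil
  then show ?case by (simp add: pre_digraph.awalk_verts.simps)
next
  case (Cons b p)
  then have "(head Qt b, p) \<in> paths Q" "head Qt b \<in> {1..n}"
    by (auto simp: q.paths_Cons arcs_Q head_Q)
  then show ?case using Cons.IH by (simp add: pre_digraph.awalk_verts.simps head_Q)
qed

lemma path_from_frozen_vertex:
  assumes "(u, p) \<in> paths Q" "u \<notin> {1..n}"
  shows "p = []"
  using assms by (cases p) (auto simp: q.paths_Cons arcs_Q tail_Q)

text \<open>
  The additional vertices are sinks, so a path that reaches one of them ends there.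
\<close>

lemma path_ending_at_mutable_vertex:
  assumes "(u, p) \<in> paths Qp" "pre_digraph.awlast Qp u p \<in> {1..n}"
  shows "u \<in> {1..n} \<and> set p \<subseteq> range Inl"
  using assms
proof (induction p arbitrary: u)
  case Nil
  then show ?case by (simp add: pre_digraph.awalk_verts.simps)
next
  case (Cons b p)
  then have b: "b \<in> arcs Qp" "u = tail Qp b" and IH: "head Qp b \<in> {1..n}" "set p \<subseteq> range Inl"
    by (auto simp: qp.paths_Cons pre_digraph.awalk_verts.simps)
  from b IH show ?case by (auto simp: arcs_Qp tail_Qp head_Qp arcs_Q)
qed

lemma prin_project_closed:
  assumes f: "f \<in> carrier Pp"
  shows "prin_project n f \<in> carrier P"
  using f paths_map_Inl by (auto simp: prin_project_def in_carrier_path_algebra)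

lemma prin_embed_closed:
  assumes f: "f \<in> carrier P"
  shows "prin_embed n f \<in> carrier Pp"
  unfolding in_carrier_path_algebra
proof (intro allI impI)
  fix x :: "nat \<times> ('a + nat) list" assume x: "x \<notin> paths Qp"
  obtain u p where [simp]: "x = (u, p)" by (cases x)
  have "f (u, map projl p) = 0" if u: "u \<in> {1..n}" and p: "set p \<subseteq> range Inl"
  proof -
    have "map Inl (map projl p) = p" using p by (rule map_Inl_projl)
    then have "(u, map projl p) \<notin> paths Q" using x paths_map_Inl[OF u, of "map projl p"] by simp
    then show ?thesis using f by (simp add: in_carrier_path_algebra)
  qed
  then show "prin_embed n f x = 0" by (auto simp: prin_embed_def)
qed

lemma prin_project_embed: "prin_project n (prin_embed n f) (u, p) = (if u \<in> {1..n} then f (u, p) else 0)"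
  by (auto simp: prin_project_def prin_embed_def comp_def)

lemma prin_project_embed_J:
  assumes f: "f \<in> J"
  shows "prin_project n (prin_embed n f) = f"
proof -
  interpret QJ: bound_quiver Q J by (rule bound_quiver_Q)
  have "f (u, p) = 0" if "u \<notin> {1..n}" for u p
  proof (cases "(u, p) \<in> paths Q")
    case True
    then show ?thesis using path_from_frozen_vertex[OF _ that] QJ.J_vertex[OF f] by auto
  next
    case False
    then show ?thesis using QJ.a_subset f by (auto simp: in_carrier_path_algebra)
  qed
  then show ?thesis by (auto simp: fun_eq_iff prin_project_embed)
qed

lemma prin_project_add: "prin_project n (f \<oplus>\<^bsub>Pp\<^esub> g) = prin_project n f \<oplus>\<^bsub>P\<^esub> prin_project n g"
  by (auto simp: prin_project_def path_algebra_simps)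

text \<open>
  A path of \<open>Q\<close> that starts in \<open>{1..n}\<close> stays there, so all pieces into which it is cut also start in
  \<open>{1..n}\<close> and are seen by \<open>prin_project\<close>.
\<close>

lemma prin_project_mult:
  assumes f: "f \<in> carrier Pp" and g: "g \<in> carrier Pp"
  shows "prin_project n (f \<otimes>\<^bsub>Pp\<^esub> g) = prin_project n f \<otimes>\<^bsub>P\<^esub> prin_project n g"
proof
  fix x :: "nat \<times> 'a list"
  obtain u p where [simp]: "x = (u, p)" by (cases x)
  have "f (pre_digraph.awlast Qp u (take k (map Inl p)), drop k (map Inl p)) * g (u, take k (map Inl p)) =
      prin_project n f (pre_digraph.awlast Q u (take k p), drop k p) * prin_project n g (u, take k p)"
    if u: "u \<in> {1..n}" for k
  proof (cases "(u, take k p) \<in> paths Q")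
    case True
    then show ?thesis
      using awlast_in_mutable[OF True u] u
      by (simp add: prin_project_def take_map drop_map awlast_map_Inl)
  next
    case False
    then have "g (u, map Inl (take k p)) = 0"
      using g paths_map_Inl[OF u, of "take k p"] by (simp add: in_carrier_path_algebra)
    then show ?thesis using u by (simp add: prin_project_def take_map)
  qed
  note summand = this
  show "prin_project n (f \<otimes>\<^bsub>Pp\<^esub> g) x = (prin_project n f \<otimes>\<^bsub>P\<^esub> prin_project n g) x"
  proof (cases "u \<in> {1..n}")
    case True
    then show ?thesis
      using summand by (simp add: path_algebra_mult prin_project_def[of _ "_ \<otimes>\<^bsub>_\<^esub> _"])
  next
    case False
    then have "prin_project n g (u, q) = 0" for q by (auto simp: prin_project_def)
    with False show ?thesis
      by (auto simp: path_algebra_mult prin_project_def[of _ "_ \<otimes>\<^bsub>_\<^esub> _"])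
  qed
qed

lemma prin_ideal_is_ideal: "ideal (prin_ideal n Q J) Pp"
  unfolding prin_ideal_def
  by (rule ring.genideal_ideal[OF qp.ring_path_algebra])
    (use prin_embed_closed rho_closed in auto)

lemma prin_ideal_vertex:
  assumes "f \<in> prin_ideal n Q J"
  shows "f (u, []) = 0"
proof -
  have "prin_ideal n Q J \<subseteq> arrow_ideal Qp"
    unfolding prin_ideal_def
  proof (rule ring.genideal_minimal[OF qp.ring_path_algebra qp.ideal_arrow_ideal])
    show "prin_embed n ` J \<subseteq> arrow_ideal Qp"
      using prin_embed_closed rho_closed
      by (auto simp: arrow_ideal_def prin_embed_def rho_def Jt_vertex)
  qed
  then show ?thesis using assms by (auto simp: arrow_ideal_def)
qed

lemma bound_quiver_Qp: "bound_quiver Qp (prin_ideal n Q J)"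
  by (intro bound_quiver.intro bound_quiver_axioms.intro quiver_Qp prin_ideal_is_ideal prin_ideal_vertex)

text \<open>
  The series whose projection lies in \<open>J\<close> form an ideal that contains the generators of
  \<open>prin_ideal n Q J\<close>, and the projection recovers \<open>J\<close> from these generators.
\<close>

lemma prin_project_ideal: "prin_project n ` prin_ideal n Q J = J"
proof
  interpret pp: ring Pp by (rule qp.ring_path_algebra)
  interpret J: ideal J P by (rule ideal_J)
  let ?I = "{f \<in> carrier Pp. prin_project n f \<in> J}"
  have "ideal ?I Pp"
  proof (rule idealI_closed[OF qp.ring_path_algebra])
    have "prin_project n \<zero>\<^bsub>Pp\<^esub> = \<zero>\<^bsub>P\<^esub>" by (auto simp: prin_project_def path_algebra_simps)
    then show "?I \<noteq> {}" using J.zero_closed pp.zero_closed by fastforce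
  qed (auto simp: prin_project_add prin_project_mult prin_project_closed J.a_closed J.I_l_closed J.I_r_closed)
  then have "prin_ideal n Q J \<subseteq> ?I"
    unfolding prin_ideal_def
    using prin_embed_closed J.a_subset prin_project_embed_J
    by (intro pp.genideal_minimal) auto
  then show "prin_project n ` prin_ideal n Q J \<subseteq> J" by auto
  have "prin_embed n ` J \<subseteq> prin_ideal n Q J"
    unfolding prin_ideal_def
    using prin_embed_closed J.a_subset by (intro pp.genideal_self) auto
  then have "prin_project n (prin_embed n f) \<in> prin_project n ` prin_ideal n Q J" if "f \<in> J" for f
    using that by blast
  then show "J \<subseteq> prin_project n ` prin_ideal n Q J"
    using prin_project_embed_J by auto
qed

lemma prin_project_const:
  "prin_project n (const_series Qp c) = vertex_series (\<lambda>u. if u \<in> {1..n} then c else 0)"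
  by (auto simp: prin_project_def const_series_def vertex_series_def verts_Qp fun_eq_iff)

lemma frozen_idempotents_act_as_zero:
  assumes supp: "(M, v) \<in> supported_reps n Q J" and x: "x \<in> carrier M"
    and B: "B \<subseteq> {n + 1..n + m}"
  shows "coset_of Q J (vertex_series (\<lambda>u. if u \<in> B then 1 else 0)) \<odot>\<^bsub>M\<^esub> x = \<zero>\<^bsub>M\<^esub>"
proof -
  have M: "left_module (quot_algebra Q J) M"
    using supp by (simp add: supported_reps_def decorated_reps_def)
  interpret QJ: bound_quiver Q J by (rule bound_quiver_Q)
  interpret M: left_module "quot_algebra Q J" M by (rule M)
  have "finite B" using B finite_subset by blast
  then show ?thesis
    using B
  proof (induction B rule: finite_induct)
    case empty
    have "vertex_series (\<lambda>u. if u \<in> {} then 1 else 0) = \<zero>\<^bsub>P\<^esub>"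
      by (auto simp: vertex_series_def path_algebra_simps)
    then have "coset_of Q J (vertex_series (\<lambda>u. if u \<in> {} then 1 else 0)) = \<zero>\<^bsub>quot_algebra Q J\<^esub>"
      by (simp add: QJ.quot_zero QJ.coset_eq_J_iff)
    then show ?case using x by (simp add: M.smult_zero_left)
  next
    case (insert j B)
    let ?f = "vertex_series (\<lambda>u. if u \<in> B then 1 else 0) :: 'a path_series"
    have c: "idem j \<in> carrier P" "?f \<in> carrier P"
      unfolding idem_eq using insert.prems by (auto intro!: q.vertex_series_closed simp: verts_Q)
    have "vertex_series (\<lambda>u. if u \<in> insert j B then 1 else 0) = idem j \<oplus>\<^bsub>P\<^esub> ?f"
      using insert.hyps by (auto simp: vertex_series_def idem_def path_algebra_simps fun_eq_iff)
    then have "coset_of Q J (vertex_series (\<lambda>u. if u \<in> insert j B then 1 else 0)) =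
        coset_of Q J (idem j) \<oplus>\<^bsub>quot_algebra Q J\<^esub> coset_of Q J ?f"
      using c by (simp add: QJ.quot_ops)
    moreover have "coset_of Q J (idem j) \<in> carrier (quot_algebra Q J)"
      "coset_of Q J ?f \<in> carrier (quot_algebra Q J)"
      using c by (auto simp: QJ.carrier_quot)
    ultimately show ?case
      using insert x frozen_idem_acts_as_zero[OF supp _ x, of j] by (simp add: M.smult_l_distr)
  qed
qed

text \<open>
  A series \<open>f\<close> killed by the projection involves only paths that end at additional vertices. Hence
  \<open>f = s f\<close> for the sum \<open>s\<close> of the idempotents at these vertices. Derivations with values in \<open>M\<close> vanish on
  the idempotent \<open>s\<close>, which acts as zero, and therefore on \<open>s f\<close>.
\<close>

theorem g_vector_prin_inflate:
  assumes supp: "(M, v) \<in> supported_reps n Q J" and i: "i \<in> {1..n}"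
  shows "g_vector Qp (prin_ideal n Q J) (prin_inflate n (M, v)) i = g_vector Q J (M, v) i"
proof -
  have M: "left_module (quot_algebra Q J) M"
    using supp by (simp add: supported_reps_def decorated_reps_def)
  interpret QJ: bound_quiver Q J by (rule bound_quiver_Q)
  interpret M: left_module "quot_algebra Q J" M by (rule M)
  let ?e = "vertex_series (\<lambda>u. if u \<in> {1..n} then 1 else 0) :: 'a path_series"
  let ?e' = "vertex_series (\<lambda>u. if u \<in> {n + 1..n + m} then 1 else 0) :: 'a path_series"
  have e: "?e \<in> carrier P" "?e' \<in> carrier P"
    by (auto intro!: q.vertex_series_closed simp: verts_Q)
  have one: "prin_project n \<one>\<^bsub>Pp\<^esub> = ?e"
    using prin_project_const[of 1] by (simp add: path_algebra_one const_series_eq)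
  have e_mult: "(?e \<otimes>\<^bsub>P\<^esub> h) (u, p) = (if u \<in> {1..n} then h (u, p) else 0)" if h: "h \<in> carrier P" for h u p
  proof (cases "(u, p) \<in> paths Q")
    case True
    then have "pre_digraph.awlast Q u p \<in> {1..n} \<longleftrightarrow> u \<in> {1..n}"
      using awlast_in_mutable[OF True] path_from_frozen_vertex[OF True]
      by (cases "p = []") (auto simp: pre_digraph.awalk_verts.simps)
    then show ?thesis by (auto simp: vertex_series_mult)
  qed (use h in \<open>auto simp: vertex_series_mult in_carrier_path_algebra\<close>)
  interpret T: bound_quiver_map Qp "prin_ideal n Q J" Q J M "prin_project n" i
  proof (intro bound_quiver_map.intro bound_quiver_map_axioms.intro bound_quiver_Qp bound_quiver_Q M)
    show "\<exists>f\<in>carrier Pp. prin_project n f = prin_project n \<one>\<^bsub>Pp\<^esub> \<otimes>\<^bsub>P\<^esub> h" if "h \<in> carrier P" for h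
      using that e_mult[OF that] prin_embed_closed[OF that]
      by (intro bexI[of _ "prin_embed n h"]) (auto simp: one prin_project_embed fun_eq_iff)
    show "prin_project n (const_series Qp c) = prin_project n \<one>\<^bsub>Pp\<^esub> \<otimes>\<^bsub>P\<^esub> const_series Q c" for c
      using e_mult[OF QJ.const_series_closed[of c]]
      by (auto simp: prin_project_const one fun_eq_iff) (auto simp: vertex_series_def const_series_def verts_Q)
    show "coset_of Q J (prin_project n \<one>\<^bsub>Pp\<^esub>) \<odot>\<^bsub>M\<^esub> x = x" if x: "x \<in> carrier M" for x
    proof -
      have "\<one>\<^bsub>P\<^esub> = ?e \<oplus>\<^bsub>P\<^esub> ?e'"
        by (auto simp: path_algebra_one path_algebra_simps vertex_series_def fun_eq_iff verts_Q)
      then have "\<one>\<^bsub>quot_algebra Q J\<^esub> = coset_of Q J ?e \<oplus>\<^bsub>quot_algebra Q J\<^esub> coset_of Q J ?e'"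
        using e by (simp add: QJ.quot_one QJ.quot_ops)
      moreover have "coset_of Q J ?e \<in> carrier (quot_algebra Q J)" "coset_of Q J ?e' \<in> carrier (quot_algebra Q J)"
        using e by (auto simp: QJ.carrier_quot)
      ultimately have "x = coset_of Q J ?e \<odot>\<^bsub>M\<^esub> x \<oplus>\<^bsub>M\<^esub> coset_of Q J ?e' \<odot>\<^bsub>M\<^esub> x"
        using M.smult_one[OF x] x by (simp add: M.smult_l_distr)
      moreover have "coset_of Q J ?e \<odot>\<^bsub>M\<^esub> x \<in> carrier M"
        using x e by (intro M.smult_closed) (auto simp: QJ.carrier_quot)
      ultimately show ?thesis
        using frozen_idempotents_act_as_zero[OF supp x, of "{n + 1..n + m}"] by (simp add: one)
    qed
    show "prin_project n f (i, []) = f (i, [])" for f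
      using i by (simp add: prin_project_def)
  qed (use i in \<open>auto simp: prin_project_closed prin_project_add prin_project_mult prin_project_ideal verts_Qp verts_Q\<close>)
  interpret T: bound_quiver_pullback Qp "prin_ideal n Q J" Q J M "prin_project n" i
  proof (intro bound_quiver_pullback.intro bound_quiver_pullback_axioms.intro T.bound_quiver_map_axioms)
    fix d f
    assume d: "d \<in> derivations (quot_algebra Qp (prin_ideal n Q J)) (scalar Qp (prin_ideal n Q J))
        (vertex_character i) (restrict_scalars (\<lambda>X. prin_project n ` X) M)"
      and f: "f \<in> carrier Pp" and zero: "prin_project n f = (\<lambda>_. 0)"
    let ?s = "vertex_series (\<lambda>u. if u \<in> {n + 1..n + n} then 1 else 0) :: ('a + nat) path_series"
    have s: "?s \<in> carrier Pp" by (rule qp.vertex_series_closed) (simp add: verts_Qp)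
    have "?s \<otimes>\<^bsub>Pp\<^esub> f = f"
    proof
      fix x :: "nat \<times> ('a + nat) list"
      obtain u p where [simp]: "x = (u, p)" by (cases x)
      have "pre_digraph.awlast Qp u p \<in> {n + 1..n + n}" if nz: "f (u, p) \<noteq> 0"
      proof (rule ccontr)
        assume no: "pre_digraph.awlast Qp u p \<notin> {n + 1..n + n}"
        have path: "(u, p) \<in> paths Qp" using f nz by (auto simp: in_carrier_path_algebra)
        then have "pre_digraph.awlast Qp u p \<in> {1..n}"
          using qp.awlast_in_verts_if_path[OF path] no by (auto simp: verts_Qp)
        then have u: "u \<in> {1..n}" and p: "set p \<subseteq> range Inl"
          using path_ending_at_mutable_vertex[OF path] by auto
        have "map Inl (map projl p) = p" using p by (rule map_Inl_projl)
        then have "prin_project n f (u, map projl p) = f (u, p)" using u by (simp add: prin_project_def)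
        then show False using zero nz by simp
      qed
      then show "(?s \<otimes>\<^bsub>Pp\<^esub> f) x = f x" by (auto simp: vertex_series_mult)
    qed
    moreover have act: "coset_of Q J (prin_project n ?s) \<odot>\<^bsub>M\<^esub> x = \<zero>\<^bsub>M\<^esub>" if "x \<in> carrier M" for x
    proof -
      have "prin_project n ?s = \<zero>\<^bsub>P\<^esub>"
        by (auto simp: prin_project_def vertex_series_def path_algebra_simps fun_eq_iff)
      then have "coset_of Q J (prin_project n ?s) = \<zero>\<^bsub>quot_algebra Q J\<^esub>"
        by (simp add: QJ.quot_zero QJ.coset_eq_J_iff)
      then show ?thesis using that by (simp add: M.smult_zero_left)
    qed
    moreover have "d (coset_of Qp (prin_ideal n Q J) ?s) = \<zero>\<^bsub>M\<^esub>"
    proof (rule T.derivation_coset_idempotent[OF d s _ _ act])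
      show "?s \<otimes>\<^bsub>Pp\<^esub> ?s = ?s"
        by (auto simp: fun_eq_iff vertex_series_mult) (auto simp: vertex_series_def pre_digraph.awalk_verts.simps)
      show "?s (i, []) = 0" using i by (simp add: vertex_series_def)
    qed
    moreover have "coset_of Q J (prin_project n (const_series Qp c)) \<in> carrier (quot_algebra Q J)" for c
      using prin_project_closed[OF T.A.const_series_closed] by (auto simp: QJ.carrier_quot)
    ultimately show "d (coset_of Qp (prin_ideal n Q J) f) = \<zero>\<^bsub>M\<^esub>"
      using T.derivation_coset_mult[OF d s f] T.derivation_coset_closed[OF d f]
      by (simp add: M.smult_zero_right)
  qed
  show ?thesis
    using T.g_vector_pullback by (simp add: prin_inflate_def)
qed

end

section \<open>Specialization of Laurent polynomials\<close>

definition exponent :: "nat \<Rightarrow> (nat \<Rightarrow> int) \<Rightarrow> nat \<Rightarrow>\<^sub>0 int" where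
  "exponent N f = Abs_poly_mapping (\<lambda>i. if i \<in> {1..N} then f i else 0)"

lemma lookup_exponent: "Poly_Mapping.lookup (exponent N f) i = (if i \<in> {1..N} then f i else 0)"
proof -
  have "finite {i. (if i \<in> {1..N} then f i else 0) \<noteq> 0}"
    by (rule finite_subset[of _ "{1..N}"]) auto
  then show ?thesis by (simp add: exponent_def)
qed

lemma exponent_add: "exponent N f + exponent N g = exponent N (\<lambda>i. f i + g i)"
  by (rule poly_mapping_eqI) (simp add: lookup_add lookup_exponent)

lemma keys_exponent: "Poly_Mapping.keys (exponent N f) = {i \<in> {1..N}. f i \<noteq> 0}"
  by (auto simp: in_keys_iff lookup_exponent split: if_splits)

lemma monomial_eq_single: "monomial N f = Poly_Mapping.single (exponent N f) 1"
  by (simp add: monomial_def exponent_def)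

lemma laurent_ring_zero: "0 \<in> laurent_ring I"
  by (simp add: laurent_ring_def)

lemma laurent_ring_add: "f \<in> laurent_ring I \<Longrightarrow> g \<in> laurent_ring I \<Longrightarrow> f + g \<in> laurent_ring I"
  using keys_add[of f g] by (auto simp: laurent_ring_def)

lemma laurent_ring_mult: "f \<in> laurent_ring I \<Longrightarrow> g \<in> laurent_ring I \<Longrightarrow> f * g \<in> laurent_ring I"
proof -
  assume f: "f \<in> laurent_ring I" and g: "g \<in> laurent_ring I"
  have "Poly_Mapping.keys c \<subseteq> I" if c: "c \<in> Poly_Mapping.keys (f * g)" for c
  proof -
    obtain a b where "c = a + b" "a \<in> Poly_Mapping.keys f" "b \<in> Poly_Mapping.keys g"
      using c keys_mult[of f g] by auto
    moreover from this have "Poly_Mapping.keys a \<subseteq> I" "Poly_Mapping.keys b \<subseteq> I"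
      using f g by (auto simp: laurent_ring_def)
    ultimately show ?thesis using keys_add[of a b] by blast
  qed
  then show ?thesis by (auto simp: laurent_ring_def)
qed

lemma laurent_ring_single: "Poly_Mapping.keys a \<subseteq> I \<Longrightarrow> Poly_Mapping.single a c \<in> laurent_ring I"
  by (auto simp: laurent_ring_def split: if_splits)

lemma laurent_ring_mono: "I \<subseteq> I' \<Longrightarrow> laurent_ring I \<subseteq> laurent_ring I'"
  by (auto simp: laurent_ring_def)

lemma laurent_ring_sum: "(\<And>x. x \<in> A \<Longrightarrow> f x \<in> laurent_ring I) \<Longrightarrow> sum f A \<in> laurent_ring I"
  by (induction A rule: infinite_finite_induct) (auto simp: laurent_ring_zero laurent_ring_add)

lemma laurent_span_superset: "S \<subseteq> laurent_span n m S"
  unfolding laurent_span_def by (rule hull_subset)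

lemma laurent_span_mono: "S \<subseteq> T \<Longrightarrow> laurent_span n m S \<subseteq> laurent_span n m T"
  unfolding laurent_span_def by (rule hull_mono)

lemma laurent_span_minimal:
  assumes "S \<subseteq> W" "W \<subseteq> laurent_ring {1..n + m}" "0 \<in> W"
    and "\<And>x y. x \<in> W \<Longrightarrow> y \<in> W \<Longrightarrow> x + y \<in> W"
    and "\<And>r x. r \<in> laurent_ring {n + 1..n + m} \<Longrightarrow> x \<in> W \<Longrightarrow> r * x \<in> W"
  shows "laurent_span n m S \<subseteq> W"
  unfolding laurent_span_def by (rule hull_minimal) (use assms in auto)

lemma laurent_span_subset_ring:
  assumes "S \<subseteq> laurent_ring {1..n + m}"
  shows "laurent_span n m S \<subseteq> laurent_ring {1..n + m}"
  using laurent_ring_mono[of "{n + 1..n + m}" "{1..n + m}"]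
  by (intro laurent_span_minimal assms) (auto simp: laurent_ring_zero laurent_ring_add intro!: laurent_ring_mult)

lemma laurent_span_zero: "0 \<in> laurent_span n m S"
  unfolding laurent_span_def hull_def by auto

lemma laurent_span_add:
  "x \<in> laurent_span n m S \<Longrightarrow> y \<in> laurent_span n m S \<Longrightarrow> x + y \<in> laurent_span n m S"
  unfolding laurent_span_def hull_def by auto

lemma laurent_span_mult:
  "r \<in> laurent_ring {n + 1..n + m} \<Longrightarrow> x \<in> laurent_span n m S \<Longrightarrow> r * x \<in> laurent_span n m S"
  unfolding laurent_span_def hull_def by auto

lemma laurent_span_sum:
  "(\<And>x. x \<in> A \<Longrightarrow> f x \<in> laurent_span n m S) \<Longrightarrow> sum f A \<in> laurent_span n m S"
  by (induction A rule: infinite_finite_induct) (auto simp: laurent_span_zero laurent_span_add)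

lemma laurent_span_eq_if_subset:
  assumes S: "S \<subseteq> T" and T: "T \<subseteq> laurent_span n m S" and ring: "S \<subseteq> laurent_ring {1..n + m}"
  shows "laurent_span n m S = laurent_span n m T"
proof
  show "laurent_span n m S \<subseteq> laurent_span n m T" using S by (rule laurent_span_mono)
  show "laurent_span n m T \<subseteq> laurent_span n m S"
    by (rule laurent_span_minimal)
      (use T laurent_span_subset_ring[OF ring] in \<open>auto simp: laurent_span_zero laurent_span_add laurent_span_mult\<close>)
qed

lemma poly_mapping_eq_sum_single:
  "f = (\<Sum>a\<in>Poly_Mapping.keys f. Poly_Mapping.single a (Poly_Mapping.lookup f a))"
proof (rule poly_mapping_eqI)
  fix b
  show "Poly_Mapping.lookup f b =
    Poly_Mapping.lookup (\<Sum>a\<in>Poly_Mapping.keys f. Poly_Mapping.single a (Poly_Mapping.lookup f a)) b"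
    by (auto simp: lookup_sum lookup_single when_def in_keys_iff)
qed

context
  fixes n m :: nat and Bt :: "nat \<Rightarrow> nat \<Rightarrow> int"
begin

text \<open>
  The matrix \<open>Bt\<close> applied to the exponents of the variables of indices \<open>n + 1, \<dots>, n + n\<close>.
\<close>

definition weight :: "(nat \<Rightarrow>\<^sub>0 int) \<Rightarrow> nat \<Rightarrow> int" where
  "weight a i = (\<Sum>j = 1..n. Bt i j * Poly_Mapping.lookup a (n + j))"

text \<open>
  Give the variable of index \<open>i \<le> n\<close> the \<open>i\<close>-th unit vector as its degree, and the variable of index
  \<open>n + j\<close> the negative of the \<open>j\<close>-th column of the upper part of \<open>Bt\<close>. Then \<open>a\<close> is the exponent of a
  monomial whose degree consists of the first \<open>n\<close> entries of \<open>\<gamma>\<close>.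
\<close>

definition homogeneous :: "(nat \<Rightarrow> int) \<Rightarrow> (nat \<Rightarrow>\<^sub>0 int) \<Rightarrow> bool" where
  "homogeneous \<gamma> a \<longleftrightarrow> (\<forall>i\<in>{1..n}. Poly_Mapping.lookup a i = weight a i + \<gamma> i)"

text \<open>
  The component of degree \<open>\<gamma>\<close>, with the variables of indices \<open>1, \<dots>, n\<close> set to \<open>1\<close>, the variable of index
  \<open>n + j\<close> replaced by the monomial whose exponent is the \<open>j\<close>-th column of \<open>Bt\<close>, and the result multiplied
  by the monomial with exponent \<open>\<gamma>\<close>. By homogeneity, this restores the exponents at \<open>{1..n}\<close>.
\<close>

definition specialize :: "(nat \<Rightarrow> int) \<Rightarrow> laurent \<Rightarrow> laurent" where
  "specialize \<gamma> f = (\<Sum>a\<in>Poly_Mapping.keys f. if homogeneous \<gamma> a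
     then Poly_Mapping.single (exponent (n + m) (\<lambda>i. weight a i + \<gamma> i)) (Poly_Mapping.lookup f a) else 0)"

lemma specialize_add: "specialize \<gamma> (f + g) = specialize \<gamma> f + specialize \<gamma> g"
  unfolding specialize_def
  by (rule setsum_keys_plus_distrib) (auto simp: single_add)

lemma specialize_zero: "specialize \<gamma> 0 = 0"
  by (simp add: specialize_def)

lemma specialize_sum: "specialize \<gamma> (sum f A) = (\<Sum>x\<in>A. specialize \<gamma> (f x))"
  by (induction A rule: infinite_finite_induct) (auto simp: specialize_zero specialize_add)

lemma specialize_single:
  "specialize \<gamma> (Poly_Mapping.single a c) = (if homogeneous \<gamma> a
    then Poly_Mapping.single (exponent (n + m) (\<lambda>i. weight a i + \<gamma> i)) c else 0)"
  by (simp add: specialize_def)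

lemma weight_add: "weight (a + b) i = weight a i + weight b i"
  by (simp add: weight_def lookup_add algebra_simps sum.distrib)

text \<open>
  A monomial in the variables of indices \<open>n + 1, \<dots>, n + n\<close> shifts degrees by its weight, and the shift of
  \<open>\<gamma>\<close> also accounts for its image under the substitution. Thus the specialization is semilinear over the
  ground ring.
\<close>

lemma specialize_single_mult:
  assumes b: "Poly_Mapping.keys b \<subseteq> {n + 1..n + n}"
  shows "specialize \<gamma> (Poly_Mapping.single b c * f) =
    Poly_Mapping.single 0 c * specialize (\<lambda>i. \<gamma> i + weight b i) f"
proof -
  have b0: "Poly_Mapping.lookup b i = 0" if "i \<in> {1..n}" for i
  proof -
    have "i \<notin> Poly_Mapping.keys b" using b that by auto
    then show ?thesis by (simp add: in_keys_iff)
  qed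
  have single_mult: "specialize \<gamma> (Poly_Mapping.single b c * Poly_Mapping.single a d) =
      Poly_Mapping.single 0 c * specialize (\<lambda>i. \<gamma> i + weight b i) (Poly_Mapping.single a d)" for a d
  proof -
    have "homogeneous \<gamma> (b + a) \<longleftrightarrow> homogeneous (\<lambda>i. \<gamma> i + weight b i) a"
      using b0 by (auto simp: homogeneous_def weight_add lookup_add)
    then show ?thesis
      by (simp add: mult_single specialize_single weight_add add_ac)
  qed
  let ?s = "\<lambda>a. Poly_Mapping.single a (Poly_Mapping.lookup f a)"
  have "specialize \<gamma> (Poly_Mapping.single b c * (\<Sum>a\<in>Poly_Mapping.keys f. ?s a)) =
      Poly_Mapping.single 0 c * specialize (\<lambda>i. \<gamma> i + weight b i) (\<Sum>a\<in>Poly_Mapping.keys f. ?s a)"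
    by (simp only: sum_distrib_left specialize_sum single_mult)
  then show ?thesis by (simp only: poly_mapping_eq_sum_single[symmetric])
qed

lemma specialize_mult_in_span:
  assumes r: "r \<in> laurent_ring {n + 1..n + n}"
    and f: "\<And>\<gamma>. specialize \<gamma> f \<in> laurent_span n m S"
  shows "specialize \<gamma> (r * f) \<in> laurent_span n m S"
proof -
  have "r * f = (\<Sum>b\<in>Poly_Mapping.keys r. Poly_Mapping.single b (Poly_Mapping.lookup r b)) * f"
    by (simp only: poly_mapping_eq_sum_single[symmetric])
  then have "specialize \<gamma> (r * f) =
      (\<Sum>b\<in>Poly_Mapping.keys r. specialize \<gamma> (Poly_Mapping.single b (Poly_Mapping.lookup r b) * f))"
    by (simp only: sum_distrib_right specialize_sum)
  also have "\<dots> \<in> laurent_span n m S"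
  proof (rule laurent_span_sum)
    fix b assume "b \<in> Poly_Mapping.keys r"
    then have "Poly_Mapping.keys b \<subseteq> {n + 1..n + n}" using r by (auto simp: laurent_ring_def)
    then show "specialize \<gamma> (Poly_Mapping.single b (Poly_Mapping.lookup r b) * f) \<in> laurent_span n m S"
      using f by (auto simp: specialize_single_mult intro!: laurent_span_mult laurent_ring_single)
  qed
  finally show ?thesis .
qed

lemma cc_sum_eq:
  "cc_sum n N B g Gr = (\<Sum>e | (\<forall>i. i \<notin> {1..n} \<longrightarrow> e i = 0) \<and> euler_char (Gr e) \<noteq> 0.
    Poly_Mapping.single (exponent N (\<lambda>i. (\<Sum>j = 1..n. B i j * int (e j)) + g i)) (of_int (euler_char (Gr e))))"
  unfolding cc_sum_def
  by (intro sum.cong refl) (simp add: monomial_eq_single single_of_int[symmetric] mult_single del: single_of_int)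

lemma cc_sum_in_laurent_ring: "cc_sum n N B g Gr \<in> laurent_ring {1..N}"
  unfolding cc_sum_eq
  by (intro laurent_ring_sum laurent_ring_single) (auto simp: keys_exponent)

definition prin_matrix :: "nat \<Rightarrow> nat \<Rightarrow> int" where
  "prin_matrix i j = (if i \<le> n then Bt i j else if i = n + j then 1 else 0)"

text \<open>
  In a Caldero--Chapoton function with principal coefficients, the contribution of the dimension vector
  \<open>e\<close> to the exponents at \<open>{1..n}\<close> equals the weight of its contribution to the other exponents. So the
  function is homogeneous, and specialization either annihilates it or turns it into the function for
  \<open>Bt\<close> up to a monomial. The vector \<open>\<delta>\<close> is the weight of the entries of \<open>g\<close> at the additional vertices.
\<close>

lemma specialize_cc_sum:
  assumes gh: "\<And>i. i \<in> {1..n} \<Longrightarrow> g i = h i"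
  defines "\<delta> \<equiv> \<lambda>i. (\<Sum>j = 1..n. Bt i j * g (n + j))"
  shows "specialize \<gamma> (cc_sum n (n + n) prin_matrix g Gr) =
    (if \<forall>i\<in>{1..n}. g i = \<delta> i + \<gamma> i
     then monomial (n + m) (\<lambda>i. \<delta> i + \<gamma> i - h i) * cc_sum n (n + m) Bt h Gr else 0)"
proof -
  define a where "a e = exponent (n + n) (\<lambda>i. (\<Sum>j = 1..n. prin_matrix i j * int (e j)) + g i)"
    for e :: "nat \<Rightarrow> nat"
  have lookup_mutable: "Poly_Mapping.lookup (a e) i = (\<Sum>j = 1..n. Bt i j * int (e j)) + g i"
    if "i \<in> {1..n}" for e i
    using that by (simp add: a_def lookup_exponent prin_matrix_def)
  have lookup_frozen: "Poly_Mapping.lookup (a e) (n + j) = int (e j) + g (n + j)" if j: "j \<in> {1..n}" for e j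
  proof -
    have "(\<Sum>k = 1..n. prin_matrix (n + j) k * int (e k)) = (\<Sum>k = 1..n. if k = j then int (e j) else 0)"
      using j by (intro sum.cong) (auto simp: prin_matrix_def)
    then show ?thesis using j by (simp add: a_def lookup_exponent)
  qed
  have weight: "weight (a e) i = (\<Sum>j = 1..n. Bt i j * int (e j)) + \<delta> i" for e i
    unfolding weight_def \<delta>_def sum.distrib[symmetric]
    by (intro sum.cong refl) (simp add: lookup_frozen distrib_left)
  define deg where "deg \<longleftrightarrow> (\<forall>i\<in>{1..n}. g i = \<delta> i + \<gamma> i)"
  have hom: "homogeneous \<gamma> (a e) \<longleftrightarrow> deg" for e
    by (auto simp: homogeneous_def lookup_mutable weight deg_def)
  have single: "specialize \<gamma> (Poly_Mapping.single (a e) c) = (if deg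
      then monomial (n + m) (\<lambda>i. \<delta> i + \<gamma> i - h i) *
        Poly_Mapping.single (exponent (n + m) (\<lambda>i. (\<Sum>j = 1..n. Bt i j * int (e j)) + h i)) c else 0)"
    for e c
    by (simp add: specialize_single hom weight monomial_eq_single mult_single exponent_add algebra_simps)
  show ?thesis
    unfolding cc_sum_eq specialize_sum a_def[symmetric] single deg_def[symmetric]
    by (cases deg) (simp_all add: sum_distrib_left)
qed

text \<open>
  The Laurent polynomials all of whose specializations lie in the span of the functions for \<open>Bt\<close> form a
  module over the ground ring of principal coefficients. It contains the functions indexed by \<open>S\<close>: the
  monomial by which a specialization differs from the function for \<open>Bt\<close> has exponent zero at \<open>{1..n}\<close>,
  because \<open>g\<close> and \<open>h\<close> agree there. Hence it contains the function indexed by \<open>N\<close>, and in the right degree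
  this one specializes to the function for \<open>Bt\<close> itself.
\<close>

theorem cc_sum_in_span_if_prin:
  fixes g h :: "'k \<Rightarrow> nat \<Rightarrow> int" and Gr :: "'k \<Rightarrow> (nat \<Rightarrow> nat) \<Rightarrow> 'x topology"
  assumes gh: "\<And>k i. k \<in> insert N S \<Longrightarrow> i \<in> {1..n} \<Longrightarrow> g k i = h k i"
    and N: "cc_sum n (n + n) prin_matrix (g N) (Gr N) \<in>
      laurent_span n n ((\<lambda>k. cc_sum n (n + n) prin_matrix (g k) (Gr k)) ` S)"
  shows "cc_sum n (n + m) Bt (h N) (Gr N) \<in> laurent_span n m ((\<lambda>k. cc_sum n (n + m) Bt (h k) (Gr k)) ` S)"
proof -
  let ?S = "laurent_span n m ((\<lambda>k. cc_sum n (n + m) Bt (h k) (Gr k)) ` S)"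
  let ?W = "{f \<in> laurent_ring {1..n + n}. \<forall>\<gamma>. specialize \<gamma> f \<in> ?S}"
  let ?\<delta> = "\<lambda>k i. (\<Sum>j = 1..n. Bt i j * g k (n + j))"
  have "laurent_span n n ((\<lambda>k. cc_sum n (n + n) prin_matrix (g k) (Gr k)) ` S) \<subseteq> ?W"
  proof (rule laurent_span_minimal)
    show "(\<lambda>k. cc_sum n (n + n) prin_matrix (g k) (Gr k)) ` S \<subseteq> ?W"
    proof (intro image_subsetI CollectI conjI allI cc_sum_in_laurent_ring)
      fix k \<gamma> assume k: "k \<in> S"
      let ?c = "\<forall>i\<in>{1..n}. g k i = ?\<delta> k i + \<gamma> i"
      let ?u = "monomial (n + m) (\<lambda>i. ?\<delta> k i + \<gamma> i - h k i)"
      have "?u * cc_sum n (n + m) Bt (h k) (Gr k) \<in> ?S" if c: ?c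
      proof (rule laurent_span_mult)
        have "i \<in> {n + 1..n + m}" if i: "i \<in> {1..n + m}" and nz: "?\<delta> k i + \<gamma> i - h k i \<noteq> 0" for i
        proof (rule ccontr)
          assume "i \<notin> {n + 1..n + m}"
          with i have i': "i \<in> {1..n}" by auto
          have "g k i = h k i" by (rule gh[OF _ i']) (use k in simp)
          with bspec[OF c i'] nz show False by simp
        qed
        then have "Poly_Mapping.keys (exponent (n + m) (\<lambda>i. ?\<delta> k i + \<gamma> i - h k i)) \<subseteq> {n + 1..n + m}"
          unfolding keys_exponent by (intro subsetI, elim CollectE conjE)
        then show "?u \<in> laurent_ring {n + 1..n + m}"
          unfolding monomial_eq_single by (rule laurent_ring_single)
        show "cc_sum n (n + m) Bt (h k) (Gr k) \<in> ?S"
          by (rule subsetD[OF laurent_span_superset]) (rule imageI[OF k])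
      qed
      then have "(if ?c then ?u * cc_sum n (n + m) Bt (h k) (Gr k) else 0) \<in> ?S"
        by (simp only: laurent_span_zero split: if_split) simp
      moreover have "specialize \<gamma> (cc_sum n (n + n) prin_matrix (g k) (Gr k)) =
          (if ?c then ?u * cc_sum n (n + m) Bt (h k) (Gr k) else 0)"
        by (rule specialize_cc_sum, rule gh) (use k in simp_all)
      ultimately show "specialize \<gamma> (cc_sum n (n + n) prin_matrix (g k) (Gr k)) \<in> ?S"
        by simp
    qed
    show "r * f \<in> ?W" if "r \<in> laurent_ring {n + 1..n + n}" "f \<in> ?W" for r f
      using that laurent_ring_mono[of "{n + 1..n + n}" "{1..n + n}"]
      by (auto intro!: laurent_ring_mult specialize_mult_in_span)
  qed (auto simp: laurent_ring_zero laurent_ring_add specialize_zero specialize_add laurent_span_zero laurent_span_add)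
  then have "specialize (\<lambda>i. h N i - ?\<delta> N i) (cc_sum n (n + n) prin_matrix (g N) (Gr N)) \<in> ?S"
    using N by blast
  moreover have "specialize (\<lambda>i. h N i - ?\<delta> N i) (cc_sum n (n + n) prin_matrix (g N) (Gr N)) =
      cc_sum n (n + m) Bt (h N) (Gr N)"
  proof -
    have "monomial (n + m) (\<lambda>i. 0) = 1"
    proof -
      have "exponent (n + m) (\<lambda>i. 0) = 0" by (rule poly_mapping_eqI) (simp add: lookup_exponent)
      then show ?thesis by (simp add: monomial_eq_single)
    qed
    moreover have "specialize (\<lambda>i. h N i - ?\<delta> N i) (cc_sum n (n + n) prin_matrix (g N) (Gr N)) =
        (if \<forall>i\<in>{1..n}. g N i = ?\<delta> N i + (h N i - ?\<delta> N i)
         then monomial (n + m) (\<lambda>i. ?\<delta> N i + (h N i - ?\<delta> N i) - h N i) * cc_sum n (n + m) Bt (h N) (Gr N) else 0)"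
      by (rule specialize_cc_sum, rule gh) simp_all
    ultimately show ?thesis using gh[of N] by simp
  qed
  ultimately show ?thesis by simp
qed

end

section \<open>Comparison of Caldero--Chapoton functions\<close>

lemma b_matrix_prin_eq: "b_matrix_prin n Qt = prin_matrix n (b_matrix Qt)"
  by (auto simp: b_matrix_prin_def prin_matrix_def fun_eq_iff)

context ice_quiver
begin

theorem CC_in_span_if_CC_prin:
  fixes N :: "('a, 'v) decorated" and S :: "('a, 'v) decorated set"
  assumes S: "S \<subseteq> supported_reps n Q J" and N: "N \<in> supported_reps n Q J"
    and span: "CC_prin n Qt Jt N \<in> laurent_span n n (CC_prin n Qt Jt ` S)"
  shows "CC n m Qt Jt N \<in> laurent_span n m (CC n m Qt Jt ` S)"
proof -
  let ?g = "\<lambda>X :: ('a, 'v) decorated. g_vector Qp (prin_ideal n Q J) (prin_inflate n X)"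
  let ?h = "\<lambda>X :: ('a, 'v) decorated. g_vector Qt Jt (inflate n Qt X)"
  let ?Gr = "\<lambda>X :: ('a, 'v) decorated. quiver_grassmannian Q J (fst X)"
  have "?g X i = ?h X i" if X: "X \<in> insert N S" and i: "i \<in> {1..n}" for X i
  proof -
    obtain M v where X': "X = (M, v)" "(M, v) \<in> supported_reps n Q J"
      using X S N by (cases X) auto
    show ?thesis
      unfolding X'(1) g_vector_inflate[OF X'(2) i] g_vector_prin_inflate[OF X'(2) i] ..
  qed
  from cc_sum_in_span_if_prin[of N S n ?g ?h "b_matrix Qt" ?Gr, OF this] span
  show ?thesis
    unfolding CC_def[abs_def] CC_prin_def[abs_def] Let_def b_matrix_prin_eq by simp
qed

lemma CC_in_laurent_ring: "CC n m Qt Jt N \<in> laurent_ring {1..n + m}"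
  unfolding CC_def by (rule cc_sum_in_laurent_ring)

end

theorem theorem1p6:
  fixes n m :: nat
    and Qt :: "(nat, 'a) pre_digraph"
    and Jt :: "'a path_series set"
    and MM :: "('a, 'v) decorated set"
  assumes "n \<ge> 1"
    and "fin_digraph Qt" and "verts Qt = {1..n + m}"
    and "ideal Jt (path_algebra Qt)"
    and "closedin (adic_topology (path_algebra Qt) (arrow_ideal Qt)) Jt"
    and "Jt \<subseteq> ideal_power (path_algebra Qt) (arrow_ideal Qt) 2"
    and "MM \<subseteq> supported_reps n (mutable_part n Qt) (rho n Qt ` Jt)"
  shows "(\<forall>N \<in> supported_reps n (mutable_part n Qt) (rho n Qt ` Jt) :: ('a, 'v) decorated set.
            CC_prin n Qt Jt N \<in> laurent_span n n (CC_prin n Qt Jt ` MM) \<longrightarrow>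
            CC n m Qt Jt N \<in> laurent_span n m (CC n m Qt Jt ` MM)) \<and>
         (laurent_span n n (CC_prin n Qt Jt ` MM) = CC_algebra_prin n Qt Jt TYPE('v) \<longrightarrow>
          laurent_span n m (CC n m Qt Jt ` MM) = CC_algebra n m Qt Jt TYPE('v))"
proof -
  interpret ice_quiver n m Qt Jt
    using assms by (intro ice_quiver.intro ice_quiver_axioms.intro)
  let ?reps = "supported_reps n Q J :: ('a, 'v) decorated set"
  have 1: "CC n m Qt Jt N \<in> laurent_span n m (CC n m Qt Jt ` MM)"
    if "N \<in> ?reps" "CC_prin n Qt Jt N \<in> laurent_span n n (CC_prin n Qt Jt ` MM)" for N
    by (rule CC_in_span_if_CC_prin[OF assms(7) that])
  have "laurent_span n m (CC n m Qt Jt ` MM) = laurent_span n m (CC n m Qt Jt ` ?reps)"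
    if "laurent_span n n (CC_prin n Qt Jt ` MM) = CC_algebra_prin n Qt Jt TYPE('v)"
  proof (rule laurent_span_eq_if_subset)
    show "CC n m Qt Jt ` MM \<subseteq> CC n m Qt Jt ` ?reps" using assms(7) by (rule image_mono)
    show "CC n m Qt Jt ` ?reps \<subseteq> laurent_span n m (CC n m Qt Jt ` MM)"
    proof (rule image_subsetI)
      fix N assume N: "N \<in> ?reps"
      then have "CC_prin n Qt Jt N \<in> laurent_span n n (CC_prin n Qt Jt ` ?reps)"
        using laurent_span_superset by blast
      then have "CC_prin n Qt Jt N \<in> laurent_span n n (CC_prin n Qt Jt ` MM)"
        using that by (simp add: CC_algebra_prin_def)
      then show "CC n m Qt Jt N \<in> laurent_span n m (CC n m Qt Jt ` MM)" by (rule 1[OF N])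
    qed
    show "CC n m Qt Jt ` MM \<subseteq> laurent_ring {1..n + m}" using CC_in_laurent_ring by blast
  qed
  with 1 show ?thesis by (simp add: CC_algebra_def)
qed

end
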